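(* Consider two samples $X_i(t)=\mu(t)+\varepsilon_i(t)$, $1\le i\le N$, and $X^*_j(t)=\mu^*(t)+\varepsilon^*_j(t)$, $1\le j\le M$, $t\in[0,1]$, with $\mu,\mu^*\in L^2([0,1])$. Suppose $(\varepsilon_i)$ satisfies: $\varepsilon_i=f(\delta_i,\delta_{i-1},\ldots)$ with $(\delta_i)$ i.i.d. in a measurable space $S$ and $f:S^\infty\to L^2$ measurable; $\sum_{m\ge1}(E\int_0^1(\varepsilon_i(t)-\varepsilon_{i,m}(t))^2dt)^{1/2}<\infty$, where $\varepsilon_{i,m}=f(\delta_i,\ldots,\delta_{i-m+1},\delta^{(m)}_{i,i-m},\delta^{(m)}_{i,i-m-1},\ldots)$ with $(\delta^{(m)}_{i,k})_k$ independent copies of $(\delta_k)$; $E\varepsilon_0=0$ in $L^2$; $\int_0^1E\varepsilon_0^2(t)dt<\infty$. Suppose $(\varepsilon^*_j)$ satisfies the same conditions (with its own i.i.d. sequence and function $f^*$). Suppose $\{\varepsilon_i,1\le i\le N\}$ and $\{\varepsilon^*_j,1\le j\le M\}$ are independent, that $H_0:\mu=\mu^*$ (in $L^2$) holds, and that $N/(N+M)\to\theta$ for some $0\le\theta\le1$ as $\min(M,N)\to\infty$. Let $\bar X_N=N^{-1}\sum_{i=1}^NX_i$, $\bar X^*_M=M^{-1}\sum_{j=1}^MX^*_j$ and $$U_{N,M}=\frac{NM}{N+M}\int_0^1(\bar X_N(t)-\bar X^*_M(t))^2dt.$$ Then $U_{N,M}\to\int_0^1\Gamma^2(t)dt$ in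 distribution as $\min(M,N)\to\infty$, where $\{\Gamma(t),0\le t\le1\}$ is a mean zero Gaussian process with $E[\Gamma(t)\Gamma(s)]=d(t,s):=(1-\theta)c(t,s)+\theta c^*(t,s)$, with $c(t,s)=E\varepsilon_0(t)\varepsilon_0(s)+\sum_{i\ge1}E\varepsilon_0(t)\varepsilon_i(s)+\sum_{i\ge1}E\varepsilon_0(s)\varepsilon_i(t)$ and $c^*$ defined identically in terms of the $\varepsilon^*_j$.
   Context: $L^2=L^2([0,1])$. Equality $\mu=\mu^*$ means $\int_0^1(\mu(t)-\mu^*(t))^2dt=0$. *)

theory Defs
  imports "HOL-Probability.Probability"
begin

text \<open>Square-integrable (Borel) functions on [0,1]; elements of L^2([0,1]) are represented
  by such functions, equality in L^2 being a.e. equality.\<close>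
definition L2 :: "(real \<Rightarrow> real) set" where
  "L2 = {g. g \<in> borel_measurable borel \<and> set_integrable lborel {0..1} (\<lambda>t. (g t)^2)}"

definition bernoulli_shift ::
  "'a measure \<Rightarrow> 's measure \<Rightarrow> (int \<Rightarrow> 'a \<Rightarrow> 's) \<Rightarrow> ((nat \<Rightarrow> 's) \<Rightarrow> real \<Rightarrow> real)
     \<Rightarrow> (int \<Rightarrow> 'a \<Rightarrow> real \<Rightarrow> real) \<Rightarrow> bool" where
  "bernoulli_shift M S \<delta> f eps \<longleftrightarrow>
     prob_space.indep_vars M (\<lambda>_. S) \<delta> UNIV \<and>
     (\<forall>i. distr M S (\<delta> i) = distr M S (\<delta> 0)) \<and>
     (\<lambda>(x, t). f x t) \<in> borel_measurable (PiM UNIV (\<lambda>_. S) \<Otimes>\<^sub>M lborel) \<and>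
     (\<forall>x \<in> space (PiM UNIV (\<lambda>_. S)). f x \<in> L2) \<and>
     (\<forall>i. \<forall>\<omega>\<in>space M. eps i \<omega> = f (\<lambda>k. \<delta> (i - int k) \<omega>))"

text \<open>E int_0^1 (eps_i(t) - eps_{i,m}(t))^2 dt, where eps_{i,m} replaces
  delta_{i-m}, delta_{i-m-1}, ... by an independent copy.  Since the delta's are i.i.d.
  with law P and the copy is independent, this expectation is the integral below
  (x k plays delta_{i-k}, y k plays the copy delta^{(m)}_{i,i-k}).\<close>
definition approx_err :: "'s measure \<Rightarrow> ((nat \<Rightarrow> 's) \<Rightarrow> real \<Rightarrow> real) \<Rightarrow> nat \<Rightarrow> ennreal" where
  "approx_err P f m =
     (\<integral>\<^sup>+ x. \<integral>\<^sup>+ y. \<integral>\<^sup>+ t. indicator {0..1} t *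
         ennreal ((f x t - f (\<lambda>k. if k < m then x k else y k) t)^2) \<partial>lborel
       \<partial>PiM UNIV (\<lambda>_. P) \<partial>PiM UNIV (\<lambda>_. P))"

definition error_assumptions ::
  "'a measure \<Rightarrow> 's measure \<Rightarrow> (int \<Rightarrow> 'a \<Rightarrow> 's) \<Rightarrow> ((nat \<Rightarrow> 's) \<Rightarrow> real \<Rightarrow> real)
     \<Rightarrow> (int \<Rightarrow> 'a \<Rightarrow> real \<Rightarrow> real) \<Rightarrow> bool" where
  "error_assumptions M S \<delta> f eps \<longleftrightarrow>
     bernoulli_shift M S \<delta> f eps \<and>
     (\<forall>m\<ge>1. approx_err (distr M S (\<delta> 0)) f m < \<infinity>) \<and>
     summable (\<lambda>m. sqrt (enn2real (approx_err (distr M S (\<delta> 0)) f (Suc m)))) \<and>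
     (AE t in lborel. t \<in> {0..1} \<longrightarrow> (\<integral>\<omega>. eps 0 \<omega> t \<partial>M) = 0) \<and>
     (\<integral>\<^sup>+ t. indicator {0..1} t * (\<integral>\<^sup>+ \<omega>. ennreal ((eps 0 \<omega> t)^2) \<partial>M) \<partial>lborel) < \<infinity>"

definition lrcov :: "'a measure \<Rightarrow> (int \<Rightarrow> 'a \<Rightarrow> real \<Rightarrow> real) \<Rightarrow> real \<Rightarrow> real \<Rightarrow> real" where
  "lrcov M eps t s =
     (\<integral>\<omega>. eps 0 \<omega> t * eps 0 \<omega> s \<partial>M)
     + (\<Sum>i. \<integral>\<omega>. eps 0 \<omega> t * eps (int i + 1) \<omega> s \<partial>M)
     + (\<Sum>i. \<integral>\<omega>. eps 0 \<omega> s * eps (int i + 1) \<omega> t \<partial>M)"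

text \<open>Mean zero Gaussian process on [0,1] (jointly measurable) with covariance d:
  every finite linear combination of values is centred normal (characteristic function
  exp(-u^2 v/2), v its second moment; v = 0 allowed), and E G(t)G(s) = d(t,s) for almost
  every (t,s) in [0,1]^2 (d is a kernel in L^2, defined only almost everywhere).\<close>
definition gaussian_process :: "'b measure \<Rightarrow> ('b \<Rightarrow> real \<Rightarrow> real) \<Rightarrow> (real \<Rightarrow> real \<Rightarrow> real) \<Rightarrow> bool" where
  "gaussian_process \<Omega> G d \<longleftrightarrow>
     prob_space \<Omega> \<and>
     (\<lambda>(\<omega>, t). G \<omega> t) \<in> borel_measurable (\<Omega> \<Otimes>\<^sub>M lborel) \<and>
     (\<forall>n (T :: nat \<Rightarrow> real) (a :: nat \<Rightarrow> real). (\<forall>k<n. T k \<in> {0..1}) \<longrightarrow>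
        integrable \<Omega> (\<lambda>\<omega>. (\<Sum>k<n. a k * G \<omega> (T k))^2) \<and>
        (\<integral>\<omega>. (\<Sum>k<n. a k * G \<omega> (T k)) \<partial>\<Omega>) = 0 \<and>
        (\<forall>u. char (distr \<Omega> borel (\<lambda>\<omega>. \<Sum>k<n. a k * G \<omega> (T k))) u =
              complex_of_real (exp (- (u^2 * (\<integral>\<omega>. (\<Sum>k<n. a k * G \<omega> (T k))^2 \<partial>\<Omega>)) / 2)))) \<and>
     (AE t in lborel. AE s in lborel. t \<in> {0..1} \<longrightarrow> s \<in> {0..1} \<longrightarrow>
        (\<integral>\<omega>. G \<omega> t * G \<omega> s \<partial>\<Omega>) = d t s)"

definition U_stat :: "(int \<Rightarrow> 'a \<Rightarrow> real \<Rightarrow> real) \<Rightarrow> (int \<Rightarrow> 'a \<Rightarrow> real \<Rightarrow> real) \<Rightarrow> nat \<Rightarrow> nat \<Rightarrow> 'a \<Rightarrow> real" where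
  "U_stat X Xs N K \<omega> =
     (real N * real K / (real N + real K)) *
     (LINT t:{0..1}|lborel. ((\<Sum>i=1..int N. X i \<omega> t) / real N - (\<Sum>j=1..int K. Xs j \<omega> t) / real K)^2)"

end

theory Submission
  imports Defs
begin

text \<open>Under the hypothesis \<open>\<mu> = \<mu>s\<close> the statistic is the squared norm of the normalized difference \<open>D\<close>
  of the two error sums. Tested against a square-integrable function \<open>h\<close>, each error sequence becomes a
  real Bernoulli shift with summable coupling errors: averaging over the innovations that are more than
  \<open>m\<close> steps old leaves \<open>m\<close>-dependent variables, to which a blocking argument applies, and this gives a
  central limit theorem whose variance is the quadratic form of the long-run covariance at \<open>h\<close>.
  Expanding \<open>D\<close> in the Haar basis, the variances of the coefficients are bounded by a fixed summable
  sequence, so the squared norm is approximated uniformly by finitely many squared coefficients. Weak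
  convergence is proved through Laplace transforms: randomising the frequency by Gaussian variables
  writes the Laplace transform of a finite sum of squares as an average of characteristic functions of
  linear combinations. The limiting process is constructed as a series in the Haar basis whose Gaussian
  coefficients come from the Cholesky decomposition of the covariance; conversely, every process with
  this covariance has Gaussian Haar coefficients because its integrals are limits of Riemann sums over
  suitable points.\<close>

section \<open>Limits of real sequences\<close>

lemma Cesaro_mean_tendsto:
  fixes a :: "nat \<Rightarrow> real"
  assumes "a \<longlonglongrightarrow> L"
  shows "(\<lambda>n. (\<Sum>i<n. a i) / real n) \<longlonglongrightarrow> L"
proof (rule LIMSEQ_I)
  fix e :: real assume e: "0 < e"
  obtain n0 where n0: "\<And>n. n \<ge> n0 \<Longrightarrow> \<bar>a n - L\<bar> < e / 2"
    using LIMSEQ_D[OF assms, of "e / 2"] e by auto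
  define C where "C = (\<Sum>i<n0. \<bar>a i - L\<bar>)"
  obtain n1 :: nat where n1: "2 * C / e < real n1" using reals_Archimedean2 by blast
  show "\<exists>no. \<forall>n\<ge>no. norm ((\<Sum>i<n. a i) / real n - L) < e"
  proof (intro exI allI impI)
    fix n assume n: "n \<ge> max (max n0 n1) 1"
    have "(\<Sum>i<n. a i) / real n - L = (\<Sum>i<n. a i - L) / real n"
      using n by (simp add: sum_subtractf field_simps)
    also have "\<bar>\<dots>\<bar> \<le> (\<Sum>i<n. \<bar>a i - L\<bar>) / real n"
      using sum_abs[of "\<lambda>i. a i - L" "{..<n}"] by (simp add: divide_right_mono)
    also have "(\<Sum>i<n. \<bar>a i - L\<bar>) = C + (\<Sum>i=n0..<n. \<bar>a i - L\<bar>)"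
      unfolding C_def using n sum.atLeastLessThan_concat[of 0 n0 n "\<lambda>i. \<bar>a i - L\<bar>"]
      by (simp add: atLeast0LessThan)
    also have "(\<Sum>i=n0..<n. \<bar>a i - L\<bar>) \<le> (\<Sum>i=n0..<n. e / 2)"
      using n0 by (intro sum_mono) (auto intro: less_imp_le)
    also have "\<dots> \<le> real n * (e / 2)" using e by (simp add: mult_right_mono)
    finally have "\<bar>(\<Sum>i<n. a i) / real n - L\<bar> \<le> (C + real n * (e / 2)) / real n"
      using n by (simp add: divide_right_mono)
    also have "\<dots> = C / real n + e / 2" using n by (simp add: field_simps)
    also have "C / real n < e / 2"
    proof -
      have "2 * C / e < real n" using n1 n by simp
      then show ?thesis using e n by (simp add: field_simps)
    qed
    finally show "norm ((\<Sum>i<n. a i) / real n - L) < e" by simp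
  qed
qed

lemma tendsto_uniform_approximation:
  fixes x :: "nat \<Rightarrow> 'a::real_normed_vector"
  assumes approx: "\<And>J. \<forall>\<^sub>F k in sequentially. norm (x k - y J k) \<le> err J k"
    and err: "\<And>J. err J \<longlonglongrightarrow> lim_err J" "lim_err \<longlonglongrightarrow> 0"
    and y: "\<And>J. y J \<longlonglongrightarrow> z J" and z: "z \<longlonglongrightarrow> L"
  shows "x \<longlonglongrightarrow> L"
proof (rule tendstoI)
  fix r :: real assume r: "0 < r"
  have "\<forall>\<^sub>F J in sequentially. lim_err J < r / 3 \<and> dist (z J) L < r / 3"
    using r by (intro eventually_conj order_tendstoD(2)[OF err(2)] tendstoD[OF z]) auto
  then obtain J where J: "lim_err J < r / 3" "dist (z J) L < r / 3"
    unfolding eventually_sequentially by blast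
  have "\<forall>\<^sub>F k in sequentially. dist (y J k) (z J) < r / 3"
    using r by (intro tendstoD[OF y]) simp
  with order_tendstoD(2)[OF err(1) J(1)] approx[of J]
  show "\<forall>\<^sub>F k in sequentially. dist (x k) L < r"
  proof eventually_elim
    case (elim k)
    have "dist (x k) L \<le> dist (x k) (y J k) + dist (y J k) (z J) + dist (z J) L"
      using dist_triangle[of "x k" L "y J k"] dist_triangle[of "y J k" L "z J"] by linarith
    then show ?case using elim J(2) by (simp add: dist_norm)
  qed
qed

lemma sums_minus_partial_sum_le:
  fixes x y :: "nat \<Rightarrow> real"
  assumes x: "x sums s" and y: "summable y" and termwise_le: "\<And>j. x j \<le> y j"
  shows "s - (\<Sum>j<n. x j) \<le> (\<Sum>j. y (j + n))"
proof -
  have "s - (\<Sum>j<n. x j) = (\<Sum>j. x (j + n))"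
    using suminf_minus_initial_segment[OF sums_summable[OF x], of n] sums_unique[OF x] by simp
  also have "\<dots> \<le> (\<Sum>j. y (j + n))"
    using summable_ignore_initial_segment[OF sums_summable[OF x]] summable_ignore_initial_segment[OF y]
        termwise_le
    by (intro suminf_le) auto
  finally show ?thesis .
qed

lemma sums_if_suminf_ennreal_eq:
  assumes "\<And>j. 0 \<le> y j" "0 \<le> s" "(\<Sum>j. ennreal (y j)) = ennreal s"
  shows "y sums s"
proof -
  have "summable y" by (rule summable_suminf_not_top) (use assms in auto)
  then have "ennreal (suminf y) = ennreal s"
    using suminf_ennreal_eq[OF assms(1) summable_sums] assms(3) by simp
  then have "suminf y = s" using assms(1,2) suminf_nonneg[OF \<open>summable y\<close>] by simp
  then show ?thesis using summable_sums[OF \<open>summable y\<close>] by simp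
qed

lemma summable_if_SUP_square_partial_sums_finite:
  fixes a :: "nat \<Rightarrow> real"
  assumes SUP_finite: "(SUP n. ennreal ((\<Sum>l<n. \<bar>a l\<bar>)\<^sup>2)) \<noteq> \<infinity>"
  shows "summable (\<lambda>l. \<bar>a l\<bar>)"
    and "ennreal ((\<Sum>l. a l)\<^sup>2) \<le> (SUP n. ennreal ((\<Sum>l<n. \<bar>a l\<bar>)\<^sup>2))"
proof -
  obtain r where r: "(SUP n. ennreal ((\<Sum>l<n. \<bar>a l\<bar>)\<^sup>2)) = ennreal r" "0 \<le> r"
    using SUP_finite by (metis ennreal_cases infinity_ennreal_def)
  have partial_sum_le: "(\<Sum>l<n. \<bar>a l\<bar>) \<le> sqrt r" for n
  proof -
    have "ennreal ((\<Sum>l<n. \<bar>a l\<bar>)\<^sup>2) \<le> ennreal r"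
      unfolding r(1)[symmetric] by (intro SUP_upper) auto
    then show ?thesis using r(2) by (simp add: real_le_rsqrt)
  qed
  then show abs_summable: "summable (\<lambda>l. \<bar>a l\<bar>)" by (intro summableI_nonneg_bounded) auto
  have "\<bar>\<Sum>l. a l\<bar> \<le> (\<Sum>l. \<bar>a l\<bar>)" by (rule summable_rabs[OF abs_summable])
  also have "\<dots> \<le> sqrt r" by (rule suminf_le_const[OF abs_summable partial_sum_le])
  finally have "\<bar>\<Sum>l. a l\<bar>\<^sup>2 \<le> (sqrt r)\<^sup>2" by (rule power_mono) simp
  then show "ennreal ((\<Sum>l. a l)\<^sup>2) \<le> (SUP n. ennreal ((\<Sum>l<n. \<bar>a l\<bar>)\<^sup>2))"
    unfolding r(1) using r(2) by (intro ennreal_leI) simp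
qed

section \<open>Square-integrable functions\<close>

definition square_integrable :: "'a measure \<Rightarrow> ('a \<Rightarrow> real) \<Rightarrow> bool" where
  "square_integrable M f \<longleftrightarrow> f \<in> borel_measurable M \<and> integrable M (\<lambda>x. (f x)\<^sup>2)"

definition l2norm :: "'a measure \<Rightarrow> ('a \<Rightarrow> real) \<Rightarrow> real" where
  "l2norm M f = sqrt (\<integral>x. (f x)\<^sup>2 \<partial>M)"

lemma borel_measurable_square_integrable[measurable_dest]:
  "square_integrable M f \<Longrightarrow> f \<in> borel_measurable M"
  and integrable_square: "square_integrable M f \<Longrightarrow> integrable M (\<lambda>x. (f x)\<^sup>2)"
  by (auto simp: square_integrable_def)

lemma l2norm_cong: "(\<And>x. x \<in> space M \<Longrightarrow> f x = g x) \<Longrightarrow> l2norm M f = l2norm M g"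
  unfolding l2norm_def by (intro arg_cong[where f = sqrt] Bochner_Integration.integral_cong) auto

lemma l2norm_cong_AE:
  assumes "f \<in> borel_measurable M" "g \<in> borel_measurable M" "AE x in M. f x = g x"
  shows "l2norm M f = l2norm M g"
  unfolding l2norm_def using assms by (intro arg_cong[where f = sqrt] integral_cong_AE) auto

lemma l2norm_nonneg[simp]: "0 \<le> l2norm M f"
  by (simp add: l2norm_def)

lemma l2norm_square: "(l2norm M f)\<^sup>2 = (\<integral>x. (f x)\<^sup>2 \<partial>M)"
  by (simp add: l2norm_def)

lemma l2norm_zero[simp]: "l2norm M (\<lambda>x. 0) = 0"
  by (simp add: l2norm_def)

lemma l2norm_abs[simp]: "l2norm M (\<lambda>x. \<bar>f x\<bar>) = l2norm M f"
  by (simp add: l2norm_def)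

lemma l2norm_uminus[simp]: "l2norm M (\<lambda>x. - f x) = l2norm M f"
  by (simp add: l2norm_def)

lemma l2norm_minus_commute: "l2norm M (\<lambda>x. f x - g x) = l2norm M (\<lambda>x. g x - f x)"
  by (simp add: l2norm_def power2_commute)

lemma l2norm_cmult: "l2norm M (\<lambda>x. c * f x) = \<bar>c\<bar> * l2norm M f"
  by (simp add: l2norm_def power_mult_distrib real_sqrt_mult)

lemma l2norm_divide: "l2norm M (\<lambda>x. f x / c) = l2norm M f / \<bar>c\<bar>"
  by (simp add: l2norm_def power_divide real_sqrt_divide)

lemma nn_integral_square: "square_integrable M f \<Longrightarrow> (\<integral>\<^sup>+x. ennreal ((f x)\<^sup>2) \<partial>M) = ennreal ((l2norm M f)\<^sup>2)"
  by (subst nn_integral_eq_integral) (auto simp: square_integrable_def l2norm_square)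

lemma square_integrable_if_nn_integral_le:
  assumes "f \<in> borel_measurable M" "(\<integral>\<^sup>+x. ennreal ((f x)\<^sup>2) \<partial>M) \<le> ennreal (C\<^sup>2)" "0 \<le> C"
  shows "square_integrable M f" "l2norm M f \<le> C"
proof -
  have "integrable M (\<lambda>x. (f x)\<^sup>2)"
    using assms by (intro integrableI_nonneg) (auto simp: order_le_less_trans)
  then show f: "square_integrable M f" using assms by (simp add: square_integrable_def)
  show "l2norm M f \<le> C"
    using assms(2,3) by (simp add: nn_integral_square[OF f] power_mono_iff)
qed

lemma square_integrable_bound:
  assumes g: "square_integrable M g" and f: "f \<in> borel_measurable M"
    and dominated: "AE x in M. \<bar>f x\<bar> \<le> \<bar>g x\<bar>"
  shows "square_integrable M f" "l2norm M f \<le> l2norm M g"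
proof -
  have "(\<integral>\<^sup>+x. ennreal ((f x)\<^sup>2) \<partial>M) \<le> (\<integral>\<^sup>+x. ennreal ((g x)\<^sup>2) \<partial>M)"
    using dominated by (intro nn_integral_mono_AE) (auto simp: abs_le_square_iff)
  then have "(\<integral>\<^sup>+x. ennreal ((f x)\<^sup>2) \<partial>M) \<le> ennreal ((l2norm M g)\<^sup>2)"
    unfolding nn_integral_square[OF g] .
  from square_integrable_if_nn_integral_le[OF f this]
  show "square_integrable M f" "l2norm M f \<le> l2norm M g" by auto
qed

lemma Cauchy_Schwarz_integral:
  assumes f: "square_integrable M f" and g: "square_integrable M g"
  shows "integrable M (\<lambda>x. f x * g x)" "\<bar>\<integral>x. f x * g x \<partial>M\<bar> \<le> l2norm M f * l2norm M g"
proof -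
  note [measurable] = borel_measurable_square_integrable[OF f] borel_measurable_square_integrable[OF g]
  let ?I = "\<integral>\<^sup>+x. ennreal (norm (f x * g x)) \<partial>M"
  have "?I\<^sup>2 = (\<integral>\<^sup>+x. ennreal \<bar>f x\<bar> * ennreal \<bar>g x\<bar> \<partial>M)\<^sup>2"
    by (simp add: abs_mult ennreal_mult)
  also have "\<dots> \<le> (\<integral>\<^sup>+x. (ennreal \<bar>f x\<bar>)\<^sup>2 \<partial>M) * (\<integral>\<^sup>+x. (ennreal \<bar>g x\<bar>)\<^sup>2 \<partial>M)"
    by (rule Cauchy_Schwarz_nn_integral) auto
  also have "\<dots> = ennreal ((l2norm M f * l2norm M g)\<^sup>2)"
    by (simp add: ennreal_power nn_integral_square[OF f] nn_integral_square[OF g] ennreal_mult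
        power_mult_distrib)
  finally have square_le: "?I\<^sup>2 \<le> ennreal ((l2norm M f * l2norm M g)\<^sup>2)" .
  have "?I \<noteq> \<infinity>"
    using square_le by (auto simp: top_unique ennreal_top_mult power2_eq_square)
  then show fg: "integrable M (\<lambda>x. f x * g x)"
    by (intro integrableI_bounded) (auto simp: less_top)
  have "?I = ennreal (\<integral>x. \<bar>f x * g x\<bar> \<partial>M)"
    using fg by (subst nn_integral_eq_integral) auto
  then have "?I\<^sup>2 = ennreal ((\<integral>x. \<bar>f x * g x\<bar> \<partial>M)\<^sup>2)"
    by (simp add: ennreal_power)
  with square_le have "(\<integral>x. \<bar>f x * g x\<bar> \<partial>M)\<^sup>2 \<le> (l2norm M f * l2norm M g)\<^sup>2"
    by (simp only: ennreal_le_iff zero_le_power2)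
  then have "(\<integral>x. \<bar>f x * g x\<bar> \<partial>M) \<le> l2norm M f * l2norm M g"
    by (rule power2_le_imp_le) simp
  then show "\<bar>\<integral>x. f x * g x \<partial>M\<bar> \<le> l2norm M f * l2norm M g"
    using integral_abs_bound[of M "\<lambda>x. f x * g x"] by linarith
qed

lemmas integrable_mult = Cauchy_Schwarz_integral(1)

lemma square_integrable_zero[simp]: "square_integrable M (\<lambda>x. 0)"
  by (simp add: square_integrable_def)

lemma square_integrable_abs: "square_integrable M f \<Longrightarrow> square_integrable M (\<lambda>x. \<bar>f x\<bar>)"
  by (auto simp: square_integrable_def)

lemma square_integrable_cmult: "square_integrable M f \<Longrightarrow> square_integrable M (\<lambda>x. c * f x)"
  by (auto simp: square_integrable_def power_mult_distrib)

lemma square_integrable_divide: "square_integrable M f \<Longrightarrow> square_integrable M (\<lambda>x. f x / c)"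
  by (auto simp: square_integrable_def power_divide)

lemma square_integrable_add:
  "square_integrable M f \<Longrightarrow> square_integrable M g \<Longrightarrow> square_integrable M (\<lambda>x. f x + g x)"
  using integrable_mult[of M f g] unfolding square_integrable_def
  by (auto simp: power2_sum mult.assoc)

lemma square_integrable_diff:
  "square_integrable M f \<Longrightarrow> square_integrable M g \<Longrightarrow> square_integrable M (\<lambda>x. f x - g x)"
  using square_integrable_add[of M f "\<lambda>x. (-1) * g x"] square_integrable_cmult[of M g "-1"] by simp

lemma square_integrable_sum:
  "(\<And>i. i \<in> A \<Longrightarrow> square_integrable M (f i)) \<Longrightarrow> square_integrable M (\<lambda>x. \<Sum>i\<in>A. f i x)"
  by (induct A rule: infinite_finite_induct) (auto intro: square_integrable_add)

lemma square_integrable_times_bounded: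
  assumes X: "square_integrable M X" and [measurable]: "h \<in> borel_measurable M" and h: "\<And>x. \<bar>h x\<bar> \<le> c"
  shows "square_integrable M (\<lambda>x. X x * h x)" "l2norm M (\<lambda>x. X x * h x) \<le> c * l2norm M X"
proof -
  note [measurable] = borel_measurable_square_integrable[OF X]
  have c: "0 \<le> c" using h[of undefined] by linarith
  have "\<bar>X x * h x\<bar> \<le> \<bar>c * X x\<bar>" for x
    using mult_right_mono[OF h[of x], of "\<bar>X x\<bar>"] c by (simp add: abs_mult mult.commute)
  then have "AE x in M. \<bar>X x * h x\<bar> \<le> \<bar>c * X x\<bar>" by simp
  from square_integrable_bound[OF square_integrable_cmult[OF X] _ this]
  show "square_integrable M (\<lambda>x. X x * h x)" "l2norm M (\<lambda>x. X x * h x) \<le> c * l2norm M X"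
    using c by (auto simp: l2norm_cmult)
qed

lemma l2norm_add_le:
  assumes f: "square_integrable M f" and g: "square_integrable M g"
  shows "l2norm M (\<lambda>x. f x + g x) \<le> l2norm M f + l2norm M g"
proof (rule power2_le_imp_le)
  note [simp] = integrable_mult[OF f g] integrable_square[OF f] integrable_square[OF g]
  have "(l2norm M (\<lambda>x. f x + g x))\<^sup>2 = (\<integral>x. (f x)\<^sup>2 + (g x)\<^sup>2 + 2 * (f x * g x) \<partial>M)"
    unfolding l2norm_square by (simp add: power2_sum mult.assoc)
  also have "\<dots> = (l2norm M f)\<^sup>2 + (l2norm M g)\<^sup>2 + 2 * (\<integral>x. f x * g x \<partial>M)"
    by (simp add: l2norm_square)
  also have "\<dots> \<le> (l2norm M f)\<^sup>2 + (l2norm M g)\<^sup>2 + 2 * (l2norm M f * l2norm M g)"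
    using Cauchy_Schwarz_integral(2)[OF f g] by simp
  finally show "(l2norm M (\<lambda>x. f x + g x))\<^sup>2 \<le> (l2norm M f + l2norm M g)\<^sup>2"
    by (simp add: power2_sum)
qed simp

lemma l2norm_diff_le:
  assumes f: "square_integrable M f" and g: "square_integrable M g"
  shows "l2norm M (\<lambda>x. f x - g x) \<le> l2norm M f + l2norm M g"
  using l2norm_add_le[OF f square_integrable_cmult[OF g, of "-1"]] by simp

lemma abs_l2norm_diff_le:
  assumes f: "square_integrable M f" and g: "square_integrable M g"
  shows "\<bar>l2norm M f - l2norm M g\<bar> \<le> l2norm M (\<lambda>x. f x - g x)"
  using l2norm_add_le[OF g square_integrable_diff[OF f g]] l2norm_add_le[OF f square_integrable_diff[OF g f]]
  by (simp add: l2norm_minus_commute[of M g f])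

lemma l2norm_sum_le:
  assumes "\<And>i. i \<in> A \<Longrightarrow> square_integrable M (f i)"
  shows "l2norm M (\<lambda>x. \<Sum>i\<in>A. f i x) \<le> (\<Sum>i\<in>A. l2norm M (f i))"
  using assms
proof (induct A rule: infinite_finite_induct)
  case (insert a A)
  then show ?case
    using l2norm_add_le[of M "f a" "\<lambda>x. \<Sum>i\<in>A. f i x"] square_integrable_sum[of A M f] by auto
qed auto

lemma l2norm_parallelogram:
  assumes f: "square_integrable M f" and g: "square_integrable M g"
  shows "(l2norm M (\<lambda>x. f x + g x))\<^sup>2 + (l2norm M (\<lambda>x. f x - g x))\<^sup>2 = 2 * (l2norm M f)\<^sup>2 + 2 * (l2norm M g)\<^sup>2"
proof -
  note [simp] = integrable_square[OF f] integrable_square[OF g]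
    integrable_square[OF square_integrable_add[OF f g]] integrable_square[OF square_integrable_diff[OF f g]]
  have "(l2norm M (\<lambda>x. f x + g x))\<^sup>2 + (l2norm M (\<lambda>x. f x - g x))\<^sup>2 = (\<integral>x. (f x + g x)\<^sup>2 + (f x - g x)\<^sup>2 \<partial>M)"
    by (simp add: l2norm_square)
  also have "\<dots> = (\<integral>x. 2 * (f x)\<^sup>2 + 2 * (g x)\<^sup>2 \<partial>M)"
    by (intro Bochner_Integration.integral_cong) (auto simp: power2_eq_square algebra_simps)
  also have "\<dots> = 2 * (l2norm M f)\<^sup>2 + 2 * (l2norm M g)\<^sup>2"
    by (simp add: l2norm_square)
  finally show ?thesis .
qed

lemma l2norm_sum_orthogonal:
  assumes I: "finite I" and D: "\<And>i. i \<in> I \<Longrightarrow> square_integrable M (D i)"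
    and orth: "\<And>i j. i \<in> I \<Longrightarrow> j \<in> I \<Longrightarrow> i \<noteq> j \<Longrightarrow> (\<integral>x. D i x * D j x \<partial>M) = 0"
    and norm: "\<And>i. i \<in> I \<Longrightarrow> l2norm M (D i) = a"
  shows "l2norm M (\<lambda>x. \<Sum>i\<in>I. D i x) = sqrt (card I) * a"
proof -
  have "(l2norm M (\<lambda>x. \<Sum>i\<in>I. D i x))\<^sup>2 = (\<integral>x. (\<Sum>i\<in>I. \<Sum>j\<in>I. D i x * D j x) \<partial>M)"
    unfolding l2norm_square by (simp add: power2_eq_square sum_product)
  also have "\<dots> = (\<Sum>i\<in>I. \<Sum>j\<in>I. \<integral>x. D i x * D j x \<partial>M)"
    using D by (simp add: Bochner_Integration.integral_sum integrable_mult)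
  also have "\<dots> = (\<Sum>i\<in>I. \<Sum>j\<in>I. if j = i then (l2norm M (D i))\<^sup>2 else 0)"
    using orth by (intro sum.cong refl) (auto simp: l2norm_square, simp add: power2_eq_square)
  also have "\<dots> = card I * a\<^sup>2"
    using I norm by simp
  also have "sqrt \<dots> = sqrt (card I) * \<bar>a\<bar>"
    by (simp add: real_sqrt_mult)
  finally have "l2norm M (\<lambda>x. \<Sum>i\<in>I. D i x) = sqrt (card I) * \<bar>a\<bar>"
    by simp
  moreover have "0 \<le> a" if "I \<noteq> {}"
    using that norm l2norm_nonneg by (metis all_not_in_conv)
  ultimately show ?thesis by (cases "I = {}") auto
qed

lemma l2norm_eq_0_imp_AE:
  assumes f: "square_integrable M f" and zero: "l2norm M f = 0"
  shows "AE x in M. f x = 0"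
proof -
  have "(\<integral>x. (f x)\<^sup>2 \<partial>M) = 0" using zero by (simp add: l2norm_def)
  then have "AE x in M. (f x)\<^sup>2 = 0"
    using integrable_square[OF f] by (subst (asm) integral_nonneg_eq_0_iff_AE) auto
  then show ?thesis by simp
qed

lemma square_integrable_distr:
  assumes T: "T \<in> M \<rightarrow>\<^sub>M N" "distr M N T = N" and F: "square_integrable N F"
  shows "square_integrable M (\<lambda>x. F (T x))" "l2norm M (\<lambda>x. F (T x)) = l2norm N F"
proof -
  note [measurable] = T(1) borel_measurable_square_integrable[OF F]
  have "integrable (distr M N T) (\<lambda>x. (F x)\<^sup>2)" "l2norm (distr M N T) F = l2norm N F"
    using F by (simp_all add: T(2) square_integrable_def)
  then show "square_integrable M (\<lambda>x. F (T x))" "l2norm M (\<lambda>x. F (T x)) = l2norm N F"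
    by (auto simp: square_integrable_def l2norm_def integral_distr integrable_distr_eq)
qed

lemma (in finite_measure) square_integrable_const: "square_integrable M (\<lambda>x. c)"
  by (simp add: square_integrable_def)

lemma (in finite_measure) square_integrable_if_bounded:
  assumes "f \<in> borel_measurable M" "\<And>x. \<bar>f x\<bar> \<le> c"
  shows "square_integrable M f"
  using square_integrable_times_bounded(1)[OF square_integrable_const[of 1] assms] by simp

lemma (in finite_measure) integrable_if_square_integrable: "square_integrable M f \<Longrightarrow> integrable M f"
  using square_integrable_imp_integrable by (auto simp: square_integrable_def)

lemma (in prob_space) expectation_abs_le_l2norm:
  assumes "square_integrable M f"
  shows "expectation (\<lambda>x. \<bar>f x\<bar>) \<le> l2norm M f"
  using Cauchy_Schwarz_integral(2)[OF square_integrable_abs[OF assms] square_integrable_const[of 1]]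
  by (simp add: l2norm_def prob_space)

lemma nn_integral_SUP_square_partial_sums_le:
  fixes \<phi> :: "nat \<Rightarrow> 'a \<Rightarrow> real"
  assumes \<phi>: "\<And>l. square_integrable M (\<phi> l)" and norm_summable: "summable (\<lambda>l. l2norm M (\<phi> l))"
  shows "(\<integral>\<^sup>+x. (SUP n. ennreal ((\<Sum>l<n. \<bar>\<phi> l x\<bar>)\<^sup>2)) \<partial>M) \<le> ennreal ((\<Sum>l. l2norm M (\<phi> l))\<^sup>2)"
proof -
  note [measurable] = borel_measurable_square_integrable[OF \<phi>]
  have "incseq (\<lambda>n x. ennreal ((\<Sum>l<n. \<bar>\<phi> l x\<bar>)\<^sup>2))"
    unfolding incseq_def le_fun_def
    by (intro allI impI ennreal_leI power_mono sum_mono2 sum_nonneg) auto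
  then have "(\<integral>\<^sup>+x. (SUP n. ennreal ((\<Sum>l<n. \<bar>\<phi> l x\<bar>)\<^sup>2)) \<partial>M) = (SUP n. \<integral>\<^sup>+x. ennreal ((\<Sum>l<n. \<bar>\<phi> l x\<bar>)\<^sup>2) \<partial>M)"
    by (intro nn_integral_monotone_convergence_SUP) auto
  also have "\<dots> \<le> ennreal ((\<Sum>l. l2norm M (\<phi> l))\<^sup>2)"
  proof (rule SUP_least)
    fix n
    have partial: "square_integrable M (\<lambda>x. \<Sum>l<n. \<bar>\<phi> l x\<bar>)"
      by (intro square_integrable_sum square_integrable_abs \<phi>)
    have "l2norm M (\<lambda>x. \<Sum>l<n. \<bar>\<phi> l x\<bar>) \<le> (\<Sum>l<n. l2norm M (\<lambda>x. \<bar>\<phi> l x\<bar>))"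
      by (intro l2norm_sum_le square_integrable_abs \<phi>)
    also have "\<dots> \<le> (\<Sum>l. l2norm M (\<phi> l))"
      using sum_le_suminf[OF norm_summable, of "{..<n}"] by simp
    finally show "(\<integral>\<^sup>+x. ennreal ((\<Sum>l<n. \<bar>\<phi> l x\<bar>)\<^sup>2) \<partial>M) \<le> ennreal ((\<Sum>l. l2norm M (\<phi> l))\<^sup>2)"
      unfolding nn_integral_square[OF partial] by (intro ennreal_leI power_mono) auto
  qed
  finally show ?thesis .
qed

lemma infinite_Minkowski:
  fixes \<phi> :: "nat \<Rightarrow> 'a \<Rightarrow> real"
  assumes \<phi>: "\<And>l. square_integrable M (\<phi> l)" and norm_summable: "summable (\<lambda>l. l2norm M (\<phi> l))"
  shows "AE x in M. summable (\<lambda>l. \<bar>\<phi> l x\<bar>)"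
    and "square_integrable M (\<lambda>x. \<Sum>l. \<phi> l x)"
    and "l2norm M (\<lambda>x. \<Sum>l. \<phi> l x) \<le> (\<Sum>l. l2norm M (\<phi> l))"
proof -
  note [measurable] = borel_measurable_square_integrable[OF \<phi>]
  note SUP_le = nn_integral_SUP_square_partial_sums_le[OF \<phi> norm_summable]
  then have "(\<integral>\<^sup>+x. (SUP n. ennreal ((\<Sum>l<n. \<bar>\<phi> l x\<bar>)\<^sup>2)) \<partial>M) \<noteq> \<infinity>"
    by (auto simp: top_unique)
  then have SUP_finite: "AE x in M. (SUP n. ennreal ((\<Sum>l<n. \<bar>\<phi> l x\<bar>)\<^sup>2)) \<noteq> \<infinity>"
    by (intro nn_integral_noteq_infinite) auto
  then show "AE x in M. summable (\<lambda>l. \<bar>\<phi> l x\<bar>)"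
    by eventually_elim (rule summable_if_SUP_square_partial_sums_finite)
  have "(\<integral>\<^sup>+x. ennreal ((\<Sum>l. \<phi> l x)\<^sup>2) \<partial>M) \<le> (\<integral>\<^sup>+x. (SUP n. ennreal ((\<Sum>l<n. \<bar>\<phi> l x\<bar>)\<^sup>2)) \<partial>M)"
    by (intro nn_integral_mono_AE eventually_mono[OF SUP_finite]
        summable_if_SUP_square_partial_sums_finite(2))
  also note SUP_le
  finally have "(\<integral>\<^sup>+x. ennreal ((\<Sum>l. \<phi> l x)\<^sup>2) \<partial>M) \<le> ennreal ((\<Sum>l. l2norm M (\<phi> l))\<^sup>2)" .
  from square_integrable_if_nn_integral_le[OF _ this]
  show "square_integrable M (\<lambda>x. \<Sum>l. \<phi> l x)" "l2norm M (\<lambda>x. \<Sum>l. \<phi> l x) \<le> (\<Sum>l. l2norm M (\<phi> l))"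
    using suminf_nonneg[OF norm_summable] by auto
qed

lemma l2norm_suminf_minus_partial_sum_tendsto:
  fixes \<phi> :: "nat \<Rightarrow> 'a \<Rightarrow> real"
  assumes \<phi>: "\<And>l. square_integrable M (\<phi> l)" and norm_summable: "summable (\<lambda>l. l2norm M (\<phi> l))"
  shows "(\<lambda>n. l2norm M (\<lambda>x. (\<Sum>l. \<phi> l x) - (\<Sum>l<n. \<phi> l x))) \<longlonglongrightarrow> 0"
proof (rule tendsto_sandwich[OF _ _ tendsto_const])
  note [measurable] = borel_measurable_square_integrable[OF \<phi>]
  have "l2norm M (\<lambda>x. (\<Sum>l. \<phi> l x) - (\<Sum>l<n. \<phi> l x)) \<le> (\<Sum>l. l2norm M (\<phi> (l + n)))" for n
  proof -
    have "l2norm M (\<lambda>x. (\<Sum>l. \<phi> l x) - (\<Sum>l<n. \<phi> l x)) = l2norm M (\<lambda>x. \<Sum>l. \<phi> (l + n) x)"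
    proof (rule l2norm_cong_AE)
      show "AE x in M. (\<Sum>l. \<phi> l x) - (\<Sum>l<n. \<phi> l x) = (\<Sum>l. \<phi> (l + n) x)"
        using infinite_Minkowski(1)[OF \<phi> norm_summable]
        by eventually_elim (rule suminf_minus_initial_segment[OF summable_rabs_cancel, symmetric])
    qed auto
    also have "\<dots> \<le> (\<Sum>l. l2norm M (\<phi> (l + n)))"
      using summable_ignore_initial_segment[OF norm_summable] by (intro infinite_Minkowski(3) \<phi>)
    finally show ?thesis .
  qed
  then show "\<forall>\<^sub>F n in sequentially. l2norm M (\<lambda>x. (\<Sum>l. \<phi> l x) - (\<Sum>l<n. \<phi> l x)) \<le> (\<Sum>l. l2norm M (\<phi> (l + n)))"
    by auto
  show "(\<lambda>n. \<Sum>l. l2norm M (\<phi> (l + n))) \<longlonglongrightarrow> 0" by (rule suminf_exist_split2[OF norm_summable])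
qed auto

lemma square_integrable_count_space_nat:
  "square_integrable (count_space (UNIV :: nat set)) f \<longleftrightarrow> summable (\<lambda>j. (f j)\<^sup>2)"
  by (simp add: square_integrable_def integrable_count_space_nat_iff)

lemma l2norm_count_space_nat:
  "summable (\<lambda>j. (f j)\<^sup>2) \<Longrightarrow> l2norm (count_space (UNIV :: nat set)) f = sqrt (\<Sum>j. (f j)\<^sup>2)"
  by (simp add: l2norm_def integral_count_space_nat integrable_count_space_nat_iff)

lemma l2norm_diff_tendsto_0_dominated:
  fixes F :: "nat \<Rightarrow> 'a \<Rightarrow> real"
  assumes [measurable]: "g \<in> borel_measurable M" "\<And>n. F n \<in> borel_measurable M" and w: "square_integrable M w"
    and lim: "\<And>x. x \<in> space M \<Longrightarrow> (\<lambda>n. F n x) \<longlonglongrightarrow> g x"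
    and dominated: "\<And>n x. x \<in> space M \<Longrightarrow> \<bar>g x - F n x\<bar> \<le> w x"
  shows "(\<lambda>n. l2norm M (\<lambda>x. g x - F n x)) \<longlonglongrightarrow> 0"
proof -
  have "(\<lambda>n. \<integral>x. (g x - F n x)\<^sup>2 \<partial>M) \<longlonglongrightarrow> (\<integral>x. 0 \<partial>M)"
  proof (rule integral_dominated_convergence[OF _ _ integrable_square[OF w]])
    show "AE x in M. (\<lambda>n. (g x - F n x)\<^sup>2) \<longlonglongrightarrow> 0"
      using lim by (intro AE_I2) (auto intro!: tendsto_eq_intros)
    show "AE x in M. norm ((g x - F n x)\<^sup>2) \<le> (w x)\<^sup>2" for n
      using power_mono[OF dominated, of _ n 2] by (intro AE_I2) simp
  qed auto
  from tendsto_real_sqrt[OF this] show ?thesis by (simp add: l2norm_def)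
qed

section \<open>Square-integrable functions on product spaces\<close>

context pair_sigma_finite
begin

lemma square_integrable_swap:
  assumes B: "square_integrable (M1 \<Otimes>\<^sub>M M2) (\<lambda>(x, y). B x y)"
  shows "square_integrable (M2 \<Otimes>\<^sub>M M1) (\<lambda>(y, x). B x y)"
    and "l2norm (M2 \<Otimes>\<^sub>M M1) (\<lambda>(y, x). B x y) = l2norm (M1 \<Otimes>\<^sub>M M2) (\<lambda>(x, y). B x y)"
  using square_integrable_distr[OF _ distr_pair_swap[symmetric] B]
  by (auto simp: split_beta')

lemma square_integrable_section:
  assumes B: "square_integrable (M1 \<Otimes>\<^sub>M M2) (\<lambda>(x, y). B x y)"
  shows "AE x in M1. square_integrable M2 (B x)"
    and "square_integrable M1 (\<lambda>x. l2norm M2 (B x))"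
    and "l2norm M1 (\<lambda>x. l2norm M2 (B x)) = l2norm (M1 \<Otimes>\<^sub>M M2) (\<lambda>(x, y). B x y)"
proof -
  note [measurable] = borel_measurable_square_integrable[OF B]
  have square_integrable_pair: "integrable (M1 \<Otimes>\<^sub>M M2) (\<lambda>(x, y). (B x y)\<^sup>2)"
    using integrable_square[OF B] by (simp add: split_beta')
  show "AE x in M1. square_integrable M2 (B x)"
    using AE_integrable_fst[OF square_integrable_pair] AE_space
    by eventually_elim (simp add: square_integrable_def)
  show "square_integrable M1 (\<lambda>x. l2norm M2 (B x))"
    using integrable_fst[OF square_integrable_pair] unfolding square_integrable_def l2norm_square
    by (simp add: l2norm_def)
  show "l2norm M1 (\<lambda>x. l2norm M2 (B x)) = l2norm (M1 \<Otimes>\<^sub>M M2) (\<lambda>(x, y). B x y)"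
    unfolding l2norm_def[of M1] l2norm_square integral_fst[OF square_integrable_pair]
    by (simp add: l2norm_def split_beta')
qed

lemma square_integrable_section_snd:
  assumes B: "square_integrable (M1 \<Otimes>\<^sub>M M2) (\<lambda>(x, y). B x y)"
  shows "AE y in M2. square_integrable M1 (\<lambda>x. B x y)"
    and "square_integrable M2 (\<lambda>y. l2norm M1 (\<lambda>x. B x y))"
    and "l2norm M2 (\<lambda>y. l2norm M1 (\<lambda>x. B x y)) = l2norm (M1 \<Otimes>\<^sub>M M2) (\<lambda>(x, y). B x y)"
proof -
  interpret swap: pair_sigma_finite M2 M1 ..
  show "AE y in M2. square_integrable M1 (\<lambda>x. B x y)"
    "square_integrable M2 (\<lambda>y. l2norm M1 (\<lambda>x. B x y))"
    "l2norm M2 (\<lambda>y. l2norm M1 (\<lambda>x. B x y)) = l2norm (M1 \<Otimes>\<^sub>M M2) (\<lambda>(x, y). B x y)"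
    using swap.square_integrable_section[OF square_integrable_swap(1)[OF B]] square_integrable_swap(2)[OF B]
    by simp_all
qed

lemma square_integrable_tensor:
  assumes f: "square_integrable M1 f" and g: "square_integrable M2 g"
  shows "square_integrable (M1 \<Otimes>\<^sub>M M2) (\<lambda>(x, y). f x * g y)"
    and "l2norm (M1 \<Otimes>\<^sub>M M2) (\<lambda>(x, y). f x * g y) = l2norm M1 f * l2norm M2 g"
proof -
  note [measurable] = borel_measurable_square_integrable[OF f] borel_measurable_square_integrable[OF g]
  have "(\<integral>\<^sup>+p. ennreal ((case p of (x, y) \<Rightarrow> f x * g y)\<^sup>2) \<partial>(M1 \<Otimes>\<^sub>M M2))
      = (\<integral>\<^sup>+x. \<integral>\<^sup>+y. ennreal ((f x * g y)\<^sup>2) \<partial>M2 \<partial>M1)"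
    by (subst M2.nn_integral_fst[symmetric]) auto
  also have "\<dots> = (\<integral>\<^sup>+x. ennreal ((f x)\<^sup>2) * (\<integral>\<^sup>+y. ennreal ((g y)\<^sup>2) \<partial>M2) \<partial>M1)"
    by (intro nn_integral_cong) (simp add: power_mult_distrib ennreal_mult nn_integral_cmult)
  also have "\<dots> = ennreal ((l2norm M1 f * l2norm M2 g)\<^sup>2)"
    by (simp add: nn_integral_multc nn_integral_square[OF f] nn_integral_square[OF g] power_mult_distrib
        ennreal_mult)
  finally show fg: "square_integrable (M1 \<Otimes>\<^sub>M M2) (\<lambda>(x, y). f x * g y)"
    by (intro square_integrable_if_nn_integral_le(1)[of _ _ "l2norm M1 f * l2norm M2 g"]) auto
  have "l2norm M1 (\<lambda>x. l2norm M2 (\<lambda>y. f x * g y)) = l2norm M1 (\<lambda>x. l2norm M2 g * \<bar>f x\<bar>)"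
    by (simp add: l2norm_cmult mult.commute)
  then show "l2norm (M1 \<Otimes>\<^sub>M M2) (\<lambda>(x, y). f x * g y) = l2norm M1 f * l2norm M2 g"
    unfolding square_integrable_section(3)[OF fg] by (simp add: l2norm_cmult)
qed

lemma square_integrable_inner:
  assumes B: "square_integrable (M1 \<Otimes>\<^sub>M M2) (\<lambda>(x, y). B x y)" and h: "square_integrable M2 h"
  shows "square_integrable M1 (\<lambda>x. \<integral>y. B x y * h y \<partial>M2)"
    and "l2norm M1 (\<lambda>x. \<integral>y. B x y * h y \<partial>M2) \<le> l2norm M2 h * l2norm (M1 \<Otimes>\<^sub>M M2) (\<lambda>(x, y). B x y)"
proof -
  note [measurable] = borel_measurable_square_integrable[OF B] borel_measurable_square_integrable[OF h]
  have inner_le: "AE x in M1. \<bar>\<integral>y. B x y * h y \<partial>M2\<bar> \<le> \<bar>l2norm M2 h * l2norm M2 (B x)\<bar>"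
    using square_integrable_section(1)[OF B]
  proof eventually_elim
    case (elim x)
    from Cauchy_Schwarz_integral(2)[OF elim h] show ?case by (simp add: mult.commute abs_mult)
  qed
  from square_integrable_bound[OF square_integrable_cmult[OF square_integrable_section(2)[OF B]] _ inner_le]
  show "square_integrable M1 (\<lambda>x. \<integral>y. B x y * h y \<partial>M2)"
    "l2norm M1 (\<lambda>x. \<integral>y. B x y * h y \<partial>M2) \<le> l2norm M2 h * l2norm (M1 \<Otimes>\<^sub>M M2) (\<lambda>(x, y). B x y)"
    by (auto simp: l2norm_cmult square_integrable_section(3)[OF B])
qed

lemma integral_inner_swap:
  assumes B: "square_integrable (M1 \<Otimes>\<^sub>M M2) (\<lambda>(x, y). B x y)"
    and f: "square_integrable M1 f" and g: "square_integrable M2 g"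
  shows "(\<integral>x. f x * (\<integral>y. B x y * g y \<partial>M2) \<partial>M1) = (\<integral>y. (\<integral>x. f x * B x y \<partial>M1) * g y \<partial>M2)"
proof -
  have "integrable (M1 \<Otimes>\<^sub>M M2) (\<lambda>(x, y). f x * (B x y * g y))"
    using integrable_mult[OF B square_integrable_tensor(1)[OF f g]] by (simp add: split_beta' mult_ac)
  from Fubini_integral[OF this]
  have "(\<integral>x. (\<integral>y. f x * (B x y * g y) \<partial>M2) \<partial>M1) = (\<integral>y. (\<integral>x. f x * B x y * g y \<partial>M1) \<partial>M2)"
    by (simp add: mult.assoc)
  then show ?thesis by simp
qed

lemma square_integrable_compose_fst:
  assumes T: "T \<in> L \<rightarrow>\<^sub>M M1" "distr L M1 T = M1"
    and B: "square_integrable (M1 \<Otimes>\<^sub>M M2) (\<lambda>(x, y). B x y)"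
  shows "square_integrable (L \<Otimes>\<^sub>M M2) (\<lambda>(x, y). B (T x) y)"
proof -
  note [measurable] = T(1)
  have "distr L M1 T \<Otimes>\<^sub>M distr M2 M2 (\<lambda>y. y) = distr (L \<Otimes>\<^sub>M M2) (M1 \<Otimes>\<^sub>M M2) (\<lambda>(x, y). (T x, y))"
    by (intro pair_measure_distr) (auto simp: distr_id M2.sigma_finite_measure_axioms)
  then have "distr (L \<Otimes>\<^sub>M M2) (M1 \<Otimes>\<^sub>M M2) (\<lambda>(x, y). (T x, y)) = M1 \<Otimes>\<^sub>M M2"
    by (simp add: T(2) distr_id)
  from square_integrable_distr(1)[OF _ this B]
  show ?thesis by (auto simp: split_beta')
qed

end

section \<open>Characteristic functions and Laplace transforms\<close>

lemma char_scale:
  assumes [measurable]: "X \<in> borel_measurable M"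
  shows "char (distr M borel (\<lambda>x. c * X x)) u = char (distr M borel X) (u * c)"
  by (simp add: char_def integral_distr mult_ac)

lemma norm_iexp_diff_le: "cmod (iexp x - iexp y) \<le> \<bar>x - y\<bar>"
proof -
  have "iexp x - iexp y = iexp y * (iexp (x - y) - 1)"
    by (simp add: exp_diff right_diff_distrib)
  then have "cmod (iexp x - iexp y) = cmod (iexp (x - y) - 1)"
    by (simp add: norm_mult)
  also have "\<dots> \<le> \<bar>x - y\<bar>"
    using iexp_approx1[of "x - y" 0] by simp
  finally show ?thesis .
qed

context prob_space
begin

lemma Re_char_distr:
  assumes [measurable]: "X \<in> borel_measurable M"
  shows "Re (char (distr M borel X) u) = expectation (\<lambda>x. cos (u * X x))"
proof -
  have "integrable M (\<lambda>x. iexp (u * X x))"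
    by (rule integrable_const_bound[of _ 1]) auto
  from integral_Re[OF this] show ?thesis
    by (simp add: char_def integral_distr Re_exp)
qed

lemma char_diff_le_l2norm:
  assumes X: "square_integrable M X" and Y: "square_integrable M Y"
  shows "cmod (char (distr M borel X) u - char (distr M borel Y) u) \<le> \<bar>u\<bar> * l2norm M (\<lambda>x. X x - Y x)"
proof -
  note [measurable] = borel_measurable_square_integrable[OF X] borel_measurable_square_integrable[OF Y]
  note diff = square_integrable_diff[OF X Y]
  have iexp: "integrable M (\<lambda>x. iexp (u * Z x))" if "Z \<in> borel_measurable M" for Z
    using that by (intro integrable_const_bound[of _ 1]) auto
  have "char (distr M borel X) u - char (distr M borel Y) u = (CLINT x|M. iexp (u * X x) - iexp (u * Y x))"
    using iexp by (simp add: char_def integral_distr)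
  also have "cmod \<dots> \<le> (\<integral>x. cmod (iexp (u * X x) - iexp (u * Y x)) \<partial>M)"
    by (rule integral_norm_bound)
  also have "\<dots> \<le> (\<integral>x. \<bar>u\<bar> * \<bar>X x - Y x\<bar> \<partial>M)"
  proof (rule integral_mono)
    show "integrable M (\<lambda>x. cmod (iexp (u * X x) - iexp (u * Y x)))"
      using iexp by (intro integrable_norm Bochner_Integration.integrable_diff) auto
    show "integrable M (\<lambda>x. \<bar>u\<bar> * \<bar>X x - Y x\<bar>)"
      using integrable_if_square_integrable[OF diff] by simp
    show "cmod (iexp (u * X x) - iexp (u * Y x)) \<le> \<bar>u\<bar> * \<bar>X x - Y x\<bar>" for x
      using norm_iexp_diff_le[of "u * X x" "u * Y x"] by (simp add: abs_mult right_diff_distrib[symmetric])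
  qed
  also have "\<dots> \<le> \<bar>u\<bar> * l2norm M (\<lambda>x. X x - Y x)"
    using expectation_abs_le_l2norm[OF diff] by (simp add: mult_left_mono)
  finally show ?thesis .
qed

lemma char_scaled_tendsto:
  assumes X: "\<And>k. square_integrable M (X k)" and bound: "\<And>k. l2norm M (X k) \<le> C"
    and c: "c \<longlonglongrightarrow> c0" and lim: "(\<lambda>k. char (distr M borel (X k)) (u * c0)) \<longlonglongrightarrow> l"
  shows "(\<lambda>k. char (distr M borel (\<lambda>x. c k * X k x)) u) \<longlonglongrightarrow> l"
proof -
  note [measurable] = borel_measurable_square_integrable[OF X]
  have "(\<lambda>k. char (distr M borel (\<lambda>x. c k * X k x)) u - char (distr M borel (\<lambda>x. c0 * X k x)) u) \<longlonglongrightarrow> 0"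
  proof (rule Lim_null_comparison)
    show "(\<lambda>k. \<bar>u\<bar> * (\<bar>c k - c0\<bar> * C)) \<longlonglongrightarrow> 0"
      by (intro tendsto_mult_right_zero tendsto_mult_left_zero tendsto_rabs_zero LIM_zero c)
    have "cmod (char (distr M borel (\<lambda>x. c k * X k x)) u - char (distr M borel (\<lambda>x. c0 * X k x)) u)
        \<le> \<bar>u\<bar> * (\<bar>c k - c0\<bar> * C)" for k
    proof -
      have "cmod (char (distr M borel (\<lambda>x. c k * X k x)) u - char (distr M borel (\<lambda>x. c0 * X k x)) u)
          \<le> \<bar>u\<bar> * l2norm M (\<lambda>x. c k * X k x - c0 * X k x)"
        by (intro char_diff_le_l2norm square_integrable_cmult X)
      also have "\<dots> = \<bar>u\<bar> * (\<bar>c k - c0\<bar> * l2norm M (X k))"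
        unfolding left_diff_distrib[symmetric] l2norm_cmult ..
      also have "\<dots> \<le> \<bar>u\<bar> * (\<bar>c k - c0\<bar> * C)"
        by (intro mult_left_mono bound) auto
      finally show ?thesis .
    qed
    then show "\<forall>\<^sub>F k in sequentially. norm (char (distr M borel (\<lambda>x. c k * X k x)) u - char (distr M borel
      (\<lambda>x. c0 * X k x)) u)
        \<le> \<bar>u\<bar> * (\<bar>c k - c0\<bar> * C)" by simp
  qed
  moreover have "(\<lambda>k. char (distr M borel (\<lambda>x. c0 * X k x)) u) \<longlonglongrightarrow> l"
    using lim by (simp add: char_scale)
  ultimately have "(\<lambda>k. char (distr M borel (\<lambda>x. c k * X k x)) u - char (distr M borel (\<lambda>x. c0 * X k x)) u
      + char (distr M borel (\<lambda>x. c0 * X k x)) u) \<longlonglongrightarrow> 0 + l"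
    by (rule tendsto_add)
  then show ?thesis by simp
qed

end

definition centred_gaussian :: "'a measure \<Rightarrow> ('a \<Rightarrow> real) \<Rightarrow> bool" where
  "centred_gaussian M X \<longleftrightarrow> square_integrable M X \<and> (\<integral>x. X x \<partial>M) = 0 \<and>
     (\<forall>u. char (distr M borel X) u = complex_of_real (exp (- (u\<^sup>2 * (l2norm M X)\<^sup>2) / 2)))"

lemma (in prob_space) centred_gaussian_limit:
  assumes X: "\<And>r. centred_gaussian M (X r)" and Y: "square_integrable M Y"
    and lim: "(\<lambda>r. l2norm M (\<lambda>x. X r x - Y x)) \<longlonglongrightarrow> 0"
  shows "centred_gaussian M Y"
  unfolding centred_gaussian_def
proof (intro conjI allI Y)
  have X_sq: "square_integrable M (X r)" for r using X by (simp add: centred_gaussian_def)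
  have "\<bar>expectation Y\<bar> \<le> l2norm M (\<lambda>x. X r x - Y x)" for r
  proof -
    have "expectation (\<lambda>x. X r x - Y x) = - expectation Y"
      using X[of r] integrable_if_square_integrable[OF X_sq] integrable_if_square_integrable[OF Y]
      by (simp add: centred_gaussian_def)
    then have "\<bar>expectation Y\<bar> \<le> expectation (\<lambda>x. \<bar>X r x - Y x\<bar>)"
      using integral_abs_bound[of M "\<lambda>x. X r x - Y x"] by simp
    also have "\<dots> \<le> l2norm M (\<lambda>x. X r x - Y x)"
      by (intro expectation_abs_le_l2norm square_integrable_diff X_sq Y)
    finally show ?thesis .
  qed
  then show "expectation Y = 0"
    using LIMSEQ_le_const[OF lim, of "\<bar>expectation Y\<bar>"] by auto
  have "(\<lambda>r. l2norm M (X r) - l2norm M Y) \<longlonglongrightarrow> 0"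
    by (rule Lim_null_comparison[OF _ lim]) (use abs_l2norm_diff_le[OF X_sq Y] in auto)
  then have norm_lim: "(\<lambda>r. l2norm M (X r)) \<longlonglongrightarrow> l2norm M Y" by (simp add: LIM_zero_iff)
  fix u
  show "char (distr M borel Y) u = complex_of_real (exp (- (u\<^sup>2 * (l2norm M Y)\<^sup>2) / 2))"
  proof (rule LIMSEQ_unique)
    have "(\<lambda>r. char (distr M borel (X r)) u - char (distr M borel Y) u) \<longlonglongrightarrow> 0"
      using tendsto_mult_right_zero[OF lim, of "\<bar>u\<bar>"]
      by (rule Lim_null_comparison[rotated]) (simp add: char_diff_le_l2norm X_sq Y)
    then show "(\<lambda>r. char (distr M borel (X r)) u) \<longlonglongrightarrow> char (distr M borel Y) u"
      by (simp add: LIM_zero_iff)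
    have "(\<lambda>r. complex_of_real (exp (- (u\<^sup>2 * (l2norm M (X r))\<^sup>2) / 2)))
        \<longlonglongrightarrow> complex_of_real (exp (- (u\<^sup>2 * (l2norm M Y)\<^sup>2) / 2))"
      by (intro tendsto_intros norm_lim) auto
    then show "(\<lambda>r. char (distr M borel (X r)) u) \<longlonglongrightarrow> complex_of_real (exp (- (u\<^sup>2 * (l2norm M Y)\<^sup>2) / 2))"
      using X by (simp add: centred_gaussian_def)
  qed
qed

lemma cts_step_eq_cts_step_ln:
  assumes "x < y" shows "cts_step x y v = cts_step x y (- ln (max (exp (- v)) (exp (- y))))"
  using assms by (cases "v \<le> y") (auto simp: max_absorb1 max_absorb2 cts_step_def)

lemma (in prob_space) abs_expectation_diff_le:
  fixes X :: "'a \<Rightarrow> real" and h p :: "real \<Rightarrow> real"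
  assumes p: "\<And>w. w \<in> {0..1} \<Longrightarrow> \<bar>h w - p w\<bar> \<le> e"
    and [measurable]: "h \<in> borel_measurable borel" "p \<in> borel_measurable borel" "X \<in> borel_measurable M"
    and h: "\<And>w. \<bar>h w\<bar> \<le> 1" and X: "\<And>x. X x \<in> {0..1}"
  shows "\<bar>expectation (\<lambda>x. h (X x)) - expectation (\<lambda>x. p (X x))\<bar> \<le> e"
proof -
  have int_h: "integrable M (\<lambda>x. h (X x))"
    by (rule integrable_const_bound[of _ 1]) (auto simp: h)
  have "\<bar>p (X x)\<bar> \<le> e + 1" for x
    using p[OF X[of x]] h[of "X x"] by linarith
  then have int_p: "integrable M (\<lambda>x. p (X x))"
    by (intro integrable_const_bound[of _ "e + 1"]) auto
  have "\<bar>expectation (\<lambda>x. h (X x)) - expectation (\<lambda>x. p (X x))\<bar> = \<bar>expectation (\<lambda>x. h (X x) - p (X x))\<bar>"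
    using int_h int_p by simp
  also have "\<dots> \<le> expectation (\<lambda>x. \<bar>h (X x) - p (X x)\<bar>)"
    by (rule integral_abs_bound)
  also have "\<dots> \<le> expectation (\<lambda>x. e)"
    using p[OF X] int_h int_p by (intro integral_mono) auto
  finally show ?thesis by (simp add: prob_space)
qed

lemma polynomial_expectation_tendsto:
  fixes V :: "nat \<Rightarrow> 'a \<Rightarrow> real" and W :: "'b \<Rightarrow> real"
  assumes M: "prob_space M" and N: "prob_space N"
    and [measurable]: "\<And>k. V k \<in> borel_measurable M" "W \<in> borel_measurable N"
    and nonneg: "\<And>k x. 0 \<le> V k x" "\<And>x. 0 \<le> W x"
    and laplace: "\<And>n::nat. (\<lambda>k. \<integral>x. exp (- (real n * V k x)) \<partial>M) \<longlonglongrightarrow> (\<integral>x. exp (- (real n * W x)) \<partial>N)"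
    and p: "real_polynomial_function p"
  shows "(\<lambda>k. \<integral>x. p (exp (- V k x)) \<partial>M) \<longlonglongrightarrow> (\<integral>x. p (exp (- W x)) \<partial>N)"
proof -
  interpret M: prob_space M by fact
  interpret N: prob_space N by fact
  obtain a n where a: "p = (\<lambda>w. \<Sum>i\<le>n. a i * w ^ i)"
    using p unfolding real_polynomial_function_iff_sum by blast
  have p_exp: "p (exp (- v)) = (\<Sum>i\<le>n. a i * exp (- (real i * v)))" for v
    unfolding a by (simp add: exp_of_nat_mult[symmetric])
  have "integrable M (\<lambda>x. exp (- (real i * V k x)))" for i k
    by (rule M.integrable_const_bound[of _ 1]) (auto simp: nonneg)
  moreover have "integrable N (\<lambda>x. exp (- (real i * W x)))" for i
    by (rule N.integrable_const_bound[of _ 1]) (auto simp: nonneg)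
  ultimately show ?thesis
    unfolding p_exp by (simp, intro tendsto_intros laplace)
qed

lemma continuous_expectation_tendsto:
  fixes V :: "nat \<Rightarrow> 'a \<Rightarrow> real" and W :: "'b \<Rightarrow> real" and h :: "real \<Rightarrow> real"
  assumes M: "prob_space M" and N: "prob_space N"
    and V[measurable]: "\<And>k. V k \<in> borel_measurable M" and W[measurable]: "W \<in> borel_measurable N"
    and nonneg: "\<And>k x. 0 \<le> V k x" "\<And>x. 0 \<le> W x"
    and laplace: "\<And>n::nat. (\<lambda>k. \<integral>x. exp (- (real n * V k x)) \<partial>M) \<longlonglongrightarrow> (\<integral>x. exp (- (real n * W x)) \<partial>N)"
    and h: "continuous_on UNIV h" "\<And>w. \<bar>h w\<bar> \<le> 1"
  shows "(\<lambda>k. \<integral>x. h (exp (- V k x)) \<partial>M) \<longlonglongrightarrow> (\<integral>x. h (exp (- W x)) \<partial>N)"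
proof (rule LIMSEQ_I)
  interpret M: prob_space M by fact
  interpret N: prob_space N by fact
  have [measurable]: "h \<in> borel_measurable borel" by (rule borel_measurable_continuous_onI[OF h(1)])
  fix e :: real assume e: "0 < e"
  obtain p where p: "real_polynomial_function p" "\<And>w. w \<in> {0..1} \<Longrightarrow> \<bar>h w - p w\<bar> < e / 4"
    by (rule Stone_Weierstrass_real_polynomial_function[OF compact_Icc continuous_on_subset[OF h(1)
        subset_UNIV], of "e / 4"])
       (use e in auto)
  have [measurable]: "p \<in> borel_measurable borel"
    using p(1) by (intro borel_measurable_continuous_onI continuous_on_polymonial_function)
      (simp add: real_polynomial_function_eq)
  have h_minus_p: "\<bar>h w - p w\<bar> \<le> e / 4" if "w \<in> {0..1}" for w using p(2)[OF that] by simp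
  have M_approx: "\<bar>(\<integral>x. h (exp (- V k x)) \<partial>M) - (\<integral>x. p (exp (- V k x)) \<partial>M)\<bar> \<le> e / 4" for k
    by (rule M.abs_expectation_diff_le[OF h_minus_p]) (auto simp: h(2) nonneg)
  have N_approx: "\<bar>(\<integral>x. h (exp (- W x)) \<partial>N) - (\<integral>x. p (exp (- W x)) \<partial>N)\<bar> \<le> e / 4"
    by (rule N.abs_expectation_diff_le[OF h_minus_p]) (auto simp: h(2) nonneg)
  obtain k0 where k0: "\<And>k. k \<ge> k0 \<Longrightarrow> \<bar>(\<integral>x. p (exp (- V k x)) \<partial>M) - (\<integral>x. p (exp (- W x)) \<partial>N)\<bar> < e / 4"
    using LIMSEQ_D[OF polynomial_expectation_tendsto[OF M N V W nonneg laplace p(1)], of "e / 4"] e by auto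
  show "\<exists>no. \<forall>k\<ge>no. norm ((\<integral>x. h (exp (- V k x)) \<partial>M) - (\<integral>x. h (exp (- W x)) \<partial>N)) < e"
  proof (intro exI allI impI)
    fix k assume "k \<ge> k0"
    from k0[OF this] M_approx[of k] N_approx e
    show "norm ((\<integral>x. h (exp (- V k x)) \<partial>M) - (\<integral>x. h (exp (- W x)) \<partial>N)) < e"
      unfolding real_norm_def by argo
  qed
qed

text \<open>By the Weierstrass theorem, polynomials in \<open>exp (- x)\<close> approximate the test functions
  \<open>cts_step\<close> uniformly on the half-line, so no tightness argument is needed.\<close>
lemma weak_conv_if_laplace_tendsto:
  fixes V :: "nat \<Rightarrow> 'a \<Rightarrow> real" and W :: "'b \<Rightarrow> real"
  assumes M: "prob_space M" and N: "prob_space N"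
    and V[measurable]: "\<And>k. V k \<in> borel_measurable M" and W[measurable]: "W \<in> borel_measurable N"
    and nonneg: "\<And>k x. 0 \<le> V k x" "\<And>x. 0 \<le> W x"
    and laplace: "\<And>n::nat. (\<lambda>k. \<integral>x. exp (- (real n * V k x)) \<partial>M) \<longlonglongrightarrow> (\<integral>x. exp (- (real n * W x)) \<partial>N)"
  shows "weak_conv_m (\<lambda>k. distr M borel (V k)) (distr N borel W)"
proof (rule integral_cts_step_conv_imp_weak_conv)
  interpret M: prob_space M by fact
  interpret N: prob_space N by fact
  show "real_distribution (distr M borel (V k))" for k by (rule M.real_distribution_distr) simp
  show "real_distribution (distr N borel W)" by (rule N.real_distribution_distr) simp
  fix x y :: real assume xy: "x < y"
  define h where "h w = cts_step x y (- ln (max w (exp (- y))))" for w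
  have step_cont: "continuous_on UNIV (cts_step x y)"
    by (rule uniformly_continuous_imp_continuous[OF cts_step_uniformly_continuous[OF xy]])
  then have [measurable]: "cts_step x y \<in> borel_measurable borel"
    by (rule borel_measurable_continuous_onI)
  have "max w (exp (- y)) \<noteq> 0" for w
    using exp_gt_zero[of "- y"] by (simp only: max_def split: if_split) linarith
  then have "continuous_on UNIV h"
    unfolding h_def by (intro continuous_on_compose2[OF step_cont] continuous_intros) auto
  moreover have "\<bar>h w\<bar> \<le> 1" for w using xy by (auto simp: h_def cts_step_def)
  ultimately have "(\<lambda>k. \<integral>z. h (exp (- V k z)) \<partial>M) \<longlonglongrightarrow> (\<integral>z. h (exp (- W z)) \<partial>N)"
    by (rule continuous_expectation_tendsto[OF M N V W nonneg laplace])
  then show "(\<lambda>k. integral\<^sup>L (distr M borel (V k)) (cts_step x y))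
      \<longlonglongrightarrow> integral\<^sup>L (distr N borel W) (cts_step x y)"
    by (simp add: integral_distr h_def cts_step_eq_cts_step_ln[OF xy, symmetric])
qed

lemma (in prob_space) laplace_diff_le:
  fixes X Y :: "'a \<Rightarrow> real"
  assumes l: "0 \<le> l" and [measurable]: "X \<in> borel_measurable M" "Y \<in> borel_measurable M"
    and int: "integrable M X" "integrable M Y" and XY: "\<And>x. x \<in> space M \<Longrightarrow> 0 \<le> Y x \<and> Y x \<le> X x"
  shows "\<bar>expectation (\<lambda>x. exp (- (l * X x))) - expectation (\<lambda>x. exp (- (l * Y x)))\<bar>
    \<le> l * (expectation X - expectation Y)"
proof -
  have exp_diff_le: "\<bar>exp (- (l * X x)) - exp (- (l * Y x))\<bar> \<le> l * (X x - Y x)" if "x \<in> space M" for x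
  proof -
    have "0 \<le> l * Y x" "l * Y x \<le> l * X x" using XY[OF that] l by (simp_all add: mult_left_mono)
    moreover have "exp (- b) - exp (- a) \<le> a - b" if "0 \<le> b" "b \<le> a" for a b :: real
    proof -
      have "exp (- b) - exp (- a) = exp (- b) * (1 - exp (b - a))"
        by (simp add: algebra_simps exp_add[symmetric])
      also have "\<dots> \<le> 1 * (1 - exp (b - a))" using that by (intro mult_right_mono) auto
      also have "\<dots> \<le> a - b" by (smt (verit) exp_ge_add_one_self)
      finally show ?thesis .
    qed
    ultimately show ?thesis by (simp add: abs_le_iff right_diff_distrib)
  qed
  have int_exp: "integrable M (\<lambda>x. exp (- (l * Z x)))"
    if [measurable]: "Z \<in> borel_measurable M" and "\<And>x. x \<in> space M \<Longrightarrow> 0 \<le> Z x" for Z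
    using that(2) l by (intro integrable_const_bound[of _ 1]) auto
  have "0 \<le> X x" "0 \<le> Y x" if "x \<in> space M" for x
    using XY[OF that] by simp_all
  then have int_exp_XY: "integrable M (\<lambda>x. exp (- (l * X x)))" "integrable M (\<lambda>x. exp (- (l * Y x)))"
    using int_exp by simp_all
  have "\<bar>expectation (\<lambda>x. exp (- (l * X x))) - expectation (\<lambda>x. exp (- (l * Y x)))\<bar>
      = \<bar>expectation (\<lambda>x. exp (- (l * X x)) - exp (- (l * Y x)))\<bar>"
    using int_exp_XY by simp
  also have "\<dots> \<le> expectation (\<lambda>x. \<bar>exp (- (l * X x)) - exp (- (l * Y x))\<bar>)"
    by (rule integral_abs_bound)
  also have "\<dots> \<le> expectation (\<lambda>x. l * (X x - Y x))"
    using int int_exp_XY exp_diff_le by (intro integral_mono) auto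
  also have "\<dots> = l * (expectation X - expectation Y)"
    using int by simp
  finally show ?thesis .
qed

section \<open>Averaging out coordinates of an i.i.d. family\<close>

abbreviation iid :: "'s measure \<Rightarrow> ('i \<Rightarrow> 's) measure" where
  "iid P \<equiv> PiM UNIV (\<lambda>_. P)"

definition partial_expectation :: "'s measure \<Rightarrow> 'i set \<Rightarrow> (('i \<Rightarrow> 's) \<Rightarrow> real) \<Rightarrow> ('i \<Rightarrow> 's) \<Rightarrow> real" where
  "partial_expectation P J F x = (\<integral>y. F (override_on y x J) \<partial>iid P)"

definition depends_on :: "'i set \<Rightarrow> (('i \<Rightarrow> 's) \<Rightarrow> real) \<Rightarrow> bool" where
  "depends_on J F \<longleftrightarrow> (\<forall>x y. (\<forall>i\<in>J. x i = y i) \<longrightarrow> F x = F y)"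

lemma depends_onD: "depends_on J F \<Longrightarrow> (\<And>i. i \<in> J \<Longrightarrow> x i = y i) \<Longrightarrow> F x = F y"
  unfolding depends_on_def by blast

lemma depends_on_override_on: "depends_on J F \<Longrightarrow> F (override_on y x J) = F x"
  by (rule depends_onD) auto

lemma depends_on_mono: "depends_on J F \<Longrightarrow> J \<subseteq> K \<Longrightarrow> depends_on K F"
  unfolding depends_on_def by blast

lemma depends_on_diff: "depends_on J F \<Longrightarrow> depends_on J G \<Longrightarrow> depends_on J (\<lambda>x. F x - G x)"
  unfolding depends_on_def by metis

lemma depends_on_sum: "(\<And>i. i \<in> I \<Longrightarrow> depends_on J (F i)) \<Longrightarrow> depends_on J (\<lambda>x. \<Sum>i\<in>I. F i x)"
  unfolding depends_on_def by (auto intro!: sum.cong)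

lemma depends_on_partial_expectation: "depends_on J (partial_expectation P J F)"
  unfolding depends_on_def partial_expectation_def override_on_def
  by (auto intro!: Bochner_Integration.integral_cong arg_cong[where f = F])

lemma partial_expectation_empty: "partial_expectation P {} F x = (\<integral>y. F y \<partial>iid P)"
  by (simp add: partial_expectation_def)

lemma measurable_iidI:
  assumes "\<And>i. (\<lambda>w. X w i) \<in> N \<rightarrow>\<^sub>M P"
  shows "X \<in> N \<rightarrow>\<^sub>M iid P"
  using assms by (intro measurable_PiM_single') (auto dest: measurable_space simp: PiE_iff)

lemma measurable_override_on[measurable (raw)]:
  assumes [measurable]: "X \<in> N \<rightarrow>\<^sub>M iid P" "Y \<in> N \<rightarrow>\<^sub>M iid P"
  shows "(\<lambda>w. override_on (Y w) (X w) J) \<in> N \<rightarrow>\<^sub>M iid P"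
proof (rule measurable_iidI)
  fix i
  show "(\<lambda>w. override_on (Y w) (X w) J i) \<in> N \<rightarrow>\<^sub>M P"
    unfolding override_on_def by (cases "i \<in> J") auto
qed

lemma vimage_override_on_cylinder:
  fixes P :: "'s measure" and J :: "'i set"
  shows "(\<lambda>(x, y). override_on y x J) -` prod_emb UNIV (\<lambda>_. P) L (Pi\<^sub>E L A) \<inter> space (iid P \<Otimes>\<^sub>M iid P)
    = prod_emb UNIV (\<lambda>_. P) (L \<inter> J) (Pi\<^sub>E (L \<inter> J) A) \<times> prod_emb UNIV (\<lambda>_. P) (L - J) (Pi\<^sub>E (L - J) A)"
  (is "?pre = ?prod")
proof (rule set_eqI)
  fix p :: "('i \<Rightarrow> 's) \<times> ('i \<Rightarrow> 's)"
  have cylinder: "z \<in> prod_emb UNIV (\<lambda>_. P) K (Pi\<^sub>E K A) \<longleftrightarrow> (\<forall>i. z i \<in> space P) \<and> (\<forall>i\<in>K. z i \<in> A i)" for z K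
    by (auto simp: prod_emb_def space_PiM PiE_iff)
  have "p \<in> space (iid P \<Otimes>\<^sub>M iid P) \<longleftrightarrow> (\<forall>i. fst p i \<in> space P) \<and> (\<forall>i. snd p i \<in> space P)"
    by (cases p) (auto simp: space_pair_measure space_PiM PiE_iff)
  then show "p \<in> ?pre \<longleftrightarrow> p \<in> ?prod"
    unfolding Int_iff vimage_eq mem_Times_iff cylinder split_beta override_on_def
    by (simp split: if_splits) blast
qed

context prob_space
begin

lemma prob_space_iid: "prob_space (iid M)"
  by (intro prob_space_PiM prob_space_axioms)

lemma pair_prob_space_iid: "pair_prob_space (iid M) (iid M)"
  by (simp add: pair_prob_space_def pair_sigma_finite_def prob_space_iid prob_space_imp_sigma_finite)

lemma distr_iid_component: "distr (iid M) M (\<lambda>x. x i) = M"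
  using distr_PiM_component[of UNIV "\<lambda>_. M" i] prob_space_axioms by simp

lemma distr_iid_reindex:
  assumes "inj \<tau>"
  shows "distr (iid M) (iid M) (\<lambda>x k. x (\<tau> k)) = iid M"
  using distr_PiM_reindex[of UNIV "\<lambda>_. M" \<tau> UNIV] assms prob_space_axioms
  by (simp add: restrict_UNIV)

lemma distr_iid_override_on:
  fixes J :: "'i set"
  shows "distr (iid M \<Otimes>\<^sub>M iid M) (iid M) (\<lambda>(x, y). override_on y x J) = iid M"
proof (rule product_prob_space.PiM_eq)
  show "product_prob_space (\<lambda>_. M)"
    unfolding product_prob_space_def product_prob_space_axioms_def product_sigma_finite_def
    by (auto intro: prob_space_axioms sigma_finite_measure_axioms)
  interpret iid: pair_prob_space "iid M :: ('i \<Rightarrow> 'a) measure" "iid M" by (rule pair_prob_space_iid)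
  fix L :: "'i set" and A assume L: "finite L" and A: "\<And>j. j \<in> L \<Longrightarrow> A j \<in> sets M"
  let ?C = "\<lambda>K. prod_emb UNIV (\<lambda>_. M) K (Pi\<^sub>E K A)"
  have C: "?C K \<in> sets (iid M)" "emeasure (iid M) (?C K) = (\<Prod>j\<in>K. emeasure M (A j))" if "K \<subseteq> L" for K
    using that L A by (auto intro!: sets_PiM_I emeasure_PiM_emb prob_space_axioms intro: finite_subset)
  have "emeasure (distr (iid M \<Otimes>\<^sub>M iid M) (iid M) (\<lambda>(x, y). override_on y x J)) (?C L)
      = emeasure (iid M \<Otimes>\<^sub>M iid M) (?C (L \<inter> J) \<times> ?C (L - J))"
    unfolding vimage_override_on_cylinder[symmetric] by (rule emeasure_distr) (auto simp: C)
  also have "\<dots> = (\<Prod>j\<in>L \<inter> J. emeasure M (A j)) * (\<Prod>j\<in>L - J. emeasure M (A j))"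
    by (subst iid.M1.emeasure_pair_measure_Times) (auto simp: C)
  also have "\<dots> = (\<Prod>j\<in>L. emeasure M (A j))"
    using prod.union_disjoint[of "L \<inter> J" "L - J" "\<lambda>j. emeasure M (A j)"] L
    by (simp add: Int_Diff_disjoint Int_Diff_Un)
  finally show "emeasure (distr (iid M \<Otimes>\<^sub>M iid M) (iid M) (\<lambda>(x, y). override_on y x J)) (?C L)
      = (\<Prod>j\<in>L. emeasure M (A j))" .
qed simp

lemma square_integrable_override_on:
  assumes "square_integrable (iid M) F"
  shows "square_integrable (iid M \<Otimes>\<^sub>M iid M) (\<lambda>(x, y). F (override_on y x J))"
    and "l2norm (iid M \<Otimes>\<^sub>M iid M) (\<lambda>(x, y). F (override_on y x J)) = l2norm (iid M) F"
  using square_integrable_distr[OF _ distr_iid_override_on assms, of J] by (auto simp: split_beta')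

lemma integral_override_on:
  fixes F :: "('i \<Rightarrow> 'a) \<Rightarrow> real"
  assumes F: "integrable (iid M) F"
  shows "(\<integral>x. \<integral>y. F (override_on y x J) \<partial>iid M \<partial>iid M) = (\<integral>x. F x \<partial>iid M)"
proof -
  interpret iid: pair_prob_space "iid M :: ('i \<Rightarrow> 'a) measure" "iid M" by (rule pair_prob_space_iid)
  note [measurable] = borel_measurable_integrable[OF F]
  have "integrable (distr (iid M \<Otimes>\<^sub>M iid M) (iid M) (\<lambda>(x, y). override_on y x J)) F"
    using F by (simp add: distr_iid_override_on)
  then have "integrable (iid M \<Otimes>\<^sub>M iid M) (\<lambda>(x, y). F (override_on y x J))"
    by (subst (asm) integrable_distr_eq) (auto simp: split_beta')
  then have "(\<integral>x. \<integral>y. F (override_on y x J) \<partial>iid M \<partial>iid M)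
      = (\<integral>(x, y). F (override_on y x J) \<partial>(iid M \<Otimes>\<^sub>M iid M))"
    by (rule iid.integral_fst)
  also have "\<dots> = (\<integral>x. F x \<partial>distr (iid M \<Otimes>\<^sub>M iid M) (iid M) (\<lambda>(x, y). override_on y x J))"
    by (subst integral_distr) (auto simp: split_beta')
  finally show ?thesis unfolding distr_iid_override_on .
qed

lemma partial_expectation_depends_on:
  fixes F :: "('i \<Rightarrow> 'a) \<Rightarrow> real"
  assumes "depends_on J F" "J \<subseteq> K"
  shows "partial_expectation M K F x = F x"
proof -
  interpret iid: prob_space "iid M :: ('i \<Rightarrow> 'a) measure" by (rule prob_space_iid)
  show ?thesis
    using depends_on_override_on[OF depends_on_mono[OF assms]]
    by (simp add: partial_expectation_def iid.prob_space)
qed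

lemma measurable_partial_expectation[measurable]:
  fixes F :: "('i \<Rightarrow> 'a) \<Rightarrow> real"
  assumes [measurable]: "F \<in> borel_measurable (iid M)"
  shows "partial_expectation M J F \<in> borel_measurable (iid M)"
proof -
  interpret iid: pair_prob_space "iid M :: ('i \<Rightarrow> 'a) measure" "iid M" by (rule pair_prob_space_iid)
  show ?thesis unfolding partial_expectation_def[abs_def] by measurable
qed

lemma square_integrable_partial_expectation:
  fixes F :: "('i \<Rightarrow> 'a) \<Rightarrow> real"
  assumes F: "square_integrable (iid M) F"
  shows "square_integrable (iid M) (partial_expectation M J F)"
    and "AE x in iid M. integrable (iid M) (\<lambda>y. F (override_on y x J))"
proof -
  interpret iid: pair_prob_space "iid M :: ('i \<Rightarrow> 'a) measure" "iid M" by (rule pair_prob_space_iid)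
  note FJ = square_integrable_override_on(1)[OF F, of J]
  show "square_integrable (iid M) (partial_expectation M J F)"
    using iid.square_integrable_inner(1)[OF FJ iid.M1.square_integrable_const[of 1]]
    by (simp add: partial_expectation_def[abs_def])
  show "AE x in iid M. integrable (iid M) (\<lambda>y. F (override_on y x J))"
    using iid.square_integrable_section(1)[OF FJ] by eventually_elim
        (rule iid.M1.integrable_if_square_integrable)
qed

lemma integral_partial_expectation:
  fixes F :: "('i \<Rightarrow> 'a) \<Rightarrow> real"
  assumes "square_integrable (iid M) F"
  shows "(\<integral>x. partial_expectation M J F x \<partial>iid M) = (\<integral>x. F x \<partial>iid M)"
proof -
  interpret iid: prob_space "iid M :: ('i \<Rightarrow> 'a) measure" by (rule prob_space_iid)
  show ?thesis
    unfolding partial_expectation_def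
    by (rule integral_override_on[OF iid.integrable_if_square_integrable[OF assms]])
qed

lemma l2norm_minus_partial_expectation_le:
  fixes F :: "('i \<Rightarrow> 'a) \<Rightarrow> real"
  assumes F: "square_integrable (iid M) F"
  shows "l2norm (iid M) (\<lambda>x. F x - partial_expectation M J F x)
    \<le> l2norm (iid M \<Otimes>\<^sub>M iid M) (\<lambda>(x, y). F x - F (override_on y x J))"
proof -
  interpret iid: pair_prob_space "iid M :: ('i \<Rightarrow> 'a) measure" "iid M" by (rule pair_prob_space_iid)
  note [measurable] = borel_measurable_square_integrable[OF F]
  have resampled: "square_integrable (iid M \<Otimes>\<^sub>M iid M) (\<lambda>(x, y). F x - F (override_on y x J))"
    using square_integrable_diff[OF square_integrable_override_on(1)[OF F, of UNIV]
        square_integrable_override_on(1)[OF F, of J]]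
    by (simp add: override_on_def[of _ _ UNIV] split_beta')
  have "l2norm (iid M) (\<lambda>x. F x - partial_expectation M J F x)
      = l2norm (iid M) (\<lambda>x. \<integral>y. F x - F (override_on y x J) \<partial>iid M)"
  proof (rule l2norm_cong_AE)
    show "AE x in iid M. F x - partial_expectation M J F x = (\<integral>y. F x - F (override_on y x J) \<partial>iid M)"
      using square_integrable_partial_expectation(2)[OF F, of J]
      by eventually_elim (simp add: partial_expectation_def iid.M1.prob_space)
  qed measurable
  also have "\<dots> \<le> l2norm (iid M \<Otimes>\<^sub>M iid M) (\<lambda>(x, y). F x - F (override_on y x J))"
    using iid.square_integrable_inner(2)[OF resampled iid.M1.square_integrable_const[of 1]]
    by (simp add: l2norm_def iid.M1.prob_space)
  finally show ?thesis .
qed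

text \<open>Resampling the coordinates outside \<open>J\<close> leaves \<open>H\<close> unchanged, so the coordinates in
  \<open>K - J\<close> can be integrated out of \<open>F\<close>.\<close>
lemma integral_partial_expectation_mult:
  fixes F H :: "('i \<Rightarrow> 'a) \<Rightarrow> real"
  assumes F: "square_integrable (iid M) F" and H: "square_integrable (iid M) H" and dep: "depends_on J H"
  shows "(\<integral>x. partial_expectation M K F x * H x \<partial>iid M)
      = (\<integral>x. partial_expectation M (K \<inter> J) F x * H x \<partial>iid M)"
proof -
  interpret iid: pair_prob_space "iid M :: ('i \<Rightarrow> 'a) measure" "iid M" by (rule pair_prob_space_iid)
  note [measurable] = borel_measurable_square_integrable[OF F] borel_measurable_square_integrable[OF H]
  have "(\<integral>x. partial_expectation M K F x * H x \<partial>iid M)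
      = (\<integral>x. \<integral>z. partial_expectation M K F (override_on z x J) * H (override_on z x J) \<partial>iid M \<partial>iid M)"
    by (rule integral_override_on[symmetric] integrable_mult square_integrable_partial_expectation F H)+
  also have "\<dots> = (\<integral>x. partial_expectation M (K \<inter> J) F x * H x \<partial>iid M)"
  proof (rule integral_cong_AE)
    have override: "override_on y (override_on z x J) K
        = override_on (override_on y z K) x (K \<inter> J)" for x y z :: "'i \<Rightarrow> 'a"
      by (auto simp: override_on_def fun_eq_iff)
    show "AE x in iid M. (\<integral>z. partial_expectation M K F (override_on z x J) * H (override_on z x J) \<partial>iid M)
        = partial_expectation M (K \<inter> J) F x * H x"
      using square_integrable_partial_expectation(2)[OF F, of "K \<inter> J"]
    proof eventually_elim
      case (elim x)
      have "(\<integral>z. partial_expectation M K F (override_on z x J) \<partial>iid M)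
          = (\<integral>z. \<integral>y. F (override_on (override_on y z K) x (K \<inter> J)) \<partial>iid M \<partial>iid M)"
        by (simp add: partial_expectation_def override)
      also have "\<dots> = partial_expectation M (K \<inter> J) F x"
        unfolding partial_expectation_def by (rule integral_override_on[OF elim])
      finally show ?case by (simp add: depends_on_override_on[OF dep])
    qed
  qed measurable
  finally show ?thesis .
qed

lemma integral_mult_disjoint:
  assumes F: "square_integrable (iid M) F" and H: "square_integrable (iid M) H"
    and dep: "depends_on K F" "depends_on J H" "K \<inter> J = {}"
  shows "(\<integral>x. F x * H x \<partial>iid M) = (\<integral>x. F x \<partial>iid M) * (\<integral>x. H x \<partial>iid M)"
  using integral_partial_expectation_mult[OF F H dep(2), of K] dep(3)
  by (simp add: partial_expectation_depends_on[OF dep(1) order_refl] partial_expectation_empty)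

end

section \<open>Shifted functionals of an i.i.d. sequence\<close>

definition shifted :: "((nat \<Rightarrow> 's) \<Rightarrow> real) \<Rightarrow> int \<Rightarrow> (int \<Rightarrow> 's) \<Rightarrow> real" where
  "shifted g i x = g (\<lambda>k. x (i - int k))"

abbreviation truncated :: "'s measure \<Rightarrow> nat \<Rightarrow> ((nat \<Rightarrow> 's) \<Rightarrow> real) \<Rightarrow> (nat \<Rightarrow> 's) \<Rightarrow> real" where
  "truncated P m g \<equiv> partial_expectation P {..<m} g"

definition coupling_error :: "'s measure \<Rightarrow> ((nat \<Rightarrow> 's) \<Rightarrow> real) \<Rightarrow> nat \<Rightarrow> real" where
  "coupling_error P g m = l2norm (iid P \<Otimes>\<^sub>M iid P) (\<lambda>(x, y). g x - g (override_on y x {..<m}))"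

definition coupling_tail :: "'s measure \<Rightarrow> ((nat \<Rightarrow> 's) \<Rightarrow> real) \<Rightarrow> nat \<Rightarrow> real" where
  "coupling_tail P g m = (\<Sum>l. coupling_error P g (l + m) + coupling_error P g (Suc (l + m)))"

definition autocovariance :: "'s measure \<Rightarrow> ((nat \<Rightarrow> 's) \<Rightarrow> real) \<Rightarrow> nat \<Rightarrow> real" where
  "autocovariance P g k = (\<integral>x. shifted g 0 x * shifted g (int k) x \<partial>iid P)"

definition long_run_variance :: "'s measure \<Rightarrow> ((nat \<Rightarrow> 's) \<Rightarrow> real) \<Rightarrow> real" where
  "long_run_variance P g = autocovariance P g 0 + 2 * (\<Sum>k. autocovariance P g (Suc k))"

definition normalized_sum :: "((nat \<Rightarrow> 's) \<Rightarrow> real) \<Rightarrow> nat \<Rightarrow> (int \<Rightarrow> 's) \<Rightarrow> real" where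
  "normalized_sum g N x = (\<Sum>i=1..int N. shifted g i x) / sqrt (real N)"

lemma coupling_error_nonneg[simp]: "0 \<le> coupling_error P g m"
  by (simp add: coupling_error_def)

lemma shifted_diff: "shifted g i x - shifted h i x = shifted (\<lambda>x. g x - h x) i x"
  by (simp add: shifted_def)

lemma shifted_translate: "shifted g i (\<lambda>k. x (k + s)) = shifted g (i + s) x"
  by (simp add: shifted_def algebra_simps)

lemma depends_on_shifted: "depends_on {..i} (shifted g i)"
  unfolding depends_on_def shifted_def by (auto intro!: arg_cong[where f = g])

lemma depends_on_shifted_window:
  assumes "depends_on {..<m} h" shows "depends_on {i - int m<..i} (shifted h i)"
  using assms unfolding depends_on_def shifted_def by auto

context prob_space
begin

lemma measurable_past[measurable]: "(\<lambda>x k. x (i - int k)) \<in> iid M \<rightarrow>\<^sub>M iid M"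
  by (intro measurable_iidI) measurable

lemma distr_past: "distr (iid M) (iid M) (\<lambda>x k. x (i - int k)) = iid M"
  by (rule distr_iid_reindex) (auto simp: inj_def)

lemma measurable_shifted[measurable]: "g \<in> borel_measurable (iid M) \<Longrightarrow> shifted g i \<in> borel_measurable (iid M)"
  unfolding shifted_def[abs_def] by (rule measurable_compose[OF measurable_past])

lemma square_integrable_shifted:
  assumes "square_integrable (iid M) g"
  shows "square_integrable (iid M) (shifted g i)" "l2norm (iid M) (shifted g i) = l2norm (iid M) g"
  using square_integrable_distr[OF measurable_past distr_past assms] by (simp_all add: shifted_def[abs_def])

lemma integral_shifted:
  assumes [measurable]: "g \<in> borel_measurable (iid M)"
  shows "(\<integral>x. shifted g i x \<partial>iid M) = (\<integral>x. g x \<partial>iid M)"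
  using integral_distr[OF measurable_past[of i], of g] unfolding distr_past by (simp add: shifted_def)

lemma distr_translate: "distr (iid M) (iid M) (\<lambda>x k. x (k + s)) = iid M" for s :: int
  by (rule distr_iid_reindex) (auto simp: inj_def)

lemma measurable_translate[measurable]: "(\<lambda>x k. x (k + s)) \<in> iid M \<rightarrow>\<^sub>M iid M" for s :: int
  by (intro measurable_iidI) measurable

lemma integral_shifted_mult_stationary:
  assumes [measurable]: "g \<in> borel_measurable (iid M)" "h \<in> borel_measurable (iid M)"
  shows "(\<integral>x. shifted g i x * shifted h j x \<partial>iid M) = (\<integral>x. shifted g 0 x * shifted h (j - i) x \<partial>iid M)"
  using integral_distr[OF measurable_translate[of i], of "\<lambda>x. shifted g 0 x * shifted h (j - i) x"]
  unfolding distr_translate by (simp add: shifted_translate)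

lemma shifted_truncated:
  assumes [measurable]: "g \<in> borel_measurable (iid M)" and x: "x \<in> space (iid M)"
  shows "shifted (truncated M m g) i x = partial_expectation M {i - int m<..i} (shifted g i) x"
proof -
  have past: "(\<lambda>k. x (i - int k)) \<in> space (iid M)" using measurable_space[OF measurable_past x] .
  have [measurable]: "(\<lambda>w. g (override_on w (\<lambda>k. x (i - int k)) {..<m})) \<in> borel_measurable (iid M)"
    using past by measurable
  have "shifted (truncated M m g) i x = (\<integral>w. g (override_on w (\<lambda>k. x (i - int k)) {..<m}) \<partial>iid M)"
    by (simp add: shifted_def partial_expectation_def)
  also have "\<dots> = (\<integral>y. g (override_on (\<lambda>k. y (i - int k)) (\<lambda>k. x (i - int k)) {..<m}) \<partial>iid M)"
    using integral_distr[OF measurable_past[of i], of "\<lambda>w. g (override_on w (\<lambda>k. x (i - int k)) {..<m})"]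
    unfolding distr_past by simp
  also have "\<dots> = partial_expectation M {i - int m<..i} (shifted g i) x"
    unfolding partial_expectation_def shifted_def
    by (intro Bochner_Integration.integral_cong refl arg_cong[where f
        = g]) (auto simp: override_on_def fun_eq_iff)
  finally show ?thesis .
qed

lemma l2norm_minus_truncated_le:
  "square_integrable (iid M) g \<Longrightarrow> l2norm (iid M) (\<lambda>x. g x - truncated M m g x) \<le> coupling_error M g m"
  unfolding coupling_error_def by (rule l2norm_minus_partial_expectation_le)

text \<open>The coordinate \<open>i - l\<close> enters the increment at \<open>i\<close> but not the one at \<open>j > i\<close>, and averaging over
  it annihilates the former.\<close>
lemma integral_truncation_increments_eq_0:
  fixes l :: nat
  assumes g: "square_integrable (iid M) g" and ij: "i < j"
  defines "D \<equiv> \<lambda>i x. shifted (truncated M (Suc l) g) i x - shifted (truncated M l g) i x"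
  shows "(\<integral>x. D i x * D j x \<partial>iid M) = 0"
proof -
  note [measurable] = borel_measurable_square_integrable[OF g]
  let ?E = "\<lambda>m. partial_expectation M {i - int m<..i} (shifted g i)"
  have D: "square_integrable (iid M) (D j)" for j
    unfolding D_def by (intro square_integrable_diff square_integrable_shifted
        square_integrable_partial_expectation g)
  have E: "square_integrable (iid M) (?E m)" for m
    by (intro square_integrable_partial_expectation square_integrable_shifted g)
  have dep: "depends_on {j - int (Suc l)<..j} (D j)"
    unfolding D_def
    by (intro depends_on_diff depends_on_shifted_window depends_on_partial_expectation
        depends_on_mono[OF depends_on_shifted_window[OF depends_on_partial_expectation]]) auto
  have "(\<integral>x. D i x * D j x \<partial>iid M) = (\<integral>x. ?E (Suc l) x * D j x - ?E l x * D j x \<partial>iid M)"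
    by (intro Bochner_Integration.integral_cong refl) (simp add: D_def shifted_truncated left_diff_distrib)
  also have "\<dots> = (\<integral>x. ?E (Suc l) x * D j x \<partial>iid M) - (\<integral>x. ?E l x * D j x \<partial>iid M)"
    by (intro Bochner_Integration.integral_diff integrable_mult E D)
  also have "(\<integral>x. ?E (Suc l) x * D j x \<partial>iid M) = (\<integral>x. ?E l x * D j x \<partial>iid M)"
  proof -
    have "{i - int (Suc l)<..i} \<inter> {j - int (Suc l)<..j} = {i - int l<..i} \<inter> {j - int (Suc l)<..j}"
      using ij by auto
    then show ?thesis
      using integral_partial_expectation_mult[OF square_integrable_shifted(1)[OF g] D dep] by metis
  qed
  finally show ?thesis by simp
qed

lemma l2norm_truncation_increment_sum_le:
  assumes g: "square_integrable (iid M) g" and I: "finite I"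
  shows "l2norm (iid M) (\<lambda>x. \<Sum>i\<in>I. shifted (truncated M (Suc l) g) i x - shifted (truncated M l g) i x)
    \<le> sqrt (card I) * (coupling_error M g l + coupling_error M g (Suc l))"
proof -
  let ?h = "\<lambda>x. truncated M (Suc l) g x - truncated M l g x"
  have h: "square_integrable (iid M) ?h"
    by (intro square_integrable_diff square_integrable_partial_expectation g)
  have "l2norm (iid M) (\<lambda>x. \<Sum>i\<in>I. shifted ?h i x) = sqrt (card I) * l2norm (iid M) ?h"
  proof (rule l2norm_sum_orthogonal[OF I square_integrable_shifted(1)[OF h] _
      square_integrable_shifted(2)[OF h]])
    show "(\<integral>x. shifted ?h i x * shifted ?h j x \<partial>iid M) = 0" if "i \<noteq> j" for i j
      using that integral_truncation_increments_eq_0[OF g, of i j l]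
          integral_truncation_increments_eq_0[OF g, of j i l]
      by (cases i j rule: linorder_cases) (simp_all add: shifted_diff mult.commute)
  qed
  also have "l2norm (iid M) ?h \<le> coupling_error M g l + coupling_error M g (Suc l)"
  proof -
    have "l2norm (iid M) ?h
        = l2norm (iid M) (\<lambda>x. (g x - truncated M l g x) - (g x - truncated M (Suc l) g x))" by simp
    also have "\<dots> \<le> l2norm (iid M) (\<lambda>x. g x - truncated M l g x) + l2norm (iid M) (\<lambda>x. g x - truncated M
      (Suc l) g x)"
      by (intro l2norm_diff_le square_integrable_diff g square_integrable_partial_expectation)
    also have "\<dots> \<le> coupling_error M g l + coupling_error M g (Suc l)"
      by (intro add_mono l2norm_minus_truncated_le g)
    finally show ?thesis .
  qed
  finally show ?thesis by (simp add: shifted_diff mult_left_mono)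
qed

lemma l2norm_truncation_sum_le:
  assumes g: "square_integrable (iid M) g" and I: "finite I" and mL: "m \<le> L"
  shows "l2norm (iid M) (\<lambda>x. \<Sum>i\<in>I. shifted (truncated M L g) i x - shifted (truncated M m g) i x)
    \<le> sqrt (card I) * (\<Sum>l=m..<L. coupling_error M g l + coupling_error M g (Suc l))"
proof -
  let ?D = "\<lambda>l i x. shifted (truncated M (Suc l) g) i x - shifted (truncated M l g) i x"
  have "(\<Sum>i\<in>I. shifted (truncated M L g) i x - shifted (truncated M m g) i x)
      = (\<Sum>l=m..<L. \<Sum>i\<in>I. ?D l i x)" for x
    by (subst sum.swap) (intro sum.cong refl sum_Suc_diff'[OF mL, symmetric])
  then have "l2norm (iid M) (\<lambda>x. \<Sum>i\<in>I. shifted (truncated M L g) i x - shifted (truncated M m g) i x)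
      \<le> (\<Sum>l=m..<L. l2norm (iid M) (\<lambda>x. \<Sum>i\<in>I. ?D l i x))"
    by (simp only:) (intro l2norm_sum_le square_integrable_sum square_integrable_diff
        square_integrable_shifted square_integrable_partial_expectation g)
  also have "\<dots> \<le> (\<Sum>l=m..<L. sqrt (card I) * (coupling_error M g l + coupling_error M g (Suc l)))"
    by (intro sum_mono l2norm_truncation_increment_sum_le g I)
  finally show ?thesis by (simp add: sum_distrib_left)
qed

lemma abs_integral_shifted_mult_le:
  assumes g: "square_integrable (iid M) g" and h: "square_integrable (iid M) h" and mean: "(\<integral>x. h x \<partial>iid
      M) = 0"
  shows "\<bar>\<integral>x. shifted g 0 x * shifted h (int k) x \<partial>iid M\<bar> \<le> l2norm (iid M) g * coupling_error M h k"
proof -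
  note [measurable] = borel_measurable_square_integrable[OF g] borel_measurable_square_integrable[OF h]
  define T where "T = shifted (truncated M k h) (int k)"
  have T: "square_integrable (iid M) T"
    unfolding T_def by (intro square_integrable_shifted square_integrable_partial_expectation h)
  have g0: "square_integrable (iid M) (shifted g 0)" and hk: "square_integrable (iid M) (shifted h (int k))"
    by (intro square_integrable_shifted g h)+
  have "(\<integral>x. T x * shifted g 0 x \<partial>iid M)
      = (\<integral>x. partial_expectation M {int k - int k<..int k} (shifted h (int k)) x * shifted g 0 x \<partial>iid M)"
    unfolding T_def by (intro Bochner_Integration.integral_cong refl) (simp add: shifted_truncated)
  also have "\<dots> = (\<integral>x. partial_expectation M ({int k - int k<..int k}
      \<inter> {..0}) (shifted h (int k)) x * shifted g 0 x \<partial>iid M)"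
    by (rule integral_partial_expectation_mult[OF hk g0 depends_on_shifted])
  also have "{int k - int k<..int k} \<inter> {..0} = {}" by auto
  finally have T_orth: "(\<integral>x. T x * shifted g 0 x \<partial>iid M) = 0"
    by (simp add: partial_expectation_empty integral_shifted mean)
  have "(\<integral>x. shifted g 0 x * shifted h (int k) x \<partial>iid M)
      = (\<integral>x. shifted g 0 x * (shifted h (int k) x - T x) + T x * shifted g 0 x \<partial>iid M)"
    by (simp add: algebra_simps)
  also have "\<dots> = (\<integral>x. shifted g 0 x * (shifted h (int k) x - T x) \<partial>iid M)"
    using T_orth by (subst Bochner_Integration.integral_add)
      (auto intro!: integrable_mult square_integrable_diff g0 hk T)
  also have "\<bar>\<dots>\<bar> \<le> l2norm (iid M) (shifted g 0) * l2norm (iid M) (\<lambda>x. shifted h (int k) x - T x)"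
    by (intro Cauchy_Schwarz_integral square_integrable_diff g0 hk T)
  also have "\<dots> = l2norm (iid M) g * l2norm (iid M) (\<lambda>x. h x - truncated M k h x)"
    unfolding T_def shifted_diff
    by (simp add: square_integrable_shifted(2) square_integrable_diff g h
        square_integrable_partial_expectation)
  also have "\<dots> \<le> l2norm (iid M) g * coupling_error M h k"
    by (intro mult_left_mono l2norm_minus_truncated_le h) auto
  finally show ?thesis .
qed

end

locale weakly_dependent = prob_space M for M :: "'s measure" +
  fixes g :: "(nat \<Rightarrow> 's) \<Rightarrow> real"
  assumes g: "square_integrable (iid M) g"
    and summable_coupling_error: "summable (coupling_error M g)"
    and mean: "(\<integral>x. g x \<partial>iid M) = 0"
begin

lemma summable_coupling_tail: "summable (\<lambda>l. coupling_error M g l + coupling_error M g (Suc l))"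
  using summable_coupling_error by (intro summable_add) (auto simp: summable_Suc_iff)

lemma coupling_tail_nonneg: "0 \<le> coupling_tail M g m"
  using summable_ignore_initial_segment[OF summable_coupling_tail, of m]
  unfolding coupling_tail_def by (intro suminf_nonneg) auto

lemma coupling_tail_tendsto: "coupling_tail M g \<longlonglongrightarrow> 0"
  using suminf_exist_split2[OF summable_coupling_tail] by (simp add: coupling_tail_def[abs_def])

lemma sum_coupling_error_le:
  assumes "m \<le> L"
  shows "(\<Sum>l=m..<L. coupling_error M g l + coupling_error M g (Suc l)) \<le> coupling_tail M g m"
proof -
  let ?e = "\<lambda>l. coupling_error M g l + coupling_error M g (Suc l)"
  have "(\<Sum>l=m..<L. ?e l) = (\<Sum>l<L - m. ?e (l + m))"
    using sum.shift_bounds_nat_ivl[of ?e 0 m "L - m"] assms by (simp add: atLeast0LessThan)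
  also have "\<dots> \<le> (\<Sum>l. ?e (l + m))"
    using summable_ignore_initial_segment[OF summable_coupling_tail] by (intro sum_le_suminf) auto
  finally show ?thesis by (simp add: coupling_tail_def)
qed

lemma square_integrable_truncated: "square_integrable (iid M) (truncated M m g)"
  by (intro square_integrable_partial_expectation g)

lemma integral_truncated: "(\<integral>x. truncated M m g x \<partial>iid M) = 0"
  using integral_partial_expectation[OF g] mean by simp

lemma shifted_truncated_0: "shifted (truncated M 0 g) i x = 0"
  by (simp add: shifted_def partial_expectation_empty mean)

lemma l2norm_remainder_sum_le:
  assumes I: "finite I"
  shows "l2norm (iid M) (\<lambda>x. \<Sum>i\<in>I. shifted g i x - shifted (truncated M m g) i x)
      \<le> sqrt (card I) * coupling_tail M g m"
    (is "?norm \<le> _")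
proof (rule LIMSEQ_le_const)
  have "(\<lambda>L. card I * coupling_error M g L + sqrt (card I) * coupling_tail M g m)
      \<longlonglongrightarrow> real (card I) * 0 + sqrt (card I) * coupling_tail M g m"
    using summable_LIMSEQ_zero[OF summable_coupling_error] by (intro tendsto_intros)
  then show "(\<lambda>L. card I * coupling_error M g L + sqrt (card I) * coupling_tail M g m)
      \<longlonglongrightarrow> sqrt (card I) * coupling_tail M g m"
    by simp
  show "\<exists>N. \<forall>L\<ge>N. ?norm \<le> card I * coupling_error M g L + sqrt (card I) * coupling_tail M g m"
  proof (intro exI allI impI)
    fix L assume L: "m \<le> L"
    let ?R = "\<lambda>i x. shifted g i x - shifted (truncated M L g) i x"
    let ?D = "\<lambda>i x. shifted (truncated M L g) i x - shifted (truncated M m g) i x"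
    have R_sq: "square_integrable (iid M) (?R i)" and D_sq: "square_integrable (iid M) (?D i)" for i
      by (intro square_integrable_diff square_integrable_shifted square_integrable_truncated g)+
    have "l2norm (iid M) (\<lambda>x. \<Sum>i\<in>I. ?R i x) \<le> (\<Sum>i\<in>I. l2norm (iid M) (?R i))"
      by (intro l2norm_sum_le R_sq)
    also have "\<dots> = (\<Sum>i\<in>I. l2norm (iid M) (\<lambda>x. g x - truncated M L g x))"
      unfolding shifted_diff
      by (intro sum.cong refl square_integrable_shifted(2) square_integrable_diff
          square_integrable_truncated g)
    also have "\<dots> \<le> card I * coupling_error M g L"
      using l2norm_minus_truncated_le[OF g] by (simp add: mult_left_mono)
    finally have R: "l2norm (iid M) (\<lambda>x. \<Sum>i\<in>I. ?R i x) \<le> card I * coupling_error M g L" .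
    have D: "l2norm (iid M) (\<lambda>x. \<Sum>i\<in>I. ?D i x) \<le> sqrt (card I) * coupling_tail M g m"
      using l2norm_truncation_sum_le[OF g I L] sum_coupling_error_le[OF L]
      by (meson mult_left_mono order_trans real_sqrt_ge_zero of_nat_0_le_iff)
    have "?norm = l2norm (iid M) (\<lambda>x. (\<Sum>i\<in>I. ?R i x) + (\<Sum>i\<in>I. ?D i x))"
      by (simp add: sum_subtractf)
    also have "\<dots> \<le> l2norm (iid M) (\<lambda>x. \<Sum>i\<in>I. ?R i x) + l2norm (iid M) (\<lambda>x. \<Sum>i\<in>I. ?D i x)"
      by (intro l2norm_add_le square_integrable_sum R_sq D_sq)
    finally show "?norm \<le> card I * coupling_error M g L + sqrt (card I) * coupling_tail M g m"
      using R D by linarith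
  qed
qed

lemma l2norm_shifted_sum_le:
  assumes I: "finite I"
  shows "l2norm (iid M) (\<lambda>x. \<Sum>i\<in>I. shifted g i x) \<le> sqrt (card I) * coupling_tail M g 0"
    and "l2norm (iid M) (\<lambda>x. \<Sum>i\<in>I. shifted (truncated M m g) i x) \<le> sqrt (card I) * coupling_tail M g 0"
proof -
  show "l2norm (iid M) (\<lambda>x. \<Sum>i\<in>I. shifted g i x) \<le> sqrt (card I) * coupling_tail M g 0"
    using l2norm_remainder_sum_le[OF I, of 0] by (simp only: shifted_truncated_0 diff_0_right)
  have "l2norm (iid M) (\<lambda>x. \<Sum>i\<in>I. shifted (truncated M m g) i x)
      \<le> sqrt (card I) * (\<Sum>l=0..<m. coupling_error M g l + coupling_error M g (Suc l))"
    using l2norm_truncation_sum_le[OF g I, of 0 m] by (simp only: shifted_truncated_0 diff_0_right le0)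
  also have "\<dots> \<le> sqrt (card I) * coupling_tail M g 0"
    by (intro mult_left_mono sum_coupling_error_le) auto
  finally show "l2norm (iid M) (\<lambda>x. \<Sum>i\<in>I. shifted (truncated M m g) i x)
      \<le> sqrt (card I) * coupling_tail M g 0" .
qed

lemma square_integrable_normalized_sum: "square_integrable (iid M) (normalized_sum g N)"
  unfolding normalized_sum_def[abs_def]
  by (intro square_integrable_divide square_integrable_sum square_integrable_shifted g)

lemma l2norm_normalized_sum_le: "l2norm (iid M) (normalized_sum g N) \<le> coupling_tail M g 0"
proof (cases "N = 0")
  case True
  then show ?thesis by (simp add: normalized_sum_def[abs_def] coupling_tail_nonneg)
next
  case False
  then show ?thesis
    using l2norm_shifted_sum_le(1)[of "{1..int N}"]
    by (simp add: normalized_sum_def[abs_def] l2norm_divide field_simps)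
qed

lemma second_moment_sum_Suc:
  "(\<integral>x. (\<Sum>i=1..int (Suc N). shifted g i x)\<^sup>2 \<partial>iid M)
    = (\<integral>x. (\<Sum>i=1..int N. shifted g i x)\<^sup>2 \<partial>iid M) +
      (autocovariance M g 0 + 2 * (\<Sum>k<N. autocovariance M g (Suc k)))"
proof -
  let ?S = "\<lambda>x. \<Sum>i=1..int N. shifted g i x" and ?X = "shifted g (int (Suc N))"
  note [measurable] = borel_measurable_square_integrable[OF g]
  have shift: "square_integrable (iid M) (shifted g i)" for i by (rule square_integrable_shifted[OF g])
  have S: "square_integrable (iid M) ?S" by (intro square_integrable_sum shift)
  note [simp] = integrable_square[OF S] integrable_mult[OF shift shift] integrable_mult[OF S shift]
  have "{1..int (Suc N)} = insert (int (Suc N)) {1..int N}" by auto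
  then have "(\<integral>x. (\<Sum>i=1..int (Suc N). shifted g i x)\<^sup>2 \<partial>iid M)
      = (\<integral>x. (?S x)\<^sup>2 + (?X x * ?X x + 2 * (?S x * ?X x)) \<partial>iid M)"
    by (intro Bochner_Integration.integral_cong refl) (simp add: power2_eq_square algebra_simps)
  also have "\<dots> = (\<integral>x. (?S x)\<^sup>2 \<partial>iid M) + ((\<integral>x. ?X x * ?X x \<partial>iid M) + 2 * (\<integral>x. ?S x * ?X x \<partial>iid M))"
    by simp
  also have "(\<integral>x. ?X x * ?X x \<partial>iid M) = autocovariance M g 0"
    unfolding autocovariance_def by (subst integral_shifted_mult_stationary) auto
  also have "(\<integral>x. ?S x * ?X x \<partial>iid M) = (\<Sum>i=1..int N. autocovariance M g (nat (int (Suc N) - i)))"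
    unfolding autocovariance_def sum_distrib_right
    by (subst Bochner_Integration.integral_sum)
      (auto intro!: sum.cong simp: integral_shifted_mult_stationary[of g g _ "1 + int N"])
  also have "\<dots> = (\<Sum>k<N. autocovariance M g (Suc k))"
    by (rule sum.reindex_bij_witness[of _ "\<lambda>k. int N - int k" "\<lambda>i. N - nat i"])
       (auto intro!: arg_cong[where f = "autocovariance M g"])
  finally show ?thesis .
qed

lemma l2norm_normalized_sum_square_tendsto:
  "(\<lambda>N. (l2norm (iid M) (normalized_sum g N))\<^sup>2) \<longlonglongrightarrow> long_run_variance M g"
proof -
  have "summable (\<lambda>k. autocovariance M g (Suc k))"
  proof (rule summable_comparison_test')
    show "summable (\<lambda>k. l2norm (iid M) g * coupling_error M g (Suc k))"
      using summable_coupling_error by (intro summable_mult) (simp add: summable_Suc_iff)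
    show "norm (autocovariance M g (Suc k)) \<le> l2norm (iid M) g * coupling_error M g (Suc k)" for k
      unfolding autocovariance_def real_norm_def by (rule abs_integral_shifted_mult_le[OF g g mean])
  qed
  then have "(\<lambda>n. autocovariance M g 0 + 2 * (\<Sum>k<n. autocovariance M g (Suc k))) \<longlonglongrightarrow> long_run_variance M g"
    unfolding long_run_variance_def by (intro tendsto_intros summable_LIMSEQ)
  from Cesaro_mean_tendsto[OF this] show ?thesis
  proof (rule Lim_transform_eventually, intro always_eventually allI)
    fix N
    have "(\<integral>x. (\<Sum>i=1..int N. shifted g i x)\<^sup>2 \<partial>iid M)
        = (\<Sum>n<N. autocovariance M g 0 + 2 * (\<Sum>k<n. autocovariance M g (Suc k)))"
      by (induct N) (simp, unfold second_moment_sum_Suc, simp)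
    then show "(\<Sum>n<N. autocovariance M g 0 + 2 * (\<Sum>k<n. autocovariance M g (Suc k))) / real N
        = (l2norm (iid M) (normalized_sum g N))\<^sup>2"
      by (simp add: l2norm_square normalized_sum_def power_divide)
  qed
qed

lemma long_run_variance_nonneg: "0 \<le> long_run_variance M g"
  by (rule LIMSEQ_le_const[OF l2norm_normalized_sum_square_tendsto]) auto

end

section \<open>Central limit theorem for shifted functionals\<close>

lemma (in prob_space) char_eq_1_if_l2norm_eq_0:
  assumes X: "square_integrable M X" and zero: "l2norm M X = 0"
  shows "char (distr M borel X) u = 1"
proof -
  have "char (distr M borel (\<lambda>x. 0)) u = 1"
    by (simp add: char_def integral_distr prob_space del: distr_const)
  moreover have "cmod (char (distr M borel X) u - char (distr M borel (\<lambda>x. 0)) u)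
      \<le> \<bar>u\<bar> * l2norm M (\<lambda>x. X x - 0)"
    by (intro char_diff_le_l2norm X square_integrable_zero)
  ultimately show ?thesis using zero by simp
qed

lemma l2norm_cong_distr:
  assumes [measurable]: "X \<in> borel_measurable M" "Y \<in> borel_measurable M"
    and "distr M borel X = distr M borel Y"
  shows "l2norm M X = l2norm M Y"
proof -
  have "l2norm M Z = l2norm (distr M borel Z) (\<lambda>x. x)" if [measurable]: "Z \<in> borel_measurable M" for Z
    by (simp add: l2norm_def integral_distr)
  then show ?thesis using assms by simp
qed

lemma (in prob_space) iid_CLT_char:
  fixes X :: "nat \<Rightarrow> 'a \<Rightarrow> real"
  assumes indep: "indep_vars (\<lambda>i. borel) X UNIV"
    and mean: "\<And>n. expectation (X n) = 0"
    and X: "\<And>n. square_integrable M (X n)"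
    and ident: "\<And>n. distr M borel (X n) = distr M borel (X 0)"
  shows "(\<lambda>q. char (distr M borel (\<lambda>x. (\<Sum>r<q. X r x) / sqrt q)) u)
     \<longlonglongrightarrow> complex_of_real (exp (- (u\<^sup>2 * (l2norm M (X 0))\<^sup>2) / 2))"
proof -
  note [measurable] = borel_measurable_square_integrable[OF X]
  define \<sigma> where "\<sigma> = l2norm M (X 0)"
  have \<sigma>: "l2norm M (X n) = \<sigma>" for n
    unfolding \<sigma>_def by (rule l2norm_cong_distr) (use ident in auto)
  have scaled_sum: "square_integrable M (\<lambda>x. (\<Sum>r<q. X r x) / sqrt q)" for q
    by (intro square_integrable_divide square_integrable_sum X)
  show ?thesis
  proof (cases "\<sigma> = 0")
    case True
    have "l2norm M (\<lambda>x. \<Sum>r<q. X r x) \<le> 0" for q :: nat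
      using l2norm_sum_le[of "{..<q}" M X] X by (simp add: \<sigma> True)
    then have "l2norm M (\<lambda>x. (\<Sum>r<q. X r x) / sqrt q) = 0" for q
      by (simp add: l2norm_divide antisym)
    then have "char (distr M borel (\<lambda>x. (\<Sum>r<q. X r x) / sqrt q)) u = 1" for q
      by (intro char_eq_1_if_l2norm_eq_0 scaled_sum)
    then show ?thesis using True by (simp add: \<sigma>_def)
  next
    case False
    then have \<sigma>_pos: "\<sigma> > 0" by (simp add: \<sigma>_def order_less_le)
    let ?S = "\<lambda>q x. (\<Sum>r<q. X r x) / sqrt (q * \<sigma>\<^sup>2)"
    have "variance (X n) = \<sigma>\<^sup>2" for n
      by (simp add: mean \<sigma>[of n, symmetric] l2norm_square)
    then have "weak_conv_m (\<lambda>q. distr M borel (?S q)) std_normal_distribution"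
      using X ident by (intro central_limit_theorem_zero_mean[OF indep mean \<sigma>_pos])
        (auto simp: square_integrable_def)
    then have "(\<lambda>q. char (distr M borel (?S q)) (u * \<sigma>)) \<longlonglongrightarrow> char std_normal_distribution (u * \<sigma>)"
      by (intro levy_continuity1 real_dist_normal_dist) (auto intro!: real_distribution_distr)
    moreover have "char (distr M borel (\<lambda>x. (\<Sum>r<q. X r x) / sqrt q)) u
        = char (distr M borel (?S q)) (u * \<sigma>)" for q
    proof -
      have "(\<Sum>r<q. X r x) / sqrt q = \<sigma> * ?S q x" for x
        using \<sigma>_pos by (simp add: real_sqrt_mult)
      then show ?thesis by (simp only:) (rule char_scale, measurable)
    qed
    ultimately show ?thesis
      by (simp add: char_std_normal_distribution \<sigma>_def[symmetric] power_mult_distrib)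
  qed
qed

context prob_space
begin

lemma indep_vars_iid_coordinates: "prob_space.indep_vars (iid M) (\<lambda>_. M) (\<lambda>i x. x i) (UNIV :: 'i set)"
proof -
  interpret iid: prob_space "iid M :: ('i \<Rightarrow> 'a) measure" by (rule prob_space_iid)
  show ?thesis
    by (subst iid.indep_vars_iff_distr_eq_PiM) (auto simp: distr_iid_component restrict_UNIV distr_id)
qed

lemma indep_vars_if_depends_on_disjoint:
  fixes W :: "nat \<Rightarrow> 'i set"
  assumes B: "\<And>r. B r \<in> borel_measurable (iid M)"
    and dep: "\<And>r. depends_on (W r) (B r)" and disj: "disjoint_family W"
  shows "prob_space.indep_vars (iid M) (\<lambda>_. borel) B UNIV"
proof -
  interpret iid: prob_space "iid M :: ('i \<Rightarrow> 'a) measure" by (rule prob_space_iid)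
  obtain s0 where s0: "s0 \<in> space M" using not_empty by auto
  define E where "E r z = B r (\<lambda>i. if i \<in> W r then z i else s0)" for r z
  have "iid.indep_vars (\<lambda>r. PiM (W r) (\<lambda>_. M)) (\<lambda>r x. restrict (\<lambda>i. x i) (W r)) UNIV"
    by (rule iid.indep_vars_restrict[OF indep_vars_iid_coordinates]) (use disj in auto)
  then have "iid.indep_vars (\<lambda>_. borel) (\<lambda>r x. E r (restrict (\<lambda>i. x i) (W r))) UNIV"
  proof (rule iid.indep_vars_compose2)
    fix r
    have "(\<lambda>z i. if i \<in> W r then z i else s0) \<in> PiM (W r) (\<lambda>_. M) \<rightarrow>\<^sub>M iid M"
    proof (rule measurable_iidI)
      show "(\<lambda>z. if i \<in> W r then z i else s0) \<in> PiM (W r) (\<lambda>_. M) \<rightarrow>\<^sub>M M" for i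
        using s0 by (cases "i \<in> W r") auto
    qed
    from measurable_compose[OF this B[of r]]
    show "E r \<in> borel_measurable (PiM (W r) (\<lambda>_. M))" unfolding E_def[abs_def] .
  qed
  moreover have "E r (restrict (\<lambda>i. x i) (W r)) = B r x" for r x
    unfolding E_def by (rule depends_onD[OF dep]) auto
  ultimately show ?thesis by simp
qed

end

definition block_indices :: "nat \<Rightarrow> nat \<Rightarrow> nat \<Rightarrow> int set" where
  "block_indices l m r = {int (r * (l + m)) + 1..int (r * (l + m) + l)}"

definition block_sum :: "((nat \<Rightarrow> 's) \<Rightarrow> real) \<Rightarrow> nat \<Rightarrow> nat \<Rightarrow> nat \<Rightarrow> (int \<Rightarrow> 's) \<Rightarrow> real" where
  "block_sum h l m r x = (\<Sum>i\<in>block_indices l m r. shifted h i x)"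

lemma finite_block_indices[simp]: "finite (block_indices l m r)"
  and card_block_indices[simp]: "card (block_indices l m r) = l"
  by (simp_all add: block_indices_def)

text \<open>The gaps of length \<open>m\<close> keep the windows of memory \<open>m\<close> behind different blocks apart.\<close>
lemma disjoint_family_block_windows:
  "disjoint_family (\<lambda>r. {int (r * (l + m)) + 1 - int m..int (r * (l + m) + l)})"
proof -
  have "{int (r * (l + m)) + 1 - int m..int (r * (l + m) + l)}
      \<inter> {int (s * (l + m)) + 1 - int m..int (s * (l + m) + l)} = {}"
    if "r < s" for r s
  proof -
    have "(r + 1) * (l + m) \<le> s * (l + m)" using that by (intro mult_right_mono) auto
    then have "r * (l + m) + l + m \<le> s * (l + m)" by (simp add: algebra_simps)
    then have "int (r * (l + m) + l) + int m \<le> int (s * (l + m))"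
      by (simp only: of_nat_add[symmetric] of_nat_le_iff)
    then show ?thesis by auto
  qed
  then show ?thesis
    unfolding disjoint_family_on_def by (metis Int_commute linorder_neqE_nat)
qed

lemma disjoint_family_block_indices: "disjoint_family (block_indices l m)"
  by (rule disjoint_family_subset[OF disjoint_family_block_windows[of l m]]) (auto simp: block_indices_def)

lemma UN_block_indices_subset: "(\<Union>r<N div (l + m). block_indices l m r) \<subseteq> {1..int N}"
proof
  fix i assume "i \<in> (\<Union>r<N div (l + m). block_indices l m r)"
  then obtain r where r: "r < N div (l + m)" "int (r * (l + m)) + 1 \<le> i" "i \<le> int (r * (l + m) + l)"
    by (auto simp: block_indices_def)
  have "(r + 1) * (l + m) \<le> N div (l + m) * (l + m)" using r(1) by (intro mult_right_mono) auto
  also have "\<dots> \<le> N" by simp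
  finally have "r * (l + m) + l \<le> N" by simp
  then have "int (r * (l + m) + l) \<le> int N" by (simp only: of_nat_le_iff)
  then have "i \<le> int N" using r(3) by (rule order_trans[rotated])
  moreover have "1 \<le> i" using r(2) of_nat_0_le_iff[of "r * (l + m)", where 'a = int] by linarith
  ultimately show "i \<in> {1..int N}" by simp
qed

lemma card_outside_blocks_div_le:
  fixes l m N :: nat
  assumes p: "0 < l + m" and N: "0 < N"
  shows "card ({1..int N} - (\<Union>r<N div (l + m). block_indices l m r)) / N \<le> m / (l + m) + (l + m) / N"
proof -
  define q where "q = N div (l + m)"
  have "card (\<Union>r<q. block_indices l m r) = q * l"
    using disjoint_family_block_indices[of l m]
    by (subst card_UN_disjoint) (auto simp: disjoint_family_on_def)
  then have "card ({1..int N} - (\<Union>r<q. block_indices l m r)) = N - q * l"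
    using UN_block_indices_subset[of l m N, folded q_def] by (simp add: card_Diff_subset finite_subset)
  moreover have "N < q * (l + m) + (l + m)"
    using div_mult_mod_eq[of N "l + m"] mod_less_divisor[OF p, of N] unfolding q_def by linarith
  then have "N - q * l \<le> q * m + (l + m)"
    by (simp add: algebra_simps)
  ultimately have "real (card ({1..int N} - (\<Union>r<q. block_indices l m r))) \<le> q * m + (l + m)"
    by (simp only: of_nat_le_iff)
  then have "card ({1..int N} - (\<Union>r<q. block_indices l m r)) / N \<le> (q * m + (l + m)) / N"
    by (rule divide_right_mono) simp
  also have "\<dots> = real q / N * m + (l + m) / N"
    by (simp add: add_divide_distrib)
  also have "real q / N * m \<le> 1 / real (l + m) * m"
  proof (rule mult_right_mono)
    have "q * (l + m) \<le> N" unfolding q_def by simp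
    then have "real q * real (l + m) \<le> real N" by (simp only: of_nat_mult[symmetric] of_nat_le_iff)
    moreover have "x / y \<le> 1 / z" if "x * z \<le> y" "0 < y" "0 < z" for x y z :: real
      using that by (simp add: field_simps)
    ultimately show "real q / N \<le> 1 / real (l + m)" using p N by (simp only: of_nat_0_less_iff)
  qed simp
  finally show ?thesis unfolding q_def by simp
qed

lemma div_ratio_tendsto:
  assumes p: "0 < p"
  shows "(\<lambda>N. real (N div p) / real N) \<longlonglongrightarrow> 1 / real p"
proof (rule tendsto_sandwich)
  have lower: "real N / real p - 1 \<le> real (N div p)" and upper: "real (N div p) \<le> real N / real p" for N
  proof -
    have "real (N div p) = of_int \<lfloor>real N / real p\<rfloor>" by (simp add: floor_divide_of_nat_eq)
    then show "real N / real p - 1 \<le> real (N div p)" "real (N div p) \<le> real N / real p"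
      using of_int_floor_le[of "real N / real p"] real_of_int_floor_ge_diff_one[of "real N / real p"] by
          linarith+
  qed
  show "\<forall>\<^sub>F N in sequentially. 1 / real p - 1 / real N \<le> real (N div p) / real N"
    using eventually_gt_at_top[of 0]
  proof eventually_elim
    case (elim N)
    from divide_right_mono[OF lower[of N], of "real N"] elim show ?case by (simp add: diff_divide_distrib)
  qed
  show "\<forall>\<^sub>F N in sequentially. real (N div p) / real N \<le> 1 / real p"
    using eventually_gt_at_top[of 0]
  proof eventually_elim
    case (elim N)
    from divide_right_mono[OF upper[of N], of "real N"] elim show ?case by simp
  qed
  have "(\<lambda>N. 1 / real p - 1 / real N) \<longlonglongrightarrow> 1 / real p - 0"
    by (intro tendsto_intros lim_1_over_n)
  then show "(\<lambda>N. 1 / real p - 1 / real N) \<longlonglongrightarrow> 1 / real p" by simp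
qed simp

lemma filterlim_div_at_top:
  assumes "0 < p" shows "filterlim (\<lambda>N. N div p) at_top sequentially"
  unfolding filterlim_at_top
proof
  fix Z
  show "\<forall>\<^sub>F N in sequentially. Z \<le> N div p"
    using eventually_ge_at_top[of "Z * p"]
    by eventually_elim (use assms in \<open>simp add: less_eq_div_iff_mult_less_eq\<close>)
qed

locale finite_memory = prob_space M for M :: "'s measure" +
  fixes h :: "(nat \<Rightarrow> 's) \<Rightarrow> real" and m l :: nat
  assumes h: "square_integrable (iid M) h" and h_mean: "(\<integral>x. h x \<partial>iid M) = 0"
    and h_depends: "depends_on {..<m} h"
begin

lemma square_integrable_block_sum: "square_integrable (iid M) (block_sum h l m r)"
  unfolding block_sum_def[abs_def] by (intro square_integrable_sum square_integrable_shifted h)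

lemma measurable_block_sum[measurable]: "block_sum h l m r \<in> borel_measurable (iid M)"
  using square_integrable_block_sum by (rule borel_measurable_square_integrable)

lemma depends_on_block_sum:
  "depends_on {int (r * (l + m)) + 1 - int m..int (r * (l + m) + l)} (block_sum h l m r)"
  unfolding block_sum_def[abs_def] block_indices_def
  by (intro depends_on_sum depends_on_mono[OF depends_on_shifted_window[OF h_depends]]) auto

lemma integral_block_sum: "(\<integral>x. block_sum h l m r x \<partial>iid M) = 0"
proof -
  interpret iid: prob_space "iid M :: (int \<Rightarrow> 's) measure" by (rule prob_space_iid)
  note [measurable] = borel_measurable_square_integrable[OF h]
  show ?thesis
    unfolding block_sum_def
    using iid.integrable_if_square_integrable[OF square_integrable_shifted(1)[OF h]]
    by (simp add: integral_shifted h_mean)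
qed

lemma distr_block_sum: "distr (iid M) borel (block_sum h l m r) = distr (iid M) borel (block_sum h l m 0)"
proof -
  let ?s = "int (r * (l + m))"
  have "block_sum h l m r x = block_sum h l m 0 (\<lambda>k. x (k + ?s))" for x
    unfolding block_sum_def block_indices_def shifted_translate
    by (rule sum.reindex_bij_witness[of _ "\<lambda>i. i + ?s" "\<lambda>i. i - ?s"]) auto
  then have "distr (iid M) borel (block_sum h l m r)
      = distr (distr (iid M) (iid M) (\<lambda>x k. x (k + ?s))) borel (block_sum h l m 0)"
    by (subst distr_distr) (auto simp: comp_def intro!: arg_cong[where f = "distr (iid M) borel"])
  then show ?thesis by (simp add: distr_translate)
qed

lemma block_sum_CLT:
  "(\<lambda>q. char (distr (iid M) borel (\<lambda>x. (\<Sum>r<q. block_sum h l m r x) / sqrt q)) u)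
    \<longlonglongrightarrow> complex_of_real (exp (- (u\<^sup>2 * (l2norm (iid M) (block_sum h l m 0))\<^sup>2) / 2))"
proof -
  interpret iid: prob_space "iid M :: (int \<Rightarrow> 's) measure" by (rule prob_space_iid)
  have "iid.indep_vars (\<lambda>_. borel) (block_sum h l m) UNIV"
    by (rule indep_vars_if_depends_on_disjoint[OF _ depends_on_block_sum disjoint_family_block_windows]) simp
  from iid.iid_CLT_char[OF this integral_block_sum square_integrable_block_sum distr_block_sum] show ?thesis .
qed

lemma l2norm_sum_block_sum:
  "l2norm (iid M) (\<lambda>x. \<Sum>r<q. block_sum h l m r x) = sqrt q * l2norm (iid M) (block_sum h l m 0)"
proof -
  have "l2norm (iid M) (\<lambda>x. \<Sum>r<q. block_sum h l m r x)
      = sqrt (card {..<q}) * l2norm (iid M) (block_sum h l m 0)"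
  proof (rule l2norm_sum_orthogonal[OF _ square_integrable_block_sum])
    show "(\<integral>x. block_sum h l m r x * block_sum h l m s x \<partial>iid M) = 0" if "r \<noteq> s" for r s
      using integral_mult_disjoint[OF square_integrable_block_sum square_integrable_block_sum
          depends_on_block_sum depends_on_block_sum, of r s]
        disjoint_family_onD[OF disjoint_family_block_windows[of l m], of r s] that
      by (simp add: integral_block_sum)
    show "l2norm (iid M) (block_sum h l m r) = l2norm (iid M) (block_sum h l m 0)" for r
      by (intro l2norm_cong_distr distr_block_sum) auto
  qed simp
  then show ?thesis by simp
qed

lemma normalized_block_sum_CLT:
  fixes u :: real
  assumes p: "0 < l + m"
  defines "b \<equiv> sqrt (1 / real (l + m)) * l2norm (iid M) (block_sum h l m 0)"
    and "T \<equiv> \<lambda>N x. (\<Sum>r<N div (l + m). block_sum h l m r x) / sqrt (real N)"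
  shows "(\<lambda>N. l2norm (iid M) (T N)) \<longlonglongrightarrow> b"
    and "(\<lambda>N. char (distr (iid M) borel (T N)) u) \<longlonglongrightarrow> complex_of_real (exp (- (u\<^sup>2 * b\<^sup>2) / 2))"
proof -
  interpret iid: prob_space "iid M :: (int \<Rightarrow> 's) measure" by (rule prob_space_iid)
  let ?B = "l2norm (iid M) (block_sum h l m 0)"
  define S where "S q x = (\<Sum>r<q. block_sum h l m r x) / sqrt (real q)" for q x
  define c where "c N = sqrt (real (N div (l + m)) / real N)" for N
  have c: "c \<longlonglongrightarrow> sqrt (1 / real (l + m))"
    unfolding c_def[abs_def] by (intro tendsto_intros div_ratio_tendsto p)
  have T_norm: "l2norm (iid M) (T N) = c N * ?B" for N
    by (simp add: T_def l2norm_divide l2norm_sum_block_sum c_def real_sqrt_divide)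
  then show "(\<lambda>N. l2norm (iid M) (T N)) \<longlonglongrightarrow> b"
    unfolding b_def by (simp add: tendsto_mult_right[OF c] del: of_nat_add)
  have "(\<lambda>N. char (distr (iid M) borel (\<lambda>x. c N * S (N div (l + m)) x)) u)
      \<longlonglongrightarrow> complex_of_real (exp (- (u\<^sup>2 * b\<^sup>2) / 2))"
  proof (rule iid.char_scaled_tendsto[OF _ _ c])
    show "square_integrable (iid M) (S (N div (l + m)))" for N
      unfolding S_def[abs_def]
      by (intro square_integrable_divide square_integrable_sum square_integrable_block_sum)
    show "l2norm (iid M) (S (N div (l + m))) \<le> ?B" for N
      by (simp add: S_def[abs_def] l2norm_divide l2norm_sum_block_sum)
    show "(\<lambda>N. char (distr (iid M) borel (S (N div (l + m)))) (u * sqrt (1 / real (l + m))))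
        \<longlonglongrightarrow> complex_of_real (exp (- (u\<^sup>2 * b\<^sup>2) / 2))"
      using filterlim_compose[OF block_sum_CLT[of "u * sqrt (1 / real (l + m))"] filterlim_div_at_top[OF p]]
      by (simp add: S_def[abs_def] b_def power_mult_distrib mult_ac del: of_nat_add)
  qed
  moreover have "T N = (\<lambda>x. c N * S (N div (l + m)) x)" for N
    by (cases "N div (l + m) = 0") (simp_all add: T_def S_def c_def real_sqrt_divide)
  ultimately show "(\<lambda>N. char (distr (iid M) borel (T N)) u) \<longlonglongrightarrow> complex_of_real (exp (- (u\<^sup>2 * b\<^sup>2) / 2))"
    by simp
qed

end

context weakly_dependent
begin

lemma finite_memory_truncated: "finite_memory M (truncated M m g) m"
  by unfold_locales (rule square_integrable_truncated integral_truncated depends_on_partial_expectation)+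

lemma l2norm_block_approximation_le:
  fixes l m N :: nat
  assumes p: "0 < l + m" and N: "0 < N"
  shows "l2norm (iid M) (\<lambda>x. normalized_sum g N x - (\<Sum>r<N div (l + m). block_sum (truncated M m g) l m r
      x) / sqrt N)
    \<le> coupling_tail M g m + sqrt (m / (l + m) + (l + m) / N) * coupling_tail M g 0"
    (is "l2norm _ ?D \<le> _")
proof -
  let ?h = "truncated M m g"
  define blocks where "blocks = (\<Union>r<N div (l + m). block_indices l m r)"
  define gaps where "gaps = {1..int N} - blocks"
  have "(\<Sum>r<N div (l + m). block_sum ?h l m r x) = (\<Sum>i\<in>blocks. shifted ?h i x)" for x
    unfolding block_sum_def blocks_def using disjoint_family_block_indices[of l m]
    by (intro sum.UNION_disjoint[symmetric]) (auto simp: disjoint_family_on_def)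
  moreover have "(\<Sum>i=1..int N. shifted ?h i x)
      = (\<Sum>i\<in>gaps. shifted ?h i x) + (\<Sum>i\<in>blocks. shifted ?h i x)" for x
    unfolding gaps_def blocks_def by (rule sum.subset_diff[OF UN_block_indices_subset]) simp
  ultimately have split: "?D
      = (\<lambda>x. (\<Sum>i=1..int N. shifted g i x - shifted ?h i x) / sqrt N + (\<Sum>i\<in>gaps. shifted ?h i x) / sqrt N)"
    by (simp add: fun_eq_iff normalized_sum_def sum_subtractf diff_divide_distrib add_divide_distrib)
  have "l2norm (iid M) ?D \<le> l2norm (iid M) (\<lambda>x. \<Sum>i=1..int N. shifted g i x - shifted ?h i x) / sqrt N
      + l2norm (iid M) (\<lambda>x. \<Sum>i\<in>gaps. shifted ?h i x) / sqrt N"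
    unfolding split
    by (intro order_trans[OF l2norm_add_le] square_integrable_divide square_integrable_sum
        square_integrable_diff
        square_integrable_shifted square_integrable_truncated g) (simp add: l2norm_divide)
  also have "\<dots> \<le> sqrt (card {1..int N}) * coupling_tail M g m / sqrt N + sqrt (card gaps) * coupling_tail
      M g 0 / sqrt N"
    by (intro add_mono divide_right_mono l2norm_remainder_sum_le l2norm_shifted_sum_le) (auto simp: gaps_def)
  also have "\<dots> = coupling_tail M g m + sqrt (card gaps / N) * coupling_tail M g 0"
    using N by (simp add: real_sqrt_divide)
  also have "\<dots> \<le> coupling_tail M g m + sqrt (m / (l + m) + (l + m) / N) * coupling_tail M g 0"
    using card_outside_blocks_div_le[OF p N]
    by (intro add_left_mono mult_right_mono coupling_tail_nonneg) (simp add: gaps_def blocks_def)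
  finally show ?thesis .
qed

text \<open>Blocks of length \<open>n\<^sup>2 + 1\<close> with memory \<open>n\<close> leave a vanishing fraction of the indices in the gaps.\<close>
definition blocked_sum :: "nat \<Rightarrow> nat \<Rightarrow> (int \<Rightarrow> 's) \<Rightarrow> real" where
  "blocked_sum n N x = (\<Sum>r<N div (n\<^sup>2 + 1 + n). block_sum (truncated M n g) (n\<^sup>2 + 1) n r x) / sqrt (real N)"

definition blocked_deviation :: "nat \<Rightarrow> real" where
  "blocked_deviation n = sqrt (1 / real (n\<^sup>2 + 1 + n)) * l2norm (iid M) (block_sum (truncated M n g) (n\<^sup>2 +
      1) n 0)"

definition blocking_error :: "nat \<Rightarrow> real" where
  "blocking_error n = coupling_tail M g n + sqrt (real n / real (n\<^sup>2 + 1 + n)) * coupling_tail M g 0"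

definition finite_blocking_error :: "nat \<Rightarrow> nat \<Rightarrow> real" where
  "finite_blocking_error n N =
    coupling_tail M g n + sqrt (real n / real (n\<^sup>2 + 1 + n) + real (n\<^sup>2 + 1 + n) / real N) * coupling_tail M
        g 0"

lemma square_integrable_blocked_sum: "square_integrable (iid M) (blocked_sum n N)"
  unfolding blocked_sum_def[abs_def]
  by (intro square_integrable_divide square_integrable_sum finite_memory.square_integrable_block_sum
      finite_memory_truncated)

lemma blocked_sum_CLT:
  shows "(\<lambda>N. l2norm (iid M) (blocked_sum n N)) \<longlonglongrightarrow> blocked_deviation n"
    and "(\<lambda>N. char (distr (iid M) borel (blocked_sum n N)) u)
        \<longlonglongrightarrow> complex_of_real (exp (- (u\<^sup>2 * (blocked_deviation n)\<^sup>2) / 2))"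
  using finite_memory.normalized_block_sum_CLT[OF finite_memory_truncated, of "n\<^sup>2 + 1" n]
  by (simp_all add: blocked_sum_def[abs_def] blocked_deviation_def)

lemma l2norm_normalized_minus_blocked_sum_le:
  "0 < N \<Longrightarrow> l2norm (iid M) (\<lambda>x. normalized_sum g N x - blocked_sum n N x) \<le> finite_blocking_error n N"
  unfolding blocked_sum_def finite_blocking_error_def by (rule l2norm_block_approximation_le) simp_all

lemma finite_blocking_error_tendsto: "finite_blocking_error n \<longlonglongrightarrow> blocking_error n"
proof -
  have "finite_blocking_error n
      \<longlonglongrightarrow> coupling_tail M g n + sqrt (real n / real (n\<^sup>2 + 1 + n) + 0) * coupling_tail M g 0"
    unfolding finite_blocking_error_def by (intro tendsto_intros lim_const_over_n)
  then show ?thesis by (simp add: blocking_error_def)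
qed

lemma blocking_error_tendsto: "blocking_error \<longlonglongrightarrow> 0"
proof -
  have "(\<lambda>n. real n / real (n\<^sup>2 + 1 + n)) \<longlonglongrightarrow> 0" by real_asymp
  then have "blocking_error \<longlonglongrightarrow> 0 + sqrt 0 * coupling_tail M g 0"
    unfolding blocking_error_def by (intro tendsto_intros coupling_tail_tendsto)
  then show ?thesis by simp
qed

lemma blocked_deviation_tendsto: "blocked_deviation \<longlonglongrightarrow> sqrt (long_run_variance M g)"
proof -
  have norm_lim: "(\<lambda>N. l2norm (iid M) (normalized_sum g N)) \<longlonglongrightarrow> sqrt (long_run_variance M g)"
    using tendsto_real_sqrt[OF l2norm_normalized_sum_square_tendsto] by simp
  have "\<bar>blocked_deviation n - sqrt (long_run_variance M g)\<bar> \<le> blocking_error n" for n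
  proof (rule tendsto_le[OF sequentially_bot finite_blocking_error_tendsto])
    show "(\<lambda>N. \<bar>l2norm (iid M) (blocked_sum n N) - l2norm (iid M) (normalized_sum g N)\<bar>)
        \<longlonglongrightarrow> \<bar>blocked_deviation n - sqrt (long_run_variance M g)\<bar>"
      by (intro tendsto_intros blocked_sum_CLT norm_lim)
    show "\<forall>\<^sub>F N in sequentially. \<bar>l2norm (iid M) (blocked_sum n N) - l2norm (iid M) (normalized_sum g N)\<bar>
        \<le> finite_blocking_error n N"
      using eventually_gt_at_top[of 0]
    proof eventually_elim
      case (elim N)
      have "\<bar>l2norm (iid M) (blocked_sum n N) - l2norm (iid M) (normalized_sum g N)\<bar>
          \<le> l2norm (iid M) (\<lambda>x. blocked_sum n N x - normalized_sum g N x)"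
        by (intro abs_l2norm_diff_le square_integrable_blocked_sum square_integrable_normalized_sum)
      also note l2norm_minus_commute
      also note l2norm_normalized_minus_blocked_sum_le[OF elim]
      finally show ?case .
    qed
  qed
  then have "(\<lambda>n. blocked_deviation n - sqrt (long_run_variance M g)) \<longlonglongrightarrow> 0"
    by (intro Lim_null_comparison[OF _ blocking_error_tendsto]) simp
  then show ?thesis by (simp add: LIM_zero_iff)
qed

theorem normalized_sum_CLT:
  "(\<lambda>N. char (distr (iid M) borel (normalized_sum g N)) u)
    \<longlonglongrightarrow> complex_of_real (exp (- (u\<^sup>2 * long_run_variance M g) / 2))"
proof -
  interpret iid: prob_space "iid M :: (int \<Rightarrow> 's) measure" by (rule prob_space_iid)
  show ?thesis
  proof (rule tendsto_uniform_approximation)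
    show "(\<lambda>N. char (distr (iid M) borel (blocked_sum n N)) u)
        \<longlonglongrightarrow> complex_of_real (exp (- (u\<^sup>2 * (blocked_deviation n)\<^sup>2) / 2))" for n
      by (rule blocked_sum_CLT(2))
    have "(\<lambda>n. complex_of_real (exp (- (u\<^sup>2 * (blocked_deviation n)\<^sup>2) / 2)))
        \<longlonglongrightarrow> complex_of_real (exp (- (u\<^sup>2 * (sqrt (long_run_variance M g))\<^sup>2) / 2))"
      by (intro tendsto_intros blocked_deviation_tendsto) simp
    then show "(\<lambda>n. complex_of_real (exp (- (u\<^sup>2 * (blocked_deviation n)\<^sup>2) / 2)))
        \<longlonglongrightarrow> complex_of_real (exp (- (u\<^sup>2 * long_run_variance M g) / 2))"
      by (simp add: long_run_variance_nonneg)
    show "(\<lambda>N. \<bar>u\<bar> * finite_blocking_error n N) \<longlonglongrightarrow> \<bar>u\<bar> * blocking_error n" for n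
      by (intro tendsto_intros finite_blocking_error_tendsto)
    show "(\<lambda>n. \<bar>u\<bar> * blocking_error n) \<longlonglongrightarrow> 0"
      by (rule tendsto_mult_right_zero[OF blocking_error_tendsto])
    show "\<forall>\<^sub>F N in sequentially. cmod (char (distr (iid M) borel (normalized_sum g N)) u
        - char (distr (iid M) borel (blocked_sum n N)) u) \<le> \<bar>u\<bar> * finite_blocking_error n N" for n
      using eventually_gt_at_top[of 0]
      by eventually_elim (intro order_trans[OF iid.char_diff_le_l2norm] mult_left_mono
          l2norm_normalized_minus_blocked_sum_le square_integrable_normalized_sum
              square_integrable_blocked_sum, auto)
  qed
qed

end

section \<open>Orthonormal bases\<close>

locale orthonormal_basis = prob_space M for M :: "'a measure" +
  fixes e :: "nat \<Rightarrow> 'a \<Rightarrow> real"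
  assumes basis_square_integrable: "square_integrable M (e j)"
    and basis_orthonormal: "(\<integral>x. e i x * e j x \<partial>M) = (if i = j then 1 else 0)"
    and Parseval: "square_integrable M f \<Longrightarrow> (\<lambda>j. (\<integral>x. f x * e j x \<partial>M)\<^sup>2) sums (l2norm M f)\<^sup>2"
begin

lemma measurable_basis[measurable]: "e j \<in> borel_measurable M"
  using basis_square_integrable by (rule borel_measurable_square_integrable)

lemma l2norm_basis: "l2norm M (e j) = 1"
  using basis_orthonormal[of j j] by (simp add: l2norm_def power2_eq_square)

lemma AE_eq_0_if_orthogonal:
  assumes f: "square_integrable M f" and orth: "\<And>j. (\<integral>x. f x * e j x \<partial>M) = 0"
  shows "AE x in M. f x = 0"
proof (rule l2norm_eq_0_imp_AE[OF f])
  have "(\<lambda>j. 0) sums (l2norm M f)\<^sup>2" using Parseval[OF f] orth by simp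
  from sums_unique2[OF this sums_zero] show "l2norm M f = 0" by simp
qed

lemma integral_mult_sum_basis:
  assumes f: "square_integrable M f"
  shows "(\<integral>x. f x * (\<Sum>j\<in>A. a j * e j x) \<partial>M) = (\<Sum>j\<in>A. a j * (\<integral>x. f x * e j x \<partial>M))"
proof -
  have "(\<integral>x. f x * (\<Sum>j\<in>A. a j * e j x) \<partial>M) = (\<integral>x. (\<Sum>j\<in>A. a j * (f x * e j x)) \<partial>M)"
    by (simp add: sum_distrib_left mult_ac)
  also have "\<dots> = (\<Sum>j\<in>A. a j * (\<integral>x. f x * e j x \<partial>M))"
    using integrable_mult[OF f basis_square_integrable] by simp
  finally show ?thesis .
qed

lemma coefficient_sum_basis:
  assumes "finite A"
  shows "(\<integral>x. (\<Sum>j\<in>A. a j * e j x) * e k x \<partial>M) = (if k \<in> A then a k else 0)"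
proof -
  have "(\<integral>x. (\<Sum>j\<in>A. a j * e j x) * e k x \<partial>M) = (\<Sum>j\<in>A. if j = k then a k else 0)"
    using integral_mult_sum_basis[OF basis_square_integrable[of k], where A = A and a = a]
    by (simp add: mult.commute basis_orthonormal if_distrib cong: if_cong)
  then show ?thesis using assms by simp
qed

lemma Parseval_l2norm_sections:
  assumes N: "sigma_finite_measure N" and X: "square_integrable (N \<Otimes>\<^sub>M M) (\<lambda>(\<omega>, t). X \<omega> t)"
  shows "(\<lambda>j. (l2norm N (\<lambda>\<omega>. \<integral>t. X \<omega> t * e j t \<partial>M))\<^sup>2) sums (l2norm (N \<Otimes>\<^sub>M M) (\<lambda>(\<omega>, t). X \<omega> t))\<^sup>2"
proof (rule sums_if_suminf_ennreal_eq)
  interpret pair_sigma_finite N M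
    using N sigma_finite_measure_axioms by (simp add: pair_sigma_finite_def)
  let ?c = "\<lambda>j \<omega>. \<integral>t. X \<omega> t * e j t \<partial>M"
  note c = square_integrable_inner(1)[OF X basis_square_integrable]
  note [measurable] = borel_measurable_square_integrable[OF c]
  have "(\<Sum>j. ennreal ((l2norm N (?c j))\<^sup>2)) = (\<Sum>j. \<integral>\<^sup>+\<omega>. ennreal ((?c j \<omega>)\<^sup>2) \<partial>N)"
    by (simp add: nn_integral_square[OF c])
  also have "\<dots> = (\<integral>\<^sup>+\<omega>. (\<Sum>j. ennreal ((?c j \<omega>)\<^sup>2)) \<partial>N)"
    by (rule nn_integral_suminf[symmetric]) measurable
  also have "\<dots> = (\<integral>\<^sup>+\<omega>. ennreal ((l2norm M (X \<omega>))\<^sup>2) \<partial>N)"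
  proof (rule nn_integral_cong_AE)
    show "AE \<omega> in N. (\<Sum>j. ennreal ((?c j \<omega>)\<^sup>2)) = ennreal ((l2norm M (X \<omega>))\<^sup>2)"
      using square_integrable_section(1)[OF X]
      by eventually_elim (rule suminf_ennreal_eq[OF zero_le_power2 Parseval])
  qed
  also have "\<dots> = ennreal ((l2norm (N \<Otimes>\<^sub>M M) (\<lambda>(\<omega>, t). X \<omega> t))\<^sup>2)"
    unfolding nn_integral_square[OF square_integrable_section(2)[OF X]] square_integrable_section(3)[OF X] ..
  finally show "(\<Sum>j. ennreal ((l2norm N (?c j))\<^sup>2)) = ennreal ((l2norm (N \<Otimes>\<^sub>M M) (\<lambda>(\<omega>, t). X \<omega> t))\<^sup>2)" .
qed simp_all

end

section \<open>The uniform distribution on the unit interval\<close>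

definition UI :: "real measure" where "UI = uniform_measure lborel {0..1}"

lemma sets_UI[measurable_cong, simp]: "sets UI = sets borel"
  by (simp add: UI_def)

lemma space_UI[simp]: "space UI = UNIV"
  by (simp add: UI_def)

interpretation UI: prob_space UI
  unfolding UI_def by (rule prob_space_uniform_measure) simp_all

lemma AE_UI_iff: "(AE t in UI. P t) \<longleftrightarrow> (AE t in lborel. t \<in> {0..1} \<longrightarrow> P t)"
  unfolding UI_def by (rule AE_uniform_measure) simp_all

lemma nn_integral_UI:
  "g \<in> borel_measurable borel \<Longrightarrow> (\<integral>\<^sup>+t. g t \<partial>UI) = (\<integral>\<^sup>+t. indicator {0..1} t * g t \<partial>lborel)"
  unfolding UI_def by (subst nn_integral_uniform_measure) (simp_all add: mult.commute divide_ennreal_def)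

lemma UI_eq_density: "UI = density lborel (indicator {0..1::real} :: real \<Rightarrow> real)"
  unfolding UI_def uniform_measure_def
  by (rule density_cong) (auto simp: divide_ennreal_def split: split_indicator)

lemma integral_UI:
  fixes g :: "real \<Rightarrow> real"
  shows "g \<in> borel_measurable borel \<Longrightarrow> (\<integral>t. g t \<partial>UI) = (LINT t:{0..1}|lborel. g t)"
  unfolding UI_eq_density set_lebesgue_integral_def by (subst integral_density) auto

lemma L2_iff_square_integrable_UI: "g \<in> L2 \<longleftrightarrow> square_integrable UI g"
proof (cases "g \<in> borel_measurable borel")
  case True
  then have "integrable UI (\<lambda>t. (g t)\<^sup>2) \<longleftrightarrow> set_integrable lborel {0..1} (\<lambda>t. (g t)\<^sup>2)"
    unfolding UI_eq_density set_integrable_def by (subst integrable_density) auto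
  with True show ?thesis
    by (simp add: L2_def square_integrable_def cong: measurable_cong_sets)
qed (simp add: L2_def square_integrable_def cong: measurable_cong_sets)

section \<open>The Haar basis\<close>

definition dyadic_cell :: "nat \<Rightarrow> nat \<Rightarrow> real set" where
  "dyadic_cell n k = {real k / 2 ^ n ..< real (Suc k) / 2 ^ n}"

definition dyadic_integral :: "nat \<Rightarrow> nat \<Rightarrow> (real \<Rightarrow> real) \<Rightarrow> real" where
  "dyadic_integral n k g = (\<integral>t. g t * indicator (dyadic_cell n k) t \<partial>UI)"

definition dyadic_energy :: "nat \<Rightarrow> (real \<Rightarrow> real) \<Rightarrow> real" where
  "dyadic_energy n g = (\<Sum>k<2 ^ n. 2 ^ n * (dyadic_integral n k g)\<^sup>2)"

definition dyadic_defect :: "nat \<Rightarrow> (real \<Rightarrow> real) \<Rightarrow> real" where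
  "dyadic_defect n g = (l2norm UI g)\<^sup>2 - dyadic_energy n g"

lemma dyadic_cell_borel[measurable]: "dyadic_cell n k \<in> sets borel"
  by (simp add: dyadic_cell_def)

lemma mem_dyadic_cell_iff: "t \<in> dyadic_cell n k \<longleftrightarrow> \<lfloor>t * 2 ^ n\<rfloor> = int k"
proof -
  have "t \<in> dyadic_cell n k \<longleftrightarrow> real k \<le> t * 2 ^ n \<and> t * 2 ^ n < real k + 1"
    by (auto simp: dyadic_cell_def field_simps)
  then show ?thesis by (auto simp: floor_eq_iff)
qed

lemma dyadic_cell_subset:
  assumes "k < 2 ^ n" shows "dyadic_cell n k \<subseteq> {0..1}"
proof -
  have "real (Suc k) \<le> real (2 ^ n)" using assms by (simp only: of_nat_le_iff Suc_le_eq)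
  then have "real (Suc k) / 2 ^ n \<le> 1" by (simp add: field_simps)
  moreover have "0 \<le> real k / 2 ^ n" by simp
  ultimately show ?thesis
    unfolding dyadic_cell_def by (intro subsetI) (simp only: atLeastLessThan_iff atLeastAtMost_iff, linarith)
qed

lemma square_integrable_times_indicator:
  assumes "square_integrable M g" "A \<in> sets M"
  shows "square_integrable M (\<lambda>t. g t * indicator A t)"
  using assms by (intro square_integrable_times_bounded(1)[of _ _ _ 1]) (auto split: split_indicator)

lemma square_integrable_indicator_UI: "A \<in> sets borel \<Longrightarrow> square_integrable UI (indicator A)"
  using square_integrable_times_indicator[OF UI.square_integrable_const[of 1], of A] by simp

lemma integral_dyadic_cell:
  assumes k: "k < 2 ^ n" shows "(\<integral>t. indicator (dyadic_cell n k) t \<partial>UI) = (1 / 2 ^ n :: real)"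
proof -
  have "(\<integral>t. indicator (dyadic_cell n k) t \<partial>UI :: real) = measure UI (dyadic_cell n k)"
    by simp
  also have "\<dots> = measure lborel ({0..1} \<inter> dyadic_cell n k)"
    unfolding UI_def by (subst measure_uniform_measure) auto
  also have "\<dots> = 1 / 2 ^ n"
    using dyadic_cell_subset[OF k] by (simp add: Int_absorb1 dyadic_cell_def field_simps)
  finally show ?thesis .
qed

lemma sum_dyadic_cells:
  assumes t: "0 \<le> t" "t < 1"
  shows "(\<Sum>k<2 ^ n. indicator (dyadic_cell n k) t) = (1::real)"
proof -
  define k0 where "k0 = nat \<lfloor>t * 2 ^ n\<rfloor>"
  have k0: "t \<in> dyadic_cell n k \<longleftrightarrow> k = k0" for k
    unfolding mem_dyadic_cell_iff k0_def using t by auto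
  have "t * 2 ^ n < 1 * 2 ^ n" using t by (intro mult_strict_right_mono) auto
  then have "k0 < 2 ^ n" unfolding k0_def using t by (simp add: nat_less_iff floor_less_iff)
  then show ?thesis by (simp add: indicator_def k0 of_bool_def)
qed

lemma integrable_dyadic: "square_integrable UI g \<Longrightarrow> integrable UI (\<lambda>t. g t * indicator (dyadic_cell n k) t)"
  by (rule integrable_mult[OF _ square_integrable_indicator_UI]) auto

lemma sum_dyadic_integral:
  assumes g: "integrable UI g"
  shows "(\<Sum>k<2 ^ n. dyadic_integral n k g) = (\<integral>t. g t \<partial>UI)"
proof -
  note [measurable] = borel_measurable_integrable[OF g]
  have "integrable UI (\<lambda>t. g t * indicator (dyadic_cell n k) t)" for k
    by (rule Bochner_Integration.integrable_bound[OF g]) (auto split: split_indicator)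
  then have "(\<Sum>k<2 ^ n. dyadic_integral n k g) = (\<integral>t. (\<Sum>k<2 ^ n. g t * indicator (dyadic_cell n k) t) \<partial>UI)"
    unfolding dyadic_integral_def by (intro Bochner_Integration.integral_sum[symmetric])
  also have "\<dots> = (\<integral>t. g t \<partial>UI)"
  proof (rule integral_cong_AE)
    have "AE t in UI. 0 \<le> t \<and> t < 1"
      unfolding AE_UI_iff using AE_lborel_singleton[of "1::real"] by eventually_elim auto
    then show "AE t in UI. (\<Sum>k<2 ^ n. g t * indicator (dyadic_cell n k) t) = g t"
      by eventually_elim (simp add: sum_distrib_left[symmetric] sum_dyadic_cells)
  qed measurable
  finally show ?thesis .
qed

lemma dyadic_integral_linear:
  assumes "square_integrable UI g" "square_integrable UI h"
  shows "dyadic_integral n k (\<lambda>t. g t + h t) = dyadic_integral n k g + dyadic_integral n k h"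
    and "dyadic_integral n k (\<lambda>t. g t - h t) = dyadic_integral n k g - dyadic_integral n k h"
  using integrable_dyadic[OF assms(1)] integrable_dyadic[OF assms(2)]
  unfolding dyadic_integral_def by (simp_all add: distrib_right left_diff_distrib)

lemma dyadic_integral_cmult: "dyadic_integral n k (\<lambda>t. c * g t) = c * dyadic_integral n k g"
  unfolding dyadic_integral_def by (simp add: mult.assoc)

lemma dyadic_integral_square_le:
  assumes g: "square_integrable UI g" and k: "k < 2 ^ n"
  shows "2 ^ n * (dyadic_integral n k g)\<^sup>2 \<le> dyadic_integral n k (\<lambda>t. (g t)\<^sup>2)"
proof -
  let ?I = "indicator (dyadic_cell n k) :: real \<Rightarrow> real"
  have cell: "square_integrable UI ?I" by (rule square_integrable_indicator_UI) simp
  have gI: "square_integrable UI (\<lambda>t. g t * ?I t)" by (rule square_integrable_times_indicator[OF g]) simp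
  have "dyadic_integral n k g = (\<integral>t. (g t * ?I t) * ?I t \<partial>UI)"
    unfolding dyadic_integral_def by (intro Bochner_Integration.integral_cong) (auto split: split_indicator)
  then have "\<bar>dyadic_integral n k g\<bar> \<le> l2norm UI (\<lambda>t. g t * ?I t) * l2norm UI ?I"
    using Cauchy_Schwarz_integral(2)[OF gI cell] by simp
  then have "\<bar>dyadic_integral n k g\<bar>\<^sup>2 \<le> (l2norm UI (\<lambda>t. g t * ?I t) * l2norm UI ?I)\<^sup>2"
    by (rule power_mono) simp
  also have "\<dots> = (\<integral>t. (g t * ?I t)\<^sup>2 \<partial>UI) * (\<integral>t. (?I t)\<^sup>2 \<partial>UI)"
    by (simp add: power_mult_distrib l2norm_square)
  also have "(\<integral>t. (?I t)\<^sup>2 \<partial>UI) = (\<integral>t. ?I t \<partial>UI)"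
    by (intro Bochner_Integration.integral_cong) (auto split: split_indicator)
  also have "\<dots> = 1 / 2 ^ n" by (rule integral_dyadic_cell[OF k])
  also have "(\<integral>t. (g t * ?I t)\<^sup>2 \<partial>UI) = dyadic_integral n k (\<lambda>t. (g t)\<^sup>2)"
    unfolding dyadic_integral_def by (intro Bochner_Integration.integral_cong) (auto split: split_indicator)
  finally show ?thesis by (simp add: field_simps)
qed

lemma dyadic_defect_nonneg:
  assumes g: "square_integrable UI g"
  shows "0 \<le> dyadic_defect n g"
proof -
  have "dyadic_energy n g \<le> (\<Sum>k<2 ^ n. dyadic_integral n k (\<lambda>t. (g t)\<^sup>2))"
    unfolding dyadic_energy_def by (intro sum_mono dyadic_integral_square_le g) simp
  also have "\<dots> = (l2norm UI g)\<^sup>2"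
    unfolding l2norm_square by (rule sum_dyadic_integral[OF integrable_square[OF g]])
  finally show ?thesis by (simp add: dyadic_defect_def)
qed

lemma dyadic_defect_le: "dyadic_defect n g \<le> (l2norm UI g)\<^sup>2"
  by (simp add: dyadic_defect_def dyadic_energy_def sum_nonneg)

lemma dyadic_defect_cmult: "dyadic_defect n (\<lambda>t. c * g t) = c\<^sup>2 * dyadic_defect n g"
  by (simp add: dyadic_defect_def dyadic_energy_def dyadic_integral_cmult l2norm_cmult
      power_mult_distrib right_diff_distrib sum_distrib_left mult_ac)

lemma dyadic_defect_add_le:
  assumes g: "square_integrable UI g" and h: "square_integrable UI h"
  shows "dyadic_defect n (\<lambda>t. g t + h t) \<le> 2 * dyadic_defect n g + 2 * dyadic_defect n h"
proof -
  have "dyadic_energy n (\<lambda>t. g t + h t) + dyadic_energy n (\<lambda>t. g t - h t)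
      = 2 * dyadic_energy n g + 2 * dyadic_energy n h"
    unfolding dyadic_energy_def dyadic_integral_linear[OF g h] sum_distrib_left sum.distrib[symmetric]
    by (intro sum.cong) (auto simp: power2_eq_square algebra_simps)
  then have "dyadic_defect n (\<lambda>t. g t + h t) + dyadic_defect n (\<lambda>t. g t - h t)
      = 2 * dyadic_defect n g + 2 * dyadic_defect n h"
    using l2norm_parallelogram[OF g h] unfolding dyadic_defect_def by argo
  then show ?thesis
    using dyadic_defect_nonneg[OF square_integrable_diff[OF g h], of n] by linarith
qed

text \<open>The defect is dominated by the squared norm and obeys the parallelogram law, so the functions
  recovered by their dyadic averages form a closed subspace.\<close>
definition dyadically_approximable :: "(real \<Rightarrow> real) \<Rightarrow> bool" where
  "dyadically_approximable g \<longleftrightarrow> square_integrable UI g \<and> (\<lambda>n. dyadic_defect n g) \<longlonglongrightarrow> 0"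

lemma square_integrable_dyadically_approximable: "dyadically_approximable g \<Longrightarrow> square_integrable UI g"
  by (simp add: dyadically_approximable_def)

lemma dyadically_approximableI:
  assumes g: "square_integrable UI g" and defect_le: "\<And>n. dyadic_defect n g \<le> b n" and b: "b \<longlonglongrightarrow> 0"
  shows "dyadically_approximable g"
  unfolding dyadically_approximable_def
  by (intro conjI g tendsto_sandwich[OF _ _ tendsto_const b])
    (use dyadic_defect_nonneg[OF g] defect_le in auto)

lemma dyadically_approximable_add:
  "dyadically_approximable g \<Longrightarrow> dyadically_approximable h \<Longrightarrow> dyadically_approximable (\<lambda>t. g t + h t)"
  unfolding dyadically_approximable_def[of g] dyadically_approximable_def[of h]
  by (auto intro!: dyadically_approximableI[OF square_integrable_add dyadic_defect_add_le] tendsto_eq_intros)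

lemma dyadically_approximable_cmult: "dyadically_approximable g \<Longrightarrow> dyadically_approximable (\<lambda>t. c * g t)"
  by (auto simp: dyadically_approximable_def dyadic_defect_cmult intro!: square_integrable_cmult
      tendsto_mult_right_zero)

lemma dyadically_approximable_zero: "dyadically_approximable (\<lambda>t. 0)"
  by (rule dyadically_approximableI[where b = "\<lambda>_. 0"]) (use dyadic_defect_le[of _ "\<lambda>t. 0"] in auto)

lemma dyadically_approximable_sum:
  "(\<And>i. i \<in> A \<Longrightarrow> dyadically_approximable (f i)) \<Longrightarrow> dyadically_approximable (\<lambda>t. \<Sum>i\<in>A. f i t)"
  by (induct A rule: infinite_finite_induct)
    (auto intro: dyadically_approximable_add dyadically_approximable_zero)

lemma dyadically_approximable_limit:
  assumes g: "square_integrable UI g" and G: "\<And>m. dyadically_approximable (G m)"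
    and lim: "(\<lambda>m. l2norm UI (\<lambda>t. g t - G m t)) \<longlonglongrightarrow> 0"
  shows "dyadically_approximable g"
  unfolding dyadically_approximable_def
proof
  show "(\<lambda>n. dyadic_defect n g) \<longlonglongrightarrow> 0"
  proof (rule tendsto_uniform_approximation[where y = "\<lambda>m n. 0" and z = "\<lambda>m. 0"
        and err = "\<lambda>m n. 2 * dyadic_defect n (G m) + 2 * (l2norm UI (\<lambda>t. g t - G m t))\<^sup>2"])
    note G_sq = square_integrable_dyadically_approximable[OF G]
    have "dyadic_defect n g \<le> 2 * dyadic_defect n (G m) + 2 * (l2norm UI (\<lambda>t. g t - G m t))\<^sup>2" for n m
      using dyadic_defect_add_le[OF G_sq[of m] square_integrable_diff[OF g G_sq[of m]], of n]
        dyadic_defect_le[of n "\<lambda>t. g t - G m t"] by simp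
    then show "\<forall>\<^sub>F n in sequentially. norm (dyadic_defect n g - 0)
        \<le> 2 * dyadic_defect n (G m) + 2 * (l2norm UI (\<lambda>t. g t - G m t))\<^sup>2" for m
      using dyadic_defect_nonneg[OF g] by simp
    show "(\<lambda>n. 2 * dyadic_defect n (G m) + 2 * (l2norm UI (\<lambda>t. g t - G m t))\<^sup>2)
        \<longlonglongrightarrow> 2 * (l2norm UI (\<lambda>t. g t - G m t))\<^sup>2" for m
      using G[of m] by (auto simp: dyadically_approximable_def intro!: tendsto_eq_intros)
    show "(\<lambda>m. 2 * (l2norm UI (\<lambda>t. g t - G m t))\<^sup>2) \<longlonglongrightarrow> 0"
      using lim by (auto intro!: tendsto_eq_intros)
  qed simp_all
qed (rule g)

lemma dyadic_integral_atMost: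
  assumes k: "k < 2 ^ n" and other: "k \<noteq> nat \<lfloor>a * 2 ^ n\<rfloor>"
  shows "dyadic_integral n k (indicator {..a}) \<in> {0, 1 / 2 ^ n}"
proof -
  have "\<lfloor>a * 2 ^ n\<rfloor> < int k \<or> int k < \<lfloor>a * 2 ^ n\<rfloor>" using other by linarith
  then consider (left) "a * 2 ^ n < real k" | (right) "real k + 1 \<le> a * 2 ^ n"
    by (metis floor_less_iff of_int_of_nat_eq less_floor_iff)
  then show ?thesis
  proof cases
    case left
    have "a < t" if "t \<in> dyadic_cell n k" for t
    proof -
      have "real k \<le> t * 2 ^ n" using that by (simp add: dyadic_cell_def field_simps)
      then have "a * 2 ^ n < t * 2 ^ n" using left by linarith
      then show ?thesis by simp
    qed
    then have "dyadic_integral n k (indicator {..a}) = (\<integral>t. 0 \<partial>UI)"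
      unfolding dyadic_integral_def
      by (intro Bochner_Integration.integral_cong refl) (force simp: indicator_def)
    then show ?thesis by simp
  next
    case right
    have "t \<le> a" if "t \<in> dyadic_cell n k" for t
    proof -
      have "t * 2 ^ n < real k + 1" using that by (simp add: dyadic_cell_def field_simps)
      then have "t * 2 ^ n \<le> a * 2 ^ n" using right by linarith
      then show ?thesis by simp
    qed
    then have "dyadic_integral n k (indicator {..a}) = (\<integral>t. indicator (dyadic_cell n k) t \<partial>UI)"
      unfolding dyadic_integral_def
      by (intro Bochner_Integration.integral_cong refl) (force simp: indicator_def)
    then show ?thesis using integral_dyadic_cell[OF k] by simp
  qed
qed

text \<open>Only the cell containing \<open>a\<close> contributes to the defect of the indicator of \<open>{..a}\<close>.\<close>
lemma dyadic_defect_atMost_le: "dyadic_defect n (indicator {..a}) \<le> 1 / 2 ^ n"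
proof -
  let ?I = "indicator {..a} :: real \<Rightarrow> real"
  define c where "c k = dyadic_integral n k ?I" for k
  have I: "square_integrable UI ?I" by (rule square_integrable_indicator_UI) simp
  have cell_integral_le: "c k \<le> 1 / 2 ^ n" if "k < 2 ^ n" for k
  proof -
    have "c k \<le> (\<integral>t. indicator (dyadic_cell n k) t \<partial>UI)"
      unfolding c_def dyadic_integral_def
      by (intro integral_mono integrable_dyadic I UI.integrable_if_square_integrable
          square_integrable_indicator_UI)
         (auto split: split_indicator)
    then show ?thesis using integral_dyadic_cell[OF that] by simp
  qed
  have "(l2norm UI ?I)\<^sup>2 = (\<integral>t. ?I t \<partial>UI)"
    unfolding l2norm_square by (intro Bochner_Integration.integral_cong) (auto split: split_indicator)
  also have "\<dots> = (\<Sum>k<2 ^ n. c k)"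
    unfolding c_def by (rule sum_dyadic_integral[symmetric]) (rule UI.integrable_if_square_integrable[OF I])
  finally have "dyadic_defect n ?I = (\<Sum>k<2 ^ n. c k - 2 ^ n * (c k)\<^sup>2)"
    unfolding dyadic_defect_def dyadic_energy_def c_def by (simp add: sum_subtractf)
  also have "\<dots> \<le> (\<Sum>k<2 ^ n. if k = nat \<lfloor>a * 2 ^ n\<rfloor> then 1 / 2 ^ n else 0)"
  proof (rule sum_mono)
    fix k :: nat assume "k \<in> {..<2 ^ n}"
    then have k: "k < 2 ^ n" by simp
    show "c k - 2 ^ n * (c k)\<^sup>2 \<le> (if k = nat \<lfloor>a * 2 ^ n\<rfloor> then 1 / 2 ^ n else 0)"
    proof (cases "k = nat \<lfloor>a * 2 ^ n\<rfloor>")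
      case True
      then show ?thesis using cell_integral_le[OF k] by (auto intro: order_trans[of _ "c k"])
    next
      case False
      from dyadic_integral_atMost[OF k this] show ?thesis
        using False by (auto simp: c_def power2_eq_square)
    qed
  qed
  also have "\<dots> \<le> 1 / 2 ^ n" by simp
  finally show ?thesis .
qed

lemma dyadically_approximable_atMost: "dyadically_approximable (indicator {..a})"
  using LIMSEQ_divide_realpow_zero[of 2 1]
  by (intro dyadically_approximableI[OF square_integrable_indicator_UI dyadic_defect_atMost_le]) auto

lemma dyadically_approximable_one: "dyadically_approximable (\<lambda>t. 1)"
proof -
  have "dyadic_integral n k (\<lambda>t. 1) = 1 / 2 ^ n" if "k < 2 ^ n" for n k
    using integral_dyadic_cell[OF that] by (simp add: dyadic_integral_def)
  then have "dyadic_energy n (\<lambda>t. 1) = 1" for n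
    by (simp add: dyadic_energy_def power2_eq_square)
  then have "dyadic_defect n (\<lambda>t. 1) = 0" for n
    by (simp add: dyadic_defect_def l2norm_square UI.prob_space[unfolded space_UI])
  then show ?thesis by (simp add: dyadically_approximable_def UI.square_integrable_const)
qed

lemma dyadically_approximable_disjoint_UN:
  fixes A :: "nat \<Rightarrow> real set"
  assumes disj: "disjoint_family A" and [measurable]: "\<And>i. A i \<in> sets borel"
    and approx: "\<And>i. dyadically_approximable (indicator (A i))"
  shows "dyadically_approximable (indicator (\<Union>i. A i))"
proof (rule dyadically_approximable_limit)
  show "square_integrable UI (indicator (\<Union>i. A i))" by (rule square_integrable_indicator_UI) measurable
  show "dyadically_approximable (\<lambda>t. \<Sum>i<m. indicator (A i) t)" for m
    by (intro dyadically_approximable_sum approx)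
  have finite_UN: "(\<Sum>i<m. indicator (A i) t) = (indicator (\<Union>i<m. A i) t :: real)" for m t
    by (rule indicator_UN_disjoint[symmetric]) (use disj in \<open>auto simp: disjoint_family_on_def\<close>)
  show "(\<lambda>m. l2norm UI (\<lambda>t. indicator (\<Union>i. A i) t - (\<Sum>i<m. indicator (A i) t))) \<longlonglongrightarrow> 0"
  proof (rule l2norm_diff_tendsto_0_dominated[OF _ _ UI.square_integrable_const[of 1]])
    show "(\<lambda>m. \<Sum>i<m. indicator (A i) t) \<longlonglongrightarrow> (indicator (\<Union>i. A i) t :: real)" for t
      unfolding finite_UN by (rule LIMSEQ_indicator_UN)
    show "\<bar>indicator (\<Union>i. A i) t - (\<Sum>i<m. indicator (A i) t)\<bar> \<le> (1::real)" for m t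
      unfolding finite_UN by (auto split: split_indicator)
  qed measurable
qed

lemma dyadically_approximable_indicator:
  assumes "A \<in> sets borel" shows "dyadically_approximable (indicator A)"
proof -
  have "Int_stable (range (\<lambda>a::real. {..a}))"
    by (auto simp: Int_stable_def)
  moreover have "range (\<lambda>a::real. {..a}) \<subseteq> Pow UNIV" by simp
  moreover have "A \<in> sigma_sets UNIV (range (\<lambda>a::real. {..a}))"
    using assms unfolding borel_eq_atMost by simp
  ultimately show ?thesis
  proof (induct rule: sigma_sets_induct_disjoint[consumes 3, case_names basic empty compl union])
    case (basic A)
    then show ?case using dyadically_approximable_atMost by auto
  next
    case empty
    then show ?case using dyadically_approximable_zero by simp
  next
    case (compl A)
    have "(indicator (UNIV - A) :: real \<Rightarrow> real) = (\<lambda>t. 1 + (-1) * indicator A t)"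
      by (auto simp: indicator_def fun_eq_iff)
    then show ?case
      using dyadically_approximable_add[OF dyadically_approximable_one
          dyadically_approximable_cmult[OF compl(2), of "-1"]]
      by simp
  next
    case (union A)
    then show ?case
      by (intro dyadically_approximable_disjoint_UN) (auto simp: borel_eq_atMost)
  qed
qed

lemma dyadically_approximable_iff_square_integrable: "dyadically_approximable g \<longleftrightarrow> square_integrable UI g"
proof
  assume g: "square_integrable UI g"
  note [measurable] = borel_measurable_square_integrable[OF g]
  obtain F where "\<forall>i. simple_function UI (F i)" "\<forall>t\<in>space UI. (\<lambda>i. F i t) \<longlonglongrightarrow> g t"
    "\<forall>i. \<forall>t\<in>space UI. dist (F i t) 0 \<le> 2 * dist (g t) 0"
    using borel_measurable_implies_sequence_metric[OF borel_measurable_square_integrable[OF g], of 0]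
    by (elim exE conjE) (rule that)
  then have F: "\<And>i. simple_function UI (F i)" "\<And>t. (\<lambda>i. F i t) \<longlonglongrightarrow> g t"
    "\<And>i t. dist (F i t) 0 \<le> 2 * dist (g t) 0"
    by simp_all
  note [measurable] = borel_measurable_simple_function[OF F(1)]
  show "dyadically_approximable g"
  proof (rule dyadically_approximable_limit[OF g])
    fix i
    have "dyadically_approximable (\<lambda>t. \<Sum>y\<in>F i ` UNIV. y * indicator (F i -` {y}) t)"
      using simple_functionD(2)[OF F(1)]
      by (intro dyadically_approximable_sum dyadically_approximable_cmult
          dyadically_approximable_indicator) simp
    moreover have "(\<Sum>y\<in>F i ` UNIV. y * indicator (F i -` {y}) t) = F i t" for t
      using simple_function_indicator_representation_banach[OF F(1), of t i, symmetric]
      by (simp add: mult.commute)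
    ultimately show "dyadically_approximable (F i)" by simp
  next
    show "(\<lambda>i. l2norm UI (\<lambda>t. g t - F i t)) \<longlonglongrightarrow> 0"
    proof (rule l2norm_diff_tendsto_0_dominated[OF _ _ square_integrable_cmult[OF
        square_integrable_abs[OF g], of 3] F(2)])
      show "\<bar>g t - F i t\<bar> \<le> 3 * \<bar>g t\<bar>" for i t using F(3)[of i t] by (simp add: dist_real_def)
    qed measurable
  qed
qed (rule square_integrable_dyadically_approximable)

lemma dyadic_cell_split:
  "indicator (dyadic_cell n k) t =
    (indicator (dyadic_cell (Suc n) (2 * k)) t + indicator (dyadic_cell (Suc n) (Suc (2 * k))) t :: real)"
  by (auto simp: dyadic_cell_def field_simps indicator_def)

lemma dyadic_cells_disjoint:
  "indicator (dyadic_cell (Suc n) (2 * k)) t * indicator (dyadic_cell (Suc n) (Suc (2 * k))) t = (0::real)"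
  by (auto simp: dyadic_cell_def field_simps indicator_def)

lemma dyadic_integral_split:
  assumes "square_integrable UI g"
  shows "dyadic_integral n k g = dyadic_integral (Suc n) (2 * k) g + dyadic_integral (Suc n) (Suc (2 * k)) g"
  using integrable_dyadic[OF assms, of "Suc n"]
  unfolding dyadic_integral_def dyadic_cell_split[of n k] by (simp add: distrib_left)

definition haar_level :: "nat \<Rightarrow> nat" where "haar_level j = (LEAST n. j < 2 ^ Suc n)"

definition haar :: "nat \<Rightarrow> real \<Rightarrow> real" where
  "haar j t = (if j = 0 then 1 else
     (let n = haar_level j; k = j - 2 ^ n in
       sqrt (2 ^ n) * (indicator (dyadic_cell (Suc n) (2 * k)) t - indicator (dyadic_cell (Suc n) (Suc (2
           * k))) t)))"

lemma haar_level_eq: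
  assumes "k < 2 ^ n" shows "haar_level (2 ^ n + k) = n"
  unfolding haar_level_def
proof (rule Least_equality)
  show "2 ^ n + k < 2 ^ Suc n" using assms by simp
  fix m assume "2 ^ n + k < (2::nat) ^ Suc m"
  then have "(2::nat) ^ n < 2 ^ Suc m" by linarith
  then have "n < Suc m" by (rule power_less_imp_less_exp[rotated]) simp
  then show "n \<le> m" by simp
qed

lemma haar_eq:
  assumes "k < 2 ^ n"
  shows "haar (2 ^ n + k) t =
    sqrt (2 ^ n) * (indicator (dyadic_cell (Suc n) (2 * k)) t - indicator (dyadic_cell (Suc n) (Suc (2 *
        k))) t)"
  unfolding haar_def Let_def haar_level_eq[OF assms] by simp

lemma haar_indexE:
  fixes j :: nat
  assumes "0 < j" obtains n k where "j = 2 ^ n + k" "k < 2 ^ n"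
proof -
  have "\<exists>n. j < (2::nat) ^ Suc n"
    using less_exp[of j] by (intro exI[of _ j]) (unfold power_Suc, linarith)
  then have less: "j < 2 ^ Suc (haar_level j)" unfolding haar_level_def by (rule LeastI_ex)
  have "2 ^ haar_level j \<le> j"
  proof (cases "haar_level j")
    case 0 then show ?thesis using assms by simp
  next
    case (Suc m)
    then have "\<not> j < 2 ^ Suc m" unfolding haar_level_def by (intro not_less_Least) simp
    then show ?thesis using Suc by simp
  qed
  then show ?thesis using that[of "haar_level j" "j - 2 ^ haar_level j"] less by simp
qed

lemma measurable_haar[measurable]: "haar j \<in> borel_measurable borel"
  unfolding haar_def[abs_def] Let_def by (cases "j = 0") simp_all

lemma haar_bounded: obtains C where "\<And>t. \<bar>haar j t\<bar> \<le> C"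
proof (cases "j = 0")
  case True then show ?thesis by (intro that[of 1]) (simp add: haar_def)
next
  case False
  then obtain n k where j: "j = 2 ^ n + k" "k < 2 ^ n" using haar_indexE by (metis gr0I)
  show ?thesis
    by (intro that[of "sqrt (2 ^ n)"]) (auto simp: j haar_eq indicator_def)
qed

lemma square_integrable_haar: "square_integrable UI (haar j)"
proof -
  obtain C where "\<And>t. \<bar>haar j t\<bar> \<le> C" by (rule haar_bounded[of j]) blast
  then show ?thesis by (rule UI.square_integrable_if_bounded[rotated]) measurable
qed

lemma haar_coefficient:
  assumes g: "square_integrable UI g" and k: "k < 2 ^ n"
  shows "(\<integral>t. g t * haar (2 ^ n + k) t \<partial>UI) =
    sqrt (2 ^ n) * (dyadic_integral (Suc n) (2 * k) g - dyadic_integral (Suc n) (Suc (2 * k)) g)"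
proof -
  let ?I = "\<lambda>k t. g t * indicator (dyadic_cell (Suc n) k) t"
  have "(\<integral>t. g t * haar (2 ^ n + k) t \<partial>UI) = (\<integral>t. sqrt (2 ^ n) * (?I (2 * k) t - ?I (Suc (2 * k)) t) \<partial>UI)"
    unfolding haar_eq[OF k] by (simp add: algebra_simps)
  then show ?thesis
    unfolding dyadic_integral_def using integrable_dyadic[OF g] by simp
qed

lemma sum_haar_coefficients:
  assumes g: "square_integrable UI g"
  shows "(\<Sum>j<2 ^ n. (\<integral>t. g t * haar j t \<partial>UI)\<^sup>2) = dyadic_energy n g"
proof (induct n)
  case 0
  have "dyadic_integral 0 0 g = (\<integral>t. g t \<partial>UI)"
    using sum_dyadic_integral[OF UI.integrable_if_square_integrable[OF g], of 0] by simp
  then show ?case by (simp add: dyadic_energy_def haar_def)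
next
  case (Suc n)
  let ?c = "\<lambda>j. (\<integral>t. g t * haar j t \<partial>UI)\<^sup>2"
  let ?left = "\<lambda>k. dyadic_integral (Suc n) (2 * k) g" and ?right
      = "\<lambda>k. dyadic_integral (Suc n) (Suc (2 * k)) g"
  have "(\<Sum>j<2 ^ Suc n. ?c j) = (\<Sum>j<2 ^ n. ?c j) + (\<Sum>j=2 ^ n..<2 ^ Suc n. ?c j)"
    using sum.atLeastLessThan_concat[of 0 "2 ^ n" "2 ^ Suc n" ?c] by (simp add: atLeast0LessThan)
  also have "(\<Sum>j=2 ^ n..<2 ^ Suc n. ?c j) = (\<Sum>k<2 ^ n. ?c (2 ^ n + k))"
    by (rule sum.reindex_bij_witness[of _ "\<lambda>k. 2 ^ n + k" "\<lambda>j. j - 2 ^ n"]) auto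
  also have "\<dots> = (\<Sum>k<2 ^ n. 2 ^ n * (?left k - ?right k)\<^sup>2)"
    by (intro sum.cong refl) (simp add: haar_coefficient[OF g] power_mult_distrib)
  also have "(\<Sum>j<2 ^ n. ?c j) = (\<Sum>k<2 ^ n. 2 ^ n * (?left k + ?right k)\<^sup>2)"
    unfolding Suc dyadic_energy_def dyadic_integral_split[OF g, symmetric] ..
  also have "(\<Sum>k<2 ^ n. 2 ^ n * (?left k + ?right k)\<^sup>2) + (\<Sum>k<2 ^ n. 2 ^ n * (?left k - ?right k)\<^sup>2)
      = (\<Sum>k<2 ^ n. 2 ^ Suc n * (?left k)\<^sup>2 + 2 ^ Suc n * (?right k)\<^sup>2)"
    unfolding sum.distrib[symmetric] by (intro sum.cong refl) (simp add: power2_eq_square algebra_simps)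
  also have "\<dots> = dyadic_energy (Suc n) g"
  proof -
    have "(\<Sum>k<2 * m. f k) = (\<Sum>k<m. f (2 * k) + f (Suc (2 * k)))" for m and f :: "nat \<Rightarrow> real"
      by (induct m) simp_all
    then show ?thesis unfolding dyadic_energy_def power_Suc[of 2 n] by (rule sym)
  qed
  finally show ?case .
qed

theorem haar_Parseval:
  assumes g: "square_integrable UI g"
  shows "(\<lambda>j. (\<integral>t. g t * haar j t \<partial>UI)\<^sup>2) sums (l2norm UI g)\<^sup>2"
proof -
  let ?c = "\<lambda>j. (\<integral>t. g t * haar j t \<partial>UI)\<^sup>2"
  have partial_le: "(\<Sum>j<N. ?c j) \<le> (l2norm UI g)\<^sup>2" for N
  proof -
    have "(\<Sum>j<N. ?c j) \<le> (\<Sum>j<2 ^ N. ?c j)"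
      by (intro sum_mono2) (auto intro: less_trans[OF _ less_exp])
    also have "\<dots> \<le> (l2norm UI g)\<^sup>2"
      unfolding sum_haar_coefficients[OF g] using dyadic_defect_nonneg[OF g, of N]
      by (simp add: dyadic_defect_def)
    finally show ?thesis .
  qed
  have coefficients_summable: "summable ?c" by (rule summableI_nonneg_bounded[OF _ partial_le]) simp
  have "(\<lambda>n. (\<Sum>j<2 ^ n. ?c j)) \<longlonglongrightarrow> suminf ?c"
    by (rule LIMSEQ_subseq_LIMSEQ[OF summable_LIMSEQ[OF coefficients_summable], unfolded comp_def])
       (simp add: strict_mono_def)
  moreover have "(\<lambda>n. (\<Sum>j<2 ^ n. ?c j)) \<longlonglongrightarrow> (l2norm UI g)\<^sup>2"
  proof -
    have "(\<lambda>n. (l2norm UI g)\<^sup>2 - dyadic_defect n g) \<longlonglongrightarrow> (l2norm UI g)\<^sup>2 - 0"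
      using g[folded dyadically_approximable_iff_square_integrable]
      by (intro tendsto_intros) (simp add: dyadically_approximable_def)
    then show ?thesis unfolding sum_haar_coefficients[OF g] by (simp add: dyadic_defect_def)
  qed
  ultimately have "suminf ?c = (l2norm UI g)\<^sup>2" by (rule LIMSEQ_unique)
  then show ?thesis using coefficients_summable by (simp add: sums_iff)
qed

lemma haar_norm: "(\<integral>t. haar j t * haar j t \<partial>UI) = 1"
proof (cases "j = 0")
  case True then show ?thesis by (simp add: haar_def UI.prob_space[unfolded space_UI])
next
  case False
  then obtain n k where j: "j = 2 ^ n + k" "k < 2 ^ n" using haar_indexE by (metis gr0I)
  have "haar j t * haar j t = 2 ^ n * indicator (dyadic_cell n k) t" for t
    unfolding j(1) haar_eq[OF j(2)] dyadic_cell_split[of n k]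
    using dyadic_cells_disjoint[of n k t] by (auto simp: algebra_simps indicator_def)
  then show ?thesis using integral_dyadic_cell[OF j(2)] by simp
qed

text \<open>Parseval's identity for \<open>haar i\<close> has its whole mass already in the \<open>i\<close>-th term.\<close>
lemma haar_orthogonal:
  assumes "i \<noteq> j" shows "(\<integral>t. haar i t * haar j t \<partial>UI) = 0"
proof -
  let ?c = "\<lambda>j. (\<integral>t. haar i t * haar j t \<partial>UI)\<^sup>2"
  have total: "?c sums 1"
  proof -
    have "(l2norm UI (haar i))\<^sup>2 = 1"
      using haar_norm[of i] unfolding l2norm_square by (simp only: power2_eq_square)
    then show ?thesis using haar_Parseval[OF square_integrable_haar[of i]] by simp
  qed
  have "sum ?c {i, j} \<le> suminf ?c"
    using sums_summable[OF total] by (intro sum_le_suminf) auto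
  then have "?c i + ?c j \<le> 1" using assms sums_unique[OF total] by simp
  then show ?thesis by (simp add: haar_norm)
qed

interpretation haar: orthonormal_basis UI haar
  by unfold_locales (simp_all add: square_integrable_haar haar_norm haar_orthogonal haar_Parseval)

section \<open>Square-integrable kernels\<close>

abbreviation square_integrable_kernel :: "'a measure \<Rightarrow> ('a \<Rightarrow> 'a \<Rightarrow> real) \<Rightarrow> bool" where
  "square_integrable_kernel U K \<equiv> square_integrable (U \<Otimes>\<^sub>M U) (\<lambda>(t, s). K t s)"

definition kernel_form :: "'a measure \<Rightarrow> ('a \<Rightarrow> 'a \<Rightarrow> real) \<Rightarrow> ('a \<Rightarrow> real) \<Rightarrow> ('a \<Rightarrow> real) \<Rightarrow> real" where
  "kernel_form U K g h = (\<integral>(t, s). K t s * (g t * h s) \<partial>(U \<Otimes>\<^sub>M U))"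

definition cross_moment :: "'b measure \<Rightarrow> ('b \<Rightarrow> 'a \<Rightarrow> real) \<Rightarrow> ('b \<Rightarrow> 'a \<Rightarrow> real) \<Rightarrow> 'a \<Rightarrow> 'a \<Rightarrow> real" where
  "cross_moment N A B t s = (\<integral>\<omega>. A \<omega> t * B \<omega> s \<partial>N)"

lemma kernel_form_cmult: "kernel_form U (\<lambda>t s. c * K t s) g h = c * kernel_form U K g h"
proof -
  have "kernel_form U (\<lambda>t s. c * K t s) g h = (\<integral>p. c * (case p of (t, s) \<Rightarrow> K t s * (g t * h s)) \<partial>(U \<Otimes>\<^sub>M U))"
    unfolding kernel_form_def by (intro Bochner_Integration.integral_cong) auto
  then show ?thesis by (simp add: kernel_form_def)
qed

context sigma_finite_measure
begin

interpretation self: pair_sigma_finite M M ..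

lemma integrable_kernel_form:
  assumes "square_integrable_kernel M K" "square_integrable M g" "square_integrable M h"
  shows "integrable (M \<Otimes>\<^sub>M M) (\<lambda>(t, s). K t s * (g t * h s))"
  using integrable_mult[OF assms(1) self.square_integrable_tensor(1)[OF assms(2,3)]]
  by (simp add: split_beta')

lemma kernel_form_iterated:
  assumes "square_integrable_kernel M K" "square_integrable M g" "square_integrable M h"
  shows "kernel_form M K g h = (\<integral>t. (\<integral>s. K t s * h s \<partial>M) * g t \<partial>M)"
proof -
  have "kernel_form M K g h = (\<integral>t. (\<integral>s. K t s * (g t * h s) \<partial>M) \<partial>M)"
    unfolding kernel_form_def using self.integral_fst[OF integrable_kernel_form[OF assms]] by simp
  also have "\<dots> = (\<integral>t. (\<integral>s. K t s * h s \<partial>M) * g t \<partial>M)"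
    by (intro Bochner_Integration.integral_cong refl)
       (subst integral_mult_left_zero[symmetric], simp add: mult_ac)
  finally show ?thesis .
qed

lemma kernel_form_add:
  assumes K: "square_integrable_kernel M K" and L: "square_integrable_kernel M L"
    and g: "square_integrable M g" and h: "square_integrable M h"
  shows "kernel_form M (\<lambda>t s. K t s + L t s) g h = kernel_form M K g h + kernel_form M L g h"
  using integrable_kernel_form[OF K g h] integrable_kernel_form[OF L g h]
  by (simp add: kernel_form_def split_beta' distrib_right)

lemma kernel_form_swap:
  assumes "square_integrable_kernel M K" "square_integrable M g" "square_integrable M h"
  shows "kernel_form M (\<lambda>t s. K s t) g h = kernel_form M K h g"
  using self.integral_product_swap[of "\<lambda>(t, s). K t s * (h t * g s)"] integrable_kernel_form[OF assms(1,3,2)]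
  by (auto simp: kernel_form_def split_beta' mult_ac dest: borel_measurable_integrable)

lemma kernel_form_sum_sum:
  assumes K: "square_integrable_kernel M K" and h: "\<And>j. j \<in> A \<Longrightarrow> square_integrable M (h j)"
  shows "kernel_form M K (\<lambda>t. \<Sum>j\<in>A. a j * h j t) (\<lambda>t. \<Sum>j\<in>A. a j * h j t)
    = (\<Sum>j\<in>A. \<Sum>k\<in>A. a j * a k * kernel_form M K (h j) (h k))"
proof -
  have "K t s * ((\<Sum>j\<in>A. a j * h j t) * (\<Sum>j\<in>A. a j * h j s))
      = (\<Sum>j\<in>A. \<Sum>k\<in>A. (a j * a k) * (K t s * (h j t * h k s)))" for t s
    by (simp add: sum_product sum_distrib_left mult_ac)
  then have "kernel_form M K (\<lambda>t. \<Sum>j\<in>A. a j * h j t) (\<lambda>t. \<Sum>j\<in>A. a j * h j t)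
      = (\<integral>p. (\<Sum>j\<in>A. \<Sum>k\<in>A. (a j * a k) * (case p of (t, s) \<Rightarrow> K t s * (h j t * h k s))) \<partial>(M \<Otimes>\<^sub>M M))"
    unfolding kernel_form_def by (simp add: split_beta')
  also have "\<dots> = (\<Sum>j\<in>A. \<Sum>k\<in>A. a j * a k * kernel_form M K (h j) (h k))"
    unfolding kernel_form_def using integrable_kernel_form[OF K h h] by simp
  finally show ?thesis .
qed

lemma kernel_form_cong_AE:
  assumes [measurable]: "(\<lambda>(t, s). K t s) \<in> borel_measurable (M \<Otimes>\<^sub>M M)"
      "(\<lambda>(t, s). L t s) \<in> borel_measurable (M \<Otimes>\<^sub>M M)"
    and [measurable]: "g \<in> borel_measurable M" "h \<in> borel_measurable M"
    and eq: "AE t in M. AE s in M. K t s = L t s"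
  shows "kernel_form M K g h = kernel_form M L g h"
  unfolding kernel_form_def
proof (rule integral_cong_AE)
  have "AE p in M \<Otimes>\<^sub>M M. (case p of (t, s) \<Rightarrow> K t s) = (case p of (t, s) \<Rightarrow> L t s)"
    by (rule self.AE_pair_measure) (use eq in simp_all)
  then show "AE p in M \<Otimes>\<^sub>M M. (case p of (t, s) \<Rightarrow> K t s * (g t * h s))
      = (case p of (t, s) \<Rightarrow> L t s * (g t * h s))"
    by eventually_elim auto
qed measurable

lemma square_integrable_kernel_bound:
  assumes [measurable]: "(\<lambda>(t, s). K t s) \<in> borel_measurable (M \<Otimes>\<^sub>M M)"
    and u: "square_integrable M u" and v: "square_integrable M v"
    and dominated: "AE t in M. AE s in M. \<bar>K t s\<bar> \<le> u t * v s"
  shows "square_integrable_kernel M K" "l2norm (M \<Otimes>\<^sub>M M) (\<lambda>(t, s). K t s) \<le> l2norm M u * l2norm M v"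
proof -
  note [measurable] = borel_measurable_square_integrable[OF u] borel_measurable_square_integrable[OF v]
  have "AE p in M \<Otimes>\<^sub>M M. \<bar>case p of (t, s) \<Rightarrow> K t s\<bar> \<le> (case p of (t, s) \<Rightarrow> u t * v s)"
    by (rule self.AE_pair_measure) (use dominated in simp_all)
  then have "AE p in M \<Otimes>\<^sub>M M. \<bar>case p of (t, s) \<Rightarrow> K t s\<bar> \<le> \<bar>case p of (t, s) \<Rightarrow> u t * v s\<bar>"
    by eventually_elim linarith
  from square_integrable_bound[OF self.square_integrable_tensor(1)[OF u v] _ this]
  show "square_integrable_kernel M K" "l2norm (M \<Otimes>\<^sub>M M) (\<lambda>(t, s). K t s) \<le> l2norm M u * l2norm M v"
    by (simp_all add: self.square_integrable_tensor(2)[OF u v])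
qed

lemma integral_abs_kernel_mult_le:
  assumes K: "square_integrable_kernel M K" and g: "square_integrable M g" and h: "square_integrable M h"
  shows "(\<integral>(t, s). \<bar>K t s * (g t * h s)\<bar> \<partial>(M \<Otimes>\<^sub>M M))
      \<le> l2norm (M \<Otimes>\<^sub>M M) (\<lambda>(t, s). K t s) * (l2norm M g * l2norm M h)"
  using Cauchy_Schwarz_integral(2)[OF square_integrable_abs[OF K]
      square_integrable_abs[OF self.square_integrable_tensor(1)[OF g h]]]
  unfolding l2norm_abs self.square_integrable_tensor(2)[OF g h]
  by (simp add: split_beta' abs_mult)

lemma kernel_form_suminf:
  assumes K: "\<And>k. square_integrable_kernel M (K k)"
    and norm_summable: "summable (\<lambda>k. l2norm (M \<Otimes>\<^sub>M M) (\<lambda>(t, s). K k t s))"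
    and g: "square_integrable M g" and h: "square_integrable M h"
  shows "kernel_form M (\<lambda>t s. \<Sum>k. K k t s) g h = (\<Sum>k. kernel_form M (K k) g h)"
proof -
  let ?f = "\<lambda>k (t, s). K k t s * (g t * h s)"
  note [measurable] = borel_measurable_square_integrable[OF K]
    borel_measurable_square_integrable[OF g] borel_measurable_square_integrable[OF h]
  have abs_summable: "AE p in M \<Otimes>\<^sub>M M. summable (\<lambda>k. \<bar>case p of (t, s) \<Rightarrow> K k t s\<bar>)"
    by (rule infinite_Minkowski(1)[OF K norm_summable])
  have "(\<Sum>k. kernel_form M (K k) g h) = (\<integral>p. (\<Sum>k. ?f k p) \<partial>(M \<Otimes>\<^sub>M M))"
    unfolding kernel_form_def
  proof (rule integral_suminf[symmetric])
    show "integrable (M \<Otimes>\<^sub>M M) (?f k)" for k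
      by (rule integrable_kernel_form[OF K g h])
    show "AE p in M \<Otimes>\<^sub>M M. summable (\<lambda>k. norm (?f k p))"
      using abs_summable by eventually_elim (simp add: split_beta' abs_mult summable_mult2)
    show "summable (\<lambda>k. \<integral>p. norm (?f k p) \<partial>(M \<Otimes>\<^sub>M M))"
      by (rule summable_comparison_test'[OF summable_mult2[OF norm_summable, of "l2norm M g * l2norm M h"]])
         (use integral_abs_kernel_mult_le[OF K g h] in \<open>simp add: split_beta'\<close>)
  qed
  also have "\<dots> = kernel_form M (\<lambda>t s. \<Sum>k. K k t s) g h"
    unfolding kernel_form_def
  proof (rule integral_cong_AE)
    show "AE p in M \<Otimes>\<^sub>M M. (\<Sum>k. ?f k p) = (case p of (t, s) \<Rightarrow> (\<Sum>k. K k t s) * (g t * h s))"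
      using abs_summable
    proof eventually_elim
      case (elim p)
      then show ?case by (cases p) (simp add: suminf_mult2[OF summable_rabs_cancel])
    qed
  qed measurable
  finally show ?thesis ..
qed

end

context pair_sigma_finite
begin

lemma measurable_cross_moment[measurable]:
  assumes [measurable]: "(\<lambda>(x, t). A x t) \<in> borel_measurable (M1 \<Otimes>\<^sub>M M2)"
    "(\<lambda>(x, t). B x t) \<in> borel_measurable (M1 \<Otimes>\<^sub>M M2)"
  shows "(\<lambda>(t, s). cross_moment M1 A B t s) \<in> borel_measurable (M2 \<Otimes>\<^sub>M M2)"
  unfolding cross_moment_def by measurable

lemma square_integrable_cross_moment:
  assumes A: "square_integrable (M1 \<Otimes>\<^sub>M M2) (\<lambda>(x, t). A x t)"
    and B: "square_integrable (M1 \<Otimes>\<^sub>M M2) (\<lambda>(x, t). B x t)"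
  shows "square_integrable_kernel M2 (cross_moment M1 A B)"
proof (rule M2.square_integrable_kernel_bound(1))
  show "square_integrable M2 (\<lambda>t. l2norm M1 (\<lambda>x. A x t))" "square_integrable M2 (\<lambda>s. l2norm M1 (\<lambda>x. B x s))"
    by (rule square_integrable_section_snd(2)[OF A] square_integrable_section_snd(2)[OF B])+
  show "AE t in M2. AE s in M2. \<bar>cross_moment M1 A B t s\<bar> \<le> l2norm M1 (\<lambda>x. A x t) * l2norm M1 (\<lambda>x. B x s)"
    using square_integrable_section_snd(1)[OF A]
  proof eventually_elim
    case (elim t)
    show ?case
      using square_integrable_section_snd(1)[OF B]
      by eventually_elim (simp add: cross_moment_def Cauchy_Schwarz_integral(2)[OF elim])
  qed
qed (use A B in measurable)

lemma integral_inner_mult_inner: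
  assumes A: "square_integrable (M1 \<Otimes>\<^sub>M M2) (\<lambda>(x, t). A x t)"
    and B: "square_integrable (M1 \<Otimes>\<^sub>M M2) (\<lambda>(x, t). B x t)"
    and g: "square_integrable M2 g" and h: "square_integrable M2 h"
  shows "(\<integral>x. (\<integral>t. A x t * g t \<partial>M2) * (\<integral>s. B x s * h s \<partial>M2) \<partial>M1) = kernel_form M2 (cross_moment M1 A B) g h"
proof -
  note [measurable] = borel_measurable_square_integrable[OF A] borel_measurable_square_integrable[OF B]
    borel_measurable_square_integrable[OF g] borel_measurable_square_integrable[OF h]
  let ?Bh = "\<lambda>x. \<integral>s. B x s * h s \<partial>M2"
  have "(\<integral>x. (\<integral>t. A x t * g t \<partial>M2) * ?Bh x \<partial>M1) = (\<integral>x. ?Bh x * (\<integral>t. A x t * g t \<partial>M2) \<partial>M1)"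
    by (simp add: mult.commute)
  also have "\<dots> = (\<integral>t. (\<integral>x. ?Bh x * A x t \<partial>M1) * g t \<partial>M2)"
    by (rule integral_inner_swap[OF A square_integrable_inner(1)[OF B h] g])
  also have "\<dots> = (\<integral>t. (\<integral>s. cross_moment M1 A B t s * h s \<partial>M2) * g t \<partial>M2)"
  proof (rule integral_cong_AE)
    show "AE t in M2. (\<integral>x. ?Bh x * A x t \<partial>M1) * g t = (\<integral>s. cross_moment M1 A B t s * h s \<partial>M2) * g t"
      using square_integrable_section_snd(1)[OF A]
    proof eventually_elim
      case (elim t)
      have "(\<integral>x. ?Bh x * A x t \<partial>M1) = (\<integral>x. A x t * ?Bh x \<partial>M1)"
        by (simp add: mult.commute)
      also have "\<dots> = (\<integral>s. cross_moment M1 A B t s * h s \<partial>M2)"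
        unfolding cross_moment_def by (rule integral_inner_swap[OF B elim h])
      finally show ?case by simp
    qed
  qed measurable
  also have "\<dots> = kernel_form M2 (cross_moment M1 A B) g h"
    by (rule M2.kernel_form_iterated[OF square_integrable_cross_moment[OF A B] g h, symmetric])
  finally show ?thesis .
qed

end

context orthonormal_basis
begin

lemma AE_kernel_eq_0_if_coefficients_eq_0:
  assumes K: "square_integrable_kernel M K" and zero: "\<And>j k. kernel_form M K (e j) (e k) = 0"
  shows "AE t in M. AE s in M. K t s = 0"
proof -
  interpret self: pair_sigma_finite M M ..
  have "AE t in M. (\<integral>s. K t s * e k s \<partial>M) = 0" for k
  proof (rule AE_eq_0_if_orthogonal)
    show "square_integrable M (\<lambda>t. \<integral>s. K t s * e k s \<partial>M)"
      by (rule self.square_integrable_inner(1)[OF K basis_square_integrable])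
    show "(\<integral>t. (\<integral>s. K t s * e k s \<partial>M) * e j t \<partial>M) = 0" for j
      using zero[of j k] kernel_form_iterated[OF K basis_square_integrable basis_square_integrable] by simp
  qed
  then have "AE t in M. \<forall>k. (\<integral>s. K t s * e k s \<partial>M) = 0" by (simp add: AE_all_countable)
  with self.square_integrable_section(1)[OF K] show ?thesis
    by eventually_elim (simp add: AE_eq_0_if_orthogonal)
qed

lemma AE_kernel_eq_if_coefficients_eq:
  assumes K: "square_integrable_kernel M K" and L: "square_integrable_kernel M L"
    and eq: "\<And>j k. kernel_form M K (e j) (e k) = kernel_form M L (e j) (e k)"
  shows "AE t in M. AE s in M. K t s = L t s"
proof -
  have minus_L: "square_integrable_kernel M (\<lambda>t s. (-1) * L t s)"
    using square_integrable_cmult[OF L, of "-1"] by (simp add: split_beta')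
  have "square_integrable_kernel M (\<lambda>t s. K t s + (-1) * L t s)"
    using square_integrable_add[OF K minus_L] by (simp add: split_beta')
  moreover have "kernel_form M (\<lambda>t s. K t s + (-1) * L t s) (e j) (e k) = 0" for j k
    using kernel_form_add[OF K minus_L basis_square_integrable basis_square_integrable, of j k] eq[of j k]
    unfolding kernel_form_cmult by simp
  ultimately have "AE t in M. AE s in M. K t s + (-1) * L t s = 0"
    by (rule AE_kernel_eq_0_if_coefficients_eq_0)
  then show ?thesis by simp
qed

end

section \<open>Gaussian sequences\<close>

definition gauss_seq :: "(nat \<Rightarrow> real) measure" where
  "gauss_seq = iid std_normal_distribution"

lemma sets_gauss_seq[measurable_cong]: "sets gauss_seq = sets (iid borel)"
  unfolding gauss_seq_def by (intro sets_PiM_cong) simp_all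

interpretation std_normal: prob_space std_normal_distribution
  by (rule prob_space_normal_density) simp

interpretation gauss: prob_space gauss_seq
  unfolding gauss_seq_def by (rule std_normal.prob_space_iid)

lemma integral_gauss_component:
  fixes f :: "real \<Rightarrow> 'b :: {banach, second_countable_topology}"
  assumes [measurable]: "f \<in> borel_measurable borel"
  shows "(\<integral>\<xi>. f (\<xi> j) \<partial>gauss_seq) = (\<integral>x. f x \<partial>std_normal_distribution)"
  using integral_distr[of "\<lambda>\<xi>. \<xi> j" gauss_seq std_normal_distribution f] std_normal.distr_iid_component[of j]
  by (simp add: gauss_seq_def)

lemma square_integrable_gauss_component: "square_integrable gauss_seq (\<lambda>\<xi>. \<xi> i)"
proof -
  have "square_integrable std_normal_distribution (\<lambda>x. x)"
    using integrable_std_normal_distribution_moment[of 2] by (simp add: square_integrable_def)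
  then show ?thesis
    using square_integrable_distr(1)[of "\<lambda>\<xi>. \<xi> i" gauss_seq std_normal_distribution "\<lambda>x. x"]
      std_normal.distr_iid_component[of i] by (simp add: gauss_seq_def)
qed

lemma integral_gauss_component_eq_0: "(\<integral>\<xi>. \<xi> i \<partial>gauss_seq) = 0"
  using integral_gauss_component[of "\<lambda>x. x" i] integral_std_normal_distribution_moment_odd[of 1] by simp

lemma integral_gauss_component_mult: "(\<integral>\<xi>. \<xi> i * \<xi> j \<partial>gauss_seq) = (if i = j then 1 else 0)"
proof (cases "i = j")
  case True
  have "(\<integral>\<xi>. \<xi> j * \<xi> j \<partial>gauss_seq) = (\<integral>x. x * x \<partial>std_normal_distribution)"
    by (rule integral_gauss_component[of "\<lambda>x. x * x"]) simp
  also have "\<dots> = 1" using std_normal_distribution_even_moments[of 1] by (simp add: power2_eq_square)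
  finally show ?thesis using True by simp
next
  case False
  have "(\<integral>\<xi>. \<xi> i * \<xi> j \<partial>gauss_seq) = (\<integral>\<xi>. \<xi> i \<partial>gauss_seq) * (\<integral>\<xi>. \<xi> j \<partial>gauss_seq)"
    unfolding gauss_seq_def
    by (rule std_normal.integral_mult_disjoint[where K = "{i}" and J = "{j}"])
       (use square_integrable_gauss_component False in \<open>auto simp: depends_on_def gauss_seq_def\<close>)
  then show ?thesis using False by (simp add: integral_gauss_component_eq_0)
qed

lemma integral_gauss_sum_mult:
  "(\<integral>\<xi>. (\<Sum>i<n. a i * \<xi> i) * (\<Sum>i<n. b i * \<xi> i) \<partial>gauss_seq) = (\<Sum>i<n. a i * b i)"
proof -
  have "(\<integral>\<xi>. (\<Sum>i<n. a i * \<xi> i) * (\<Sum>i<n. b i * \<xi> i) \<partial>gauss_seq)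
      = (\<integral>\<xi>. (\<Sum>i<n. \<Sum>l<n. (a i * b l) * (\<xi> i * \<xi> l)) \<partial>gauss_seq)"
    by (simp add: sum_product mult_ac)
  also have "\<dots> = (\<Sum>i<n. \<Sum>l<n. (a i * b l) * (\<integral>\<xi>. \<xi> i * \<xi> l \<partial>gauss_seq))"
    using integrable_mult[OF square_integrable_gauss_component square_integrable_gauss_component] by simp
  also have "\<dots> = (\<Sum>i<n. \<Sum>l<n. if l = i then a i * b i else 0)"
    by (intro sum.cong refl) (simp add: integral_gauss_component_mult)
  also have "\<dots> = (\<Sum>i<n. a i * b i)" by simp
  finally show ?thesis .
qed

lemma char_gauss_sum:
  "char (distr gauss_seq borel (\<lambda>\<xi>. \<Sum>j<n. c j * \<xi> j)) u = complex_of_real (exp (- (u\<^sup>2 * (\<Sum>j<n. (c j)\<^sup>2)) / 2))"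
proof -
  have "gauss.indep_vars (\<lambda>_. std_normal_distribution) (\<lambda>i x. x i) UNIV"
    unfolding gauss_seq_def by (rule std_normal.indep_vars_iid_coordinates)
  then have "gauss.indep_vars (\<lambda>_. borel) (\<lambda>j \<xi>. c j * \<xi> j) UNIV"
    by (rule gauss.indep_vars_compose2[where Y = "\<lambda>j x. c j * x"]) simp
  then have "gauss.indep_vars (\<lambda>_. borel) (\<lambda>j \<xi>. c j * \<xi> j) {..<n}"
    by (rule gauss.indep_vars_subset) simp
  then have "char (distr gauss_seq borel (\<lambda>\<xi>. \<Sum>j<n. c j * \<xi> j)) u
      = (\<Prod>j<n. char (distr gauss_seq borel (\<lambda>\<xi>. c j * \<xi> j)) u)"
    by (rule gauss.char_distr_sum)
  also have "\<dots> = (\<Prod>j<n. complex_of_real (exp (- ((u * c j)\<^sup>2) / 2)))"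
  proof (rule prod.cong[OF refl])
    fix j
    have "char (distr gauss_seq borel (\<lambda>\<xi>. c j * \<xi> j)) u = (CLINT \<xi>|gauss_seq. iexp (u * c j * \<xi> j))"
      by (simp add: char_def integral_distr mult_ac)
    also have "\<dots> = char std_normal_distribution (u * c j)"
      unfolding char_def by (rule integral_gauss_component[of "\<lambda>x. iexp (u * c j * x)"]) simp
    finally show "char (distr gauss_seq borel (\<lambda>\<xi>. c j * \<xi> j)) u = complex_of_real (exp (- ((u * c j)\<^sup>2) / 2))"
      by (simp add: char_std_normal_distribution)
  qed
  also have "\<dots> = complex_of_real (exp (\<Sum>j<n. - ((u * c j)\<^sup>2) / 2))"
    by (simp add: exp_sum)
  also have "(\<Sum>j<n. - ((u * c j)\<^sup>2) / 2) = - (u\<^sup>2 * (\<Sum>j<n. (c j)\<^sup>2)) / 2"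
    by (simp add: power_mult_distrib sum_distrib_left sum_divide_distrib[symmetric] sum_negf)
  finally show ?thesis .
qed

text \<open>Randomising the frequency with a standard Gaussian vector turns Laplace transforms of
  \<open>\<Sum>j<n. (V j)\<^sup>2\<close> into averages of one-dimensional characteristic functions.\<close>
lemma (in prob_space) laplace_eq_integral_char:
  fixes V :: "nat \<Rightarrow> 'a \<Rightarrow> real"
  assumes [measurable]: "\<And>j. V j \<in> borel_measurable M" and l: "0 \<le> l"
  shows "expectation (\<lambda>x. exp (- (l * (\<Sum>j<n. (V j x)\<^sup>2))))
    = (\<integral>\<xi>. Re (char (distr M borel (\<lambda>x. \<Sum>j<n. \<xi> j * V j x)) (sqrt (2 * l))) \<partial>gauss_seq)"
proof -
  interpret pair: pair_prob_space M gauss_seq ..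
  let ?u = "sqrt (2 * l)"
  have "exp (- (l * (\<Sum>j<n. (V j x)\<^sup>2))) = (\<integral>\<xi>. cos (?u * (\<Sum>j<n. \<xi> j * V j x)) \<partial>gauss_seq)" for x
  proof -
    have "(\<integral>\<xi>. cos (?u * (\<Sum>j<n. V j x * \<xi> j)) \<partial>gauss_seq)
        = Re (char (distr gauss_seq borel (\<lambda>\<xi>. \<Sum>j<n. V j x * \<xi> j)) ?u)"
      by (rule gauss.Re_char_distr[symmetric]) measurable
    also have "\<dots> = exp (- (l * (\<Sum>j<n. (V j x)\<^sup>2)))"
      unfolding char_gauss_sum using l by simp
    finally show ?thesis by (simp add: mult.commute)
  qed
  then have "expectation (\<lambda>x. exp (- (l * (\<Sum>j<n. (V j x)\<^sup>2))))
      = (\<integral>x. \<integral>\<xi>. cos (?u * (\<Sum>j<n. \<xi> j * V j x)) \<partial>gauss_seq \<partial>M)" by simp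
  also have "\<dots> = (\<integral>\<xi>. \<integral>x. cos (?u * (\<Sum>j<n. \<xi> j * V j x)) \<partial>M \<partial>gauss_seq)"
  proof (rule pair.Fubini_integral[symmetric])
    show "integrable (M \<Otimes>\<^sub>M gauss_seq) (\<lambda>(x, \<xi>). cos (?u * (\<Sum>j<n. \<xi> j * V j x)))"
      by (rule pair.integrable_const_bound[of _ 1]) auto
  qed
  also have "\<dots> = (\<integral>\<xi>. Re (char (distr M borel (\<lambda>x. \<Sum>j<n. \<xi> j * V j x)) ?u) \<partial>gauss_seq)"
    by (intro Bochner_Integration.integral_cong refl Re_char_distr[symmetric]) measurable
  finally show ?thesis .
qed

lemma (in prob_space) measurable_Re_char_gauss_sum[measurable]:
  fixes V :: "nat \<Rightarrow> 'a \<Rightarrow> real"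
  assumes [measurable]: "\<And>j. V j \<in> borel_measurable M"
  shows "(\<lambda>\<xi>. Re (char (distr M borel (\<lambda>x. \<Sum>j<n. \<xi> j * V j x)) u)) \<in> borel_measurable gauss_seq"
  unfolding Re_char_distr[OF borel_measurable_sum[OF borel_measurable_times[OF borel_measurable_const assms]]]
  by measurable

lemma laplace_tendsto_if_char_tendsto:
  fixes V :: "nat \<Rightarrow> nat \<Rightarrow> 'a \<Rightarrow> real" and W :: "nat \<Rightarrow> 'b \<Rightarrow> real"
  assumes M: "prob_space M" and N: "prob_space N"
    and V[measurable]: "\<And>k j. V k j \<in> borel_measurable M" and W[measurable]: "\<And>j. W j \<in> borel_measurable N"
    and l: "0 \<le> l"
    and char: "\<And>\<xi> u. (\<lambda>k. char (distr M borel (\<lambda>x. \<Sum>j<n. \<xi> j * V k j x)) u)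
         \<longlonglongrightarrow> char (distr N borel (\<lambda>x. \<Sum>j<n. \<xi> j * W j x)) u"
  shows "(\<lambda>k. \<integral>x. exp (- (l * (\<Sum>j<n. (V k j x)\<^sup>2))) \<partial>M) \<longlonglongrightarrow> (\<integral>x. exp (- (l * (\<Sum>j<n. (W j x)\<^sup>2))) \<partial>N)"
  unfolding prob_space.laplace_eq_integral_char[OF M V l] prob_space.laplace_eq_integral_char[OF N W l]
proof (rule integral_dominated_convergence[where w = "\<lambda>_. 1"])
  interpret M: prob_space M by fact
  interpret N: prob_space N by fact
  show "(\<lambda>\<xi>. Re (char (distr N borel (\<lambda>x. \<Sum>j<n. \<xi> j * W j x)) (sqrt (2 * l)))) \<in> borel_measurable gauss_seq"
    by (rule N.measurable_Re_char_gauss_sum[OF W])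
  show "(\<lambda>\<xi>. Re (char (distr M borel (\<lambda>x. \<Sum>j<n. \<xi> j * V k j x)) (sqrt (2 * l)))) \<in> borel_measurable
      gauss_seq" for k
    by (rule M.measurable_Re_char_gauss_sum[OF V])
  show "AE \<xi> in gauss_seq. (\<lambda>k. Re (char (distr M borel (\<lambda>x. \<Sum>j<n. \<xi> j * V k j x)) (sqrt (2 * l))))
     \<longlonglongrightarrow> Re (char (distr N borel (\<lambda>x. \<Sum>j<n. \<xi> j * W j x)) (sqrt (2 * l)))"
    by (intro AE_I2 tendsto_Re char)
  show "AE \<xi> in gauss_seq. norm (Re (char (distr M borel (\<lambda>x. \<Sum>j<n. \<xi> j * V k j x)) (sqrt (2 * l))))
      \<le> 1" for k
  proof (rule AE_I2)
    fix \<xi> :: "nat \<Rightarrow> real"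
    interpret D: real_distribution "distr M borel (\<lambda>x. \<Sum>j<n. \<xi> j * V k j x)"
      by (rule M.real_distribution_distr) simp
    show "norm (Re (char (distr M borel (\<lambda>x. \<Sum>j<n. \<xi> j * V k j x)) (sqrt (2 * l)))) \<le> 1"
      unfolding real_norm_def by (rule order_trans[OF abs_Re_le_cmod D.cmod_char_le_1])
  qed
qed simp

definition gauss_linear :: "((nat \<Rightarrow> real) \<Rightarrow> real) \<Rightarrow> bool" where
  "gauss_linear X \<longleftrightarrow> (\<exists>n a. X = (\<lambda>\<xi>. \<Sum>i<n. a i * \<xi> i))"

lemma gauss_linear_sum_components: "gauss_linear (\<lambda>\<xi>. \<Sum>i<n. a i * \<xi> i)"
  unfolding gauss_linear_def by blast

lemma gauss_linear_zero: "gauss_linear (\<lambda>\<xi>. 0)"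
  using gauss_linear_sum_components[where n = 0] by simp

lemma gauss_linear_cmult:
  assumes "gauss_linear X" shows "gauss_linear (\<lambda>\<xi>. c * X \<xi>)"
proof -
  obtain n a where "X = (\<lambda>\<xi>. \<Sum>i<n. a i * \<xi> i)" using assms unfolding gauss_linear_def by blast
  then have "(\<lambda>\<xi>. c * X \<xi>) = (\<lambda>\<xi>. \<Sum>i<n. (c * a i) * \<xi> i)" by (simp add: sum_distrib_left mult.assoc)
  then show ?thesis by (simp only: gauss_linear_sum_components)
qed

lemma gauss_linear_add:
  assumes "gauss_linear X" "gauss_linear Y" shows "gauss_linear (\<lambda>\<xi>. X \<xi> + Y \<xi>)"
proof -
  obtain n a where X: "X = (\<lambda>\<xi>. \<Sum>i<n. a i * \<xi> i)" using assms unfolding gauss_linear_def by blast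
  obtain m b where Y: "Y = (\<lambda>\<xi>. \<Sum>i<m. b i * \<xi> i)" using assms unfolding gauss_linear_def by blast
  have extend: "(\<Sum>i<k. c i * \<xi> i) = (\<Sum>i<max n m. (if i < k then c i else 0) * \<xi> i)" if "k \<le> max n m"
    for k and c \<xi> :: "nat \<Rightarrow> real"
    using that by (intro sum.mono_neutral_cong_left) auto
  have "X \<xi> + Y \<xi> = (\<Sum>i<max n m. ((if i < n then a i else 0) + (if i < m then b i else 0)) * \<xi> i)" for \<xi>
    unfolding X Y extend[of n a \<xi>, OF max.cobounded1] extend[of m b \<xi>, OF max.cobounded2]
    by (simp add: sum.distrib distrib_right)
  then show ?thesis by (simp only: gauss_linear_sum_components)
qed

lemma gauss_linear_sum: "(\<And>i. i \<in> A \<Longrightarrow> gauss_linear (X i)) \<Longrightarrow> gauss_linear (\<lambda>\<xi>. \<Sum>i\<in>A. X i \<xi>)"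
  by (induct A rule: infinite_finite_induct) (auto intro: gauss_linear_add gauss_linear_zero)

lemma centred_gaussian_gauss_linear:
  assumes "gauss_linear X" shows "centred_gaussian gauss_seq X"
  unfolding centred_gaussian_def
proof (intro conjI allI)
  obtain n a where X: "X = (\<lambda>\<xi>. \<Sum>i<n. a i * \<xi> i)" using assms unfolding gauss_linear_def by blast
  show "square_integrable gauss_seq X"
    unfolding X by (intro square_integrable_sum square_integrable_cmult square_integrable_gauss_component)
  show "(\<integral>\<xi>. X \<xi> \<partial>gauss_seq) = 0"
    unfolding X using gauss.integrable_if_square_integrable[OF square_integrable_gauss_component]
    by (simp add: integral_gauss_component_eq_0)
  have "(l2norm gauss_seq X)\<^sup>2 = (\<Sum>i<n. (a i)\<^sup>2)"
    unfolding l2norm_square X by (simp only: power2_eq_square integral_gauss_sum_mult)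
  then show "char (distr gauss_seq borel X) u
      = complex_of_real (exp (- (u\<^sup>2 * (l2norm gauss_seq X)\<^sup>2) / 2))" for u
    unfolding X char_gauss_sum by simp
qed

section \<open>The Cholesky decomposition of an infinite matrix\<close>

definition quadratic_form :: "'i set \<Rightarrow> ('i \<Rightarrow> 'i \<Rightarrow> real) \<Rightarrow> ('i \<Rightarrow> real) \<Rightarrow> real" where
  "quadratic_form A C a = (\<Sum>j\<in>A. \<Sum>k\<in>A. a j * a k * C j k)"

definition positive_semidefinite :: "('i \<Rightarrow> 'i \<Rightarrow> real) \<Rightarrow> bool" where
  "positive_semidefinite C \<longleftrightarrow> (\<forall>j k. C j k = C k j) \<and> (\<forall>A a. finite A \<longrightarrow> 0 \<le> quadratic_form A C a)"

lemma positive_semidefinite_sym: "positive_semidefinite C \<Longrightarrow> C j k = C k j"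
  and quadratic_form_nonneg: "positive_semidefinite C \<Longrightarrow> finite A \<Longrightarrow> 0 \<le> quadratic_form A C a"
  unfolding positive_semidefinite_def by blast+

lemma positive_semidefinite_diag_nonneg: "positive_semidefinite C \<Longrightarrow> 0 \<le> C n n"
  using quadratic_form_nonneg[of C "{n}" "\<lambda>_. 1"] by (simp add: quadratic_form_def)

lemma positive_semidefinite_diag_eq_0:
  assumes C: "positive_semidefinite C" and diag: "C n n = 0" shows "C j n = 0"
proof (cases "j = n")
  case False
  have nonneg: "0 \<le> C j j + 2 * y * C j n" for y
    using quadratic_form_nonneg[OF C, of "{j, n}" "\<lambda>i. if i = j then 1 else y"]
      False diag positive_semidefinite_sym[OF C, of n j] by (simp add: quadratic_form_def)
  show ?thesis
  proof (rule ccontr)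
    assume "C j n \<noteq> 0"
    with nonneg[of "- (C j j + 1) / (2 * C j n)"] show False by (simp add: field_simps)
  qed
qed (use diag in simp)

lemma quadratic_form_mono_neutral:
  assumes "finite B" "A \<subseteq> B"
  shows "quadratic_form A C a = quadratic_form B C (\<lambda>j. if j \<in> A then a j else 0)"
proof -
  have "(\<Sum>k\<in>A. a j * a k * C j k) = (\<Sum>k\<in>B. a j * (if k \<in> A then a k else 0) * C j k)" for j
    using assms by (intro sum.mono_neutral_cong_left) auto
  then show ?thesis
    unfolding quadratic_form_def using assms by (intro sum.mono_neutral_cong_left) auto
qed

lemma quadratic_form_minus_rank_one:
  "quadratic_form A (\<lambda>j k. C j k - v j * v k / c) b = quadratic_form A C b - (\<Sum>j\<in>A. b j * v j)\<^sup>2 / c"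
  unfolding quadratic_form_def power2_eq_square sum_product sum_divide_distrib sum_subtractf[symmetric]
  by (intro sum.cong refl) (simp add: algebra_simps)

lemma quadratic_form_minus_unit:
  assumes B: "finite B" "n \<in> B" and sym: "\<And>j. C n j = C j n"
  shows "quadratic_form B C (\<lambda>j. b j - r * (if j = n then 1 else 0))
    = quadratic_form B C b - 2 * r * (\<Sum>j\<in>B. b j * C j n) + r\<^sup>2 * C n n"
proof -
  define d :: "'a \<Rightarrow> real" where "d j = (if j = n then 1 else 0)" for j
  have d_sum: "(\<Sum>k\<in>B. d k * x k) = x n" for x
    using B by (simp add: d_def if_distrib[of "\<lambda>y. y * _"] cong: if_cong)
  have row: "(\<Sum>k\<in>B. b k * C n k) = (\<Sum>j\<in>B. b j * C j n)"
    by (intro sum.cong refl arg_cong2[where f = times] sym)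
  have "quadratic_form B C (\<lambda>j. b j - r * d j) = (\<Sum>j\<in>B. \<Sum>k\<in>B. b j * b k * C j k - r * (d k * (b j * C j k))
      - r * (d j * (b k * C j k)) + r * r * (d j * (d k * C j k)))"
    unfolding quadratic_form_def by (intro sum.cong refl) (simp add: algebra_simps)
  also have "\<dots> = quadratic_form B C b - r * (\<Sum>j\<in>B. \<Sum>k\<in>B. d k * (b j * C j k))
      - r * (\<Sum>j\<in>B. d j * (\<Sum>k\<in>B. b k * C j k)) + r * r * (\<Sum>j\<in>B. d j * (\<Sum>k\<in>B. d k * C j k))"
    by (simp only: quadratic_form_def sum.distrib sum_subtractf sum_distrib_left)
  also have "\<dots> = quadratic_form B C b - 2 * r * (\<Sum>j\<in>B. b j * C j n) + r\<^sup>2 * C n n"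
    unfolding d_sum row by (simp add: power2_eq_square)
  finally show ?thesis by (simp add: d_def)
qed

lemma positive_semidefinite_Schur_complement:
  fixes C :: "'i \<Rightarrow> 'i \<Rightarrow> real"
  assumes C: "positive_semidefinite C"
  shows "positive_semidefinite (\<lambda>j k. C j k - C j n * C k n / C n n)"
  unfolding positive_semidefinite_def
proof (intro conjI allI impI)
  show "C j k - C j n * C k n / C n n = C k j - C k n * C j n / C n n" for j k
    using positive_semidefinite_sym[OF C, of j k] by (simp add: mult.commute)
  fix A :: "'i set" and a :: "'i \<Rightarrow> real"
  assume A: "finite A"
  define B where "B = insert n A"
  have B: "finite B" "n \<in> B" "A \<subseteq> B" using A by (auto simp: B_def)
  define b where "b j = (if j \<in> A then a j else 0)" for j
  define s where "s = (\<Sum>j\<in>B. b j * C j n)"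
  have "quadratic_form A (\<lambda>j k. C j k - C j n * C k n / C n n) a = quadratic_form B C b - s\<^sup>2 / C n n"
    by (simp only: quadratic_form_mono_neutral[OF B(1,3), of _ a] b_def[symmetric] s_def
        quadratic_form_minus_rank_one[of B])
  also have "0 \<le> quadratic_form B C b - s\<^sup>2 / C n n"
  proof (cases "C n n = 0")
    case True
    then show ?thesis using quadratic_form_nonneg[OF C B(1)] by simp
  next
    case False
    have "0 \<le> quadratic_form B C (\<lambda>j. b j - s / C n n * (if j = n then 1 else 0))"
      by (rule quadratic_form_nonneg[OF C B(1)])
    also have "\<dots> = quadratic_form B C b - 2 * (s / C n n) * s + (s / C n n)\<^sup>2 * C n n"
      unfolding s_def by (rule quadratic_form_minus_unit[OF B(1,2) positive_semidefinite_sym[OF C]])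
    also have "\<dots> = quadratic_form B C b - s\<^sup>2 / C n n"
      using False by (simp add: power2_eq_square)
    finally show ?thesis .
  qed
  finally show "0 \<le> quadratic_form A (\<lambda>j k. C j k - C j n * C k n / C n n) a" .
qed

fun schur_complement :: "(nat \<Rightarrow> nat \<Rightarrow> real) \<Rightarrow> nat \<Rightarrow> nat \<Rightarrow> nat \<Rightarrow> real" where
  "schur_complement C 0 = C"
| "schur_complement C (Suc n) =
    (\<lambda>j k. schur_complement C n j k - schur_complement C n j n * schur_complement C n k n
        / schur_complement C n n n)"

definition cholesky :: "(nat \<Rightarrow> nat \<Rightarrow> real) \<Rightarrow> nat \<Rightarrow> nat \<Rightarrow> real" where
  "cholesky C j i = schur_complement C i j i / sqrt (schur_complement C i i i)"

lemma positive_semidefinite_schur_complement: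
  "positive_semidefinite C \<Longrightarrow> positive_semidefinite (schur_complement C n)"
  by (induct n) (auto intro: positive_semidefinite_Schur_complement)

lemma schur_complement_eq_0:
  assumes C: "positive_semidefinite C"
  shows "j < n \<Longrightarrow> schur_complement C n j k = 0"
proof (induct n arbitrary: j k)
  case (Suc n)
  note psd = positive_semidefinite_schur_complement[OF C, of n]
  show ?case
  proof (cases "j < n")
    case True then show ?thesis using Suc(1) by simp
  next
    case False
    then have j: "j = n" using Suc(2) by simp
    show ?thesis
      using positive_semidefinite_diag_eq_0[OF psd, of n k] positive_semidefinite_sym[OF psd, of n k]
      by (cases "schur_complement C n n n = 0") (simp_all add: j)
  qed
qed simp

lemma cholesky_eq_0: "positive_semidefinite C \<Longrightarrow> j < i \<Longrightarrow> cholesky C j i = 0"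
  by (simp add: cholesky_def schur_complement_eq_0)

lemma sum_cholesky_mult:
  assumes C: "positive_semidefinite C" and j: "j < n"
  shows "(\<Sum>i<n. cholesky C j i * cholesky C k i) = C j k"
proof -
  have "cholesky C j i * cholesky C k i = schur_complement C i j k - schur_complement C (Suc i) j k" for i
    using positive_semidefinite_diag_nonneg[OF positive_semidefinite_schur_complement[OF C, of i], of i]
    by (simp add: cholesky_def)
  then have "(\<Sum>i<n. cholesky C j i * cholesky C k i)
      = (\<Sum>i<n. schur_complement C i j k - schur_complement C (Suc i) j k)"
    by (simp only:)
  also have "\<dots> = schur_complement C 0 j k - schur_complement C n j k"
    by (rule sum_lessThan_telescope')
  finally show ?thesis using schur_complement_eq_0[OF C j] by simp
qed

section \<open>Gaussian processes with a given covariance\<close>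

definition gaussian_space :: "((nat \<Rightarrow> real) \<Rightarrow> real) set" where
  "gaussian_space = {X. square_integrable gauss_seq X \<and>
     (\<exists>Y. (\<forall>m. gauss_linear (Y m)) \<and> (\<lambda>m. l2norm gauss_seq (\<lambda>\<xi>. Y m \<xi> - X \<xi>)) \<longlonglongrightarrow> 0)}"

lemma square_integrable_gauss_linear: "gauss_linear X \<Longrightarrow> square_integrable gauss_seq X"
  using centred_gaussian_gauss_linear by (simp add: centred_gaussian_def)

lemma gaussian_spaceI:
  assumes "square_integrable gauss_seq X" "\<And>m. gauss_linear (Y m)"
    "(\<lambda>m. l2norm gauss_seq (\<lambda>\<xi>. Y m \<xi> - X \<xi>)) \<longlonglongrightarrow> 0"
  shows "X \<in> gaussian_space"
  using assms unfolding gaussian_space_def by blast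

lemma gaussian_spaceE:
  assumes "X \<in> gaussian_space"
  obtains Y where "\<And>m. gauss_linear (Y m)" "(\<lambda>m. l2norm gauss_seq (\<lambda>\<xi>. Y m \<xi> - X \<xi>)) \<longlonglongrightarrow> 0"
  using assms unfolding gaussian_space_def by blast

lemma square_integrable_gaussian_space: "X \<in> gaussian_space \<Longrightarrow> square_integrable gauss_seq X"
  by (simp add: gaussian_space_def)

lemma gaussian_space_zero: "(\<lambda>\<xi>. 0) \<in> gaussian_space"
  by (rule gaussian_spaceI[where Y = "\<lambda>m \<xi>. 0"]) (simp_all add: gauss_linear_zero)

lemma gaussian_space_cmult:
  assumes "X \<in> gaussian_space" shows "(\<lambda>\<xi>. c * X \<xi>) \<in> gaussian_space"
proof -
  obtain Y where Y: "\<And>m. gauss_linear (Y m)" "(\<lambda>m. l2norm gauss_seq (\<lambda>\<xi>. Y m \<xi> - X \<xi>)) \<longlonglongrightarrow> 0"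
    using assms by (rule gaussian_spaceE) (rule that)
  show ?thesis
  proof (rule gaussian_spaceI[OF square_integrable_cmult[OF square_integrable_gaussian_space[OF assms]]])
    show "(\<lambda>m. l2norm gauss_seq (\<lambda>\<xi>. c * Y m \<xi> - c * X \<xi>)) \<longlonglongrightarrow> 0"
      unfolding right_diff_distrib[symmetric] l2norm_cmult by (rule tendsto_mult_right_zero[OF Y(2)])
  qed (rule gauss_linear_cmult[OF Y(1)])
qed

lemma gaussian_space_add:
  assumes "X \<in> gaussian_space" "X' \<in> gaussian_space"
  shows "(\<lambda>\<xi>. X \<xi> + X' \<xi>) \<in> gaussian_space"
proof -
  obtain Y where Y: "\<And>m. gauss_linear (Y m)" "(\<lambda>m. l2norm gauss_seq (\<lambda>\<xi>. Y m \<xi> - X \<xi>)) \<longlonglongrightarrow> 0"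
    using assms(1) by (rule gaussian_spaceE) (rule that)
  obtain Y' where Y': "\<And>m. gauss_linear (Y' m)" "(\<lambda>m. l2norm gauss_seq (\<lambda>\<xi>. Y' m \<xi> - X' \<xi>)) \<longlonglongrightarrow> 0"
    using assms(2) by (rule gaussian_spaceE) (rule that)
  note X = assms[THEN square_integrable_gaussian_space]
  show ?thesis
  proof (rule gaussian_spaceI[OF square_integrable_add[OF X]])
    show "(\<lambda>m. l2norm gauss_seq (\<lambda>\<xi>. (Y m \<xi> + Y' m \<xi>) - (X \<xi> + X' \<xi>))) \<longlonglongrightarrow> 0"
    proof (rule Lim_null_comparison)
      show "(\<lambda>m. l2norm gauss_seq (\<lambda>\<xi>. Y m \<xi> - X \<xi>) + l2norm gauss_seq (\<lambda>\<xi>. Y' m \<xi> - X' \<xi>)) \<longlonglongrightarrow> 0"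
        by (rule tendsto_add_zero[OF Y(2) Y'(2)])
      have "l2norm gauss_seq (\<lambda>\<xi>. (Y m \<xi> + Y' m \<xi>) - (X \<xi> + X' \<xi>))
          \<le> l2norm gauss_seq (\<lambda>\<xi>. Y m \<xi> - X \<xi>) + l2norm gauss_seq (\<lambda>\<xi>. Y' m \<xi> - X' \<xi>)" for m
        unfolding add_diff_add
        by (intro l2norm_add_le square_integrable_diff square_integrable_gauss_linear Y(1) Y'(1) X)
      then show "\<forall>\<^sub>F m in sequentially. norm (l2norm gauss_seq (\<lambda>\<xi>. (Y m \<xi> + Y' m \<xi>) - (X \<xi> + X' \<xi>)))
          \<le> l2norm gauss_seq (\<lambda>\<xi>. Y m \<xi> - X \<xi>) + l2norm gauss_seq (\<lambda>\<xi>. Y' m \<xi> - X' \<xi>)"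
        by simp
    qed
  qed (rule gauss_linear_add[OF Y(1) Y'(1)])
qed

lemma gaussian_space_sum: "(\<And>i. i \<in> A \<Longrightarrow> X i \<in> gaussian_space) \<Longrightarrow> (\<lambda>\<xi>. \<Sum>i\<in>A. X i \<xi>) \<in> gaussian_space"
  by (induct A rule: infinite_finite_induct) (auto intro: gaussian_space_add gaussian_space_zero)

lemma centred_gaussian_gaussian_space:
  assumes "X \<in> gaussian_space" shows "centred_gaussian gauss_seq X"
  using assms by (rule gaussian_spaceE)
    (rule gauss.centred_gaussian_limit[OF centred_gaussian_gauss_linear
        square_integrable_gaussian_space[OF assms]])

text \<open>The random field is the sum of \<open>coefficient j \<xi> * e j t\<close>, summed in blocks whose norms decay
  geometrically: then it converges for almost every \<open>t\<close>, and it is set to 0 elsewhere.\<close>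
locale trace_class_covariance = orthonormal_basis M e for M :: "'a measure" and e +
  fixes d :: "'a \<Rightarrow> 'a \<Rightarrow> real" and B :: real
  assumes kernel_square_integrable: "square_integrable_kernel M d"
    and kernel_sym: "d t s = d s t"
    and kernel_form_nonneg: "square_integrable M h \<Longrightarrow> 0 \<le> kernel_form M d h h"
    and trace_bound: "(\<Sum>j<J. kernel_form M d (e j) (e j)) \<le> B"
begin

interpretation pair: pair_sigma_finite gauss_seq M ..

definition covariance_matrix :: "nat \<Rightarrow> nat \<Rightarrow> real" where
  "covariance_matrix j k = kernel_form M d (e j) (e k)"

lemma positive_semidefinite_covariance_matrix: "positive_semidefinite covariance_matrix"
  unfolding positive_semidefinite_def
proof (intro conjI allI impI)
  have transpose: "(\<lambda>t s. d s t) = d" by (intro ext kernel_sym)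
  show "covariance_matrix j k = covariance_matrix k j" for j k
    using kernel_form_swap[OF kernel_square_integrable basis_square_integrable[of j]
        basis_square_integrable[of k]]
    unfolding covariance_matrix_def transpose .
  show "0 \<le> quadratic_form A covariance_matrix a" for A a
    unfolding quadratic_form_def covariance_matrix_def
      kernel_form_sum_sum[OF kernel_square_integrable basis_square_integrable, symmetric]
    by (intro kernel_form_nonneg square_integrable_sum square_integrable_cmult basis_square_integrable)
qed

lemma covariance_matrix_diag_nonneg: "0 \<le> covariance_matrix j j"
  by (rule positive_semidefinite_diag_nonneg[OF positive_semidefinite_covariance_matrix])

lemma summable_covariance_matrix_diag: "summable (\<lambda>j. covariance_matrix j j)"
  using trace_bound by (intro summableI_nonneg_bounded[OF covariance_matrix_diag_nonneg])
    (simp add: covariance_matrix_def)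

definition coefficient :: "nat \<Rightarrow> (nat \<Rightarrow> real) \<Rightarrow> real" where
  "coefficient j \<xi> = (\<Sum>i<Suc j. cholesky covariance_matrix j i * \<xi> i)"

lemma gauss_linear_coefficient: "gauss_linear (coefficient j)"
  unfolding coefficient_def[abs_def] by (rule gauss_linear_sum_components)

lemma square_integrable_coefficient: "square_integrable gauss_seq (coefficient j)"
  by (rule square_integrable_gauss_linear[OF gauss_linear_coefficient])

lemma measurable_coefficient[measurable]: "coefficient j \<in> borel_measurable gauss_seq"
  by (rule borel_measurable_square_integrable[OF square_integrable_coefficient])

lemma coefficient_eq: "j < n \<Longrightarrow> coefficient j \<xi> = (\<Sum>i<n. cholesky covariance_matrix j i * \<xi> i)"
  unfolding coefficient_def using cholesky_eq_0[OF positive_semidefinite_covariance_matrix]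
  by (intro sum.mono_neutral_left) auto

lemma integral_coefficient_mult: "(\<integral>\<xi>. coefficient j \<xi> * coefficient k \<xi> \<partial>gauss_seq) = covariance_matrix j k"
proof -
  define n where "n = Suc (max j k)"
  have n: "j < n" "k < n" by (auto simp: n_def)
  show ?thesis
    unfolding coefficient_eq[OF n(1)] coefficient_eq[OF n(2)] integral_gauss_sum_mult
    by (rule sum_cholesky_mult[OF positive_semidefinite_covariance_matrix n(1)])
qed

primrec block_start :: "nat \<Rightarrow> nat" where
  "block_start 0 = 0"
| "block_start (Suc r) =
    (LEAST m. block_start r < m \<and> (\<Sum>j. covariance_matrix (j + m) (j + m)) \<le> (1 / 4) ^ r)"

lemma block_start_less: "block_start r < block_start (Suc r)"
  and variance_tail_le: "(\<Sum>j. covariance_matrix (j + block_start (Suc r)) (j + block_start (Suc r)))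
      \<le> (1 / 4) ^ r"
proof -
  have "(\<lambda>m. \<Sum>j. covariance_matrix (j + m) (j + m)) \<longlonglongrightarrow> 0"
    by (rule suminf_exist_split2[OF summable_covariance_matrix_diag])
  then have "\<forall>\<^sub>F m in sequentially. (\<Sum>j. covariance_matrix (j + m) (j + m)) < (1 / 4) ^ r"
    by (rule order_tendstoD(2)) simp
  with eventually_gt_at_top[of "block_start r"]
  have "\<forall>\<^sub>F m in sequentially. block_start r < m \<and> (\<Sum>j. covariance_matrix (j + m) (j + m)) \<le> (1 / 4) ^ r"
    by eventually_elim auto
  then have "\<exists>m. block_start r < m \<and> (\<Sum>j. covariance_matrix (j + m) (j + m)) \<le> (1 / 4) ^ r"
    by (auto simp: eventually_sequentially)
  from LeastI_ex[OF this] show "block_start r < block_start (Suc r)"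
    "(\<Sum>j. covariance_matrix (j + block_start (Suc r)) (j + block_start (Suc r))) \<le> (1 / 4) ^ r"
    by simp_all
qed

lemma le_block_start: "r \<le> block_start r"
  by (induct r) (use block_start_less in \<open>auto intro: le_less_trans simp: Suc_le_eq
      simp del: block_start.simps(2)\<close>)

lemma sum_block_variances_le:
  "(\<Sum>j=block_start (Suc r)..<block_start (Suc (Suc r)). covariance_matrix j j) \<le> (1 / 4) ^ r"
proof -
  let ?n = "block_start (Suc r)" and ?v = "\<lambda>j. covariance_matrix j j"
  have "(\<Sum>j=?n..<block_start (Suc (Suc r)). ?v j) = (\<Sum>j=0..<block_start (Suc (Suc r)) - ?n. ?v (j + ?n))"
    using sum.shift_bounds_nat_ivl[of ?v 0 ?n "block_start (Suc (Suc r)) - ?n"]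
        block_start_less[of "Suc r"] by simp
  also have "\<dots> \<le> (\<Sum>j. ?v (j + ?n))"
    using summable_ignore_initial_segment[OF summable_covariance_matrix_diag] covariance_matrix_diag_nonneg
    by (intro sum_le_suminf) auto
  finally show ?thesis using variance_tail_le[of r] by linarith
qed

definition increment :: "nat \<Rightarrow> (nat \<Rightarrow> real) \<Rightarrow> 'a \<Rightarrow> real" where
  "increment r \<xi> t = (\<Sum>j=block_start r..<block_start (Suc r). coefficient j \<xi> * e j t)"

lemma sum_increment: "(\<Sum>r<m. increment r \<xi> t) = (\<Sum>j<block_start m. coefficient j \<xi> * e j t)"
proof (induct m)
  case (Suc m)
  then show ?case
    using block_start_less[of m]
    by (simp add: increment_def lessThan_atLeast0 sum.atLeastLessThan_concat del: block_start.simps(2))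
qed simp

lemma square_integrable_increment: "square_integrable (gauss_seq \<Otimes>\<^sub>M M) (\<lambda>(\<xi>, t). increment r \<xi> t)"
  using square_integrable_sum[OF pair.square_integrable_tensor(1)[OF square_integrable_coefficient
      basis_square_integrable]]
  by (simp add: increment_def split_beta')

lemma measurable_increment[measurable]: "(\<lambda>(\<xi>, t). increment r \<xi> t) \<in> borel_measurable (gauss_seq \<Otimes>\<^sub>M M)"
  by (rule borel_measurable_square_integrable[OF square_integrable_increment])

lemma gauss_linear_increment: "gauss_linear (\<lambda>\<xi>. increment r \<xi> t)"
  unfolding increment_def
  by (intro gauss_linear_sum, subst mult.commute, rule gauss_linear_cmult[OF gauss_linear_coefficient])

lemma l2norm_increment_square:
  "(l2norm (gauss_seq \<Otimes>\<^sub>M M) (\<lambda>(\<xi>, t). increment r \<xi> t))\<^sup>2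
    = (\<Sum>j=block_start r..<block_start (Suc r). covariance_matrix j j)"
proof -
  let ?J = "{block_start r..<block_start (Suc r)}"
  have "(l2norm gauss_seq (\<lambda>\<xi>. \<integral>t. increment r \<xi> t * e j t \<partial>M))\<^sup>2
      = (if j \<in> ?J then covariance_matrix j j else 0)" for j
    unfolding increment_def coefficient_sum_basis[OF finite_atLeastLessThan] l2norm_square
    by (cases "j \<in> ?J") (simp_all add: power2_eq_square integral_coefficient_mult del: atLeastLessThan_iff)
  then have "(\<lambda>j. if j \<in> ?J then covariance_matrix j j else 0)
      sums (l2norm (gauss_seq \<Otimes>\<^sub>M M) (\<lambda>(\<xi>, t). increment r \<xi> t))\<^sup>2"
    using Parseval_l2norm_sections[OF gauss.sigma_finite_measure_axioms square_integrable_increment[of r]]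
    by simp
  from sums_unique2[OF this sums_If_finite_set[OF finite_atLeastLessThan]] show ?thesis .
qed

lemma summable_l2norm_increment: "summable (\<lambda>r. l2norm (gauss_seq \<Otimes>\<^sub>M M) (\<lambda>(\<xi>, t). increment r \<xi> t))"
proof -
  have "l2norm (gauss_seq \<Otimes>\<^sub>M M) (\<lambda>(\<xi>, t). increment (Suc r) \<xi> t) \<le> (1 / 2) ^ r" for r
  proof (rule power2_le_imp_le)
    have "((1 / 2 :: real) ^ r)\<^sup>2 = (1 / 4) ^ r"
      by (simp add: power2_eq_square power_mult_distrib[symmetric])
    then show "(l2norm (gauss_seq \<Otimes>\<^sub>M M) (\<lambda>(\<xi>, t). increment (Suc r) \<xi> t))\<^sup>2 \<le> ((1 / 2) ^ r)\<^sup>2"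
      unfolding l2norm_increment_square using sum_block_variances_le[of r] by (simp only:)
  qed simp
  then have "summable (\<lambda>r. l2norm (gauss_seq \<Otimes>\<^sub>M M) (\<lambda>(\<xi>, t). increment (Suc r) \<xi> t))"
    by (intro summable_comparison_test'[OF summable_geometric[of "1 / 2 :: real"]]) simp_all
  then show ?thesis
    by (rule summable_Suc_iff[of "\<lambda>r. l2norm (gauss_seq \<Otimes>\<^sub>M M) (\<lambda>(\<xi>, t). increment r \<xi> t)", THEN iffD1])
qed

definition series :: "(nat \<Rightarrow> real) \<Rightarrow> 'a \<Rightarrow> real" where
  "series \<xi> t = (\<Sum>r. increment r \<xi> t)"

definition regular_points :: "'a set" where
  "regular_points = {t \<in> space M. (\<Sum>r. ennreal (l2norm gauss_seq (\<lambda>\<xi>. increment r \<xi> t))) \<noteq> top}"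

definition random_field :: "(nat \<Rightarrow> real) \<Rightarrow> 'a \<Rightarrow> real" where
  "random_field \<xi> t = series \<xi> t * indicator regular_points t"

lemma measurable_series[measurable]: "(\<lambda>(\<xi>, t). series \<xi> t) \<in> borel_measurable (gauss_seq \<Otimes>\<^sub>M M)"
  unfolding series_def by measurable

lemma measurable_regular_points[measurable]: "regular_points \<in> sets M"
  unfolding regular_points_def l2norm_def by measurable

lemma measurable_random_field[measurable]: "(\<lambda>(\<xi>, t). random_field \<xi> t) \<in> borel_measurable (gauss_seq \<Otimes>\<^sub>M M)"
  unfolding random_field_def by measurable

lemma AE_regular_points: "AE t in M. t \<in> regular_points"
proof -
  note sections = pair.square_integrable_section_snd[OF square_integrable_increment]
  have "AE t in M. summable (\<lambda>r. \<bar>l2norm gauss_seq (\<lambda>\<xi>. increment r \<xi> t)\<bar>)"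
    by (rule infinite_Minkowski(1)[OF sections(2)]) (simp only: sections(3) summable_l2norm_increment)
  with AE_space show ?thesis
  proof eventually_elim
    case (elim t)
    then have "(\<Sum>r. ennreal (l2norm gauss_seq (\<lambda>\<xi>. increment r \<xi> t)))
        = ennreal (\<Sum>r. l2norm gauss_seq (\<lambda>\<xi>. increment r \<xi> t))"
      by (intro suminf_ennreal_eq summable_sums) simp_all
    then show ?case using elim by (simp add: regular_points_def)
  qed
qed

lemma random_field_gaussian_space: "(\<lambda>\<xi>. random_field \<xi> t) \<in> gaussian_space"
proof (cases "t \<in> regular_points")
  case True
  then have norm_summable: "summable (\<lambda>r. l2norm gauss_seq (\<lambda>\<xi>. increment r \<xi> t))"
    by (intro summable_suminf_not_top) (simp_all add: regular_points_def)
  note increment = square_integrable_gauss_linear[OF gauss_linear_increment]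
  have "(\<lambda>\<xi>. series \<xi> t) \<in> gaussian_space"
  proof (rule gaussian_spaceI)
    show "square_integrable gauss_seq (\<lambda>\<xi>. series \<xi> t)"
      unfolding series_def by (rule infinite_Minkowski(2)[OF increment norm_summable])
    show "(\<lambda>m. l2norm gauss_seq (\<lambda>\<xi>. (\<Sum>r<m. increment r \<xi> t) - series \<xi> t)) \<longlonglongrightarrow> 0"
      unfolding series_def
      by (subst l2norm_minus_commute) (rule l2norm_suminf_minus_partial_sum_tendsto[OF increment
          norm_summable])
  qed (intro gauss_linear_sum gauss_linear_increment)
  then show ?thesis using True by (simp add: random_field_def)
qed (simp add: random_field_def gaussian_space_zero)

lemma square_integrable_series: "square_integrable (gauss_seq \<Otimes>\<^sub>M M) (\<lambda>(\<xi>, t). series \<xi> t)"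
  using infinite_Minkowski(2)[OF square_integrable_increment summable_l2norm_increment]
  by (simp add: series_def split_beta')

lemma l2norm_series_minus_partial_sum_tendsto:
  "(\<lambda>m. l2norm (gauss_seq \<Otimes>\<^sub>M M) (\<lambda>(\<xi>, t). series \<xi> t - (\<Sum>r<m. increment r \<xi> t))) \<longlonglongrightarrow> 0"
  using l2norm_suminf_minus_partial_sum_tendsto[OF square_integrable_increment summable_l2norm_increment]
  by (simp add: series_def split_beta')

lemma inner_partial_sum:
  "j < block_start m \<Longrightarrow> (\<integral>t. (\<Sum>r<m. increment r \<xi> t) * e j t \<partial>M) = coefficient j \<xi>"
  unfolding sum_increment by (simp add: coefficient_sum_basis)

lemma AE_inner_remainder:
  assumes j: "j < block_start m"
  shows "AE \<xi> in gauss_seq. (\<integral>t. (series \<xi> t - (\<Sum>r<m. increment r \<xi> t)) * e j t \<partial>M)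
    = (\<integral>t. series \<xi> t * e j t \<partial>M) - coefficient j \<xi>"
  using pair.square_integrable_section(1)[OF square_integrable_series]
proof eventually_elim
  case (elim \<xi>)
  have partial: "square_integrable M (\<lambda>t. \<Sum>r<m. increment r \<xi> t)"
    unfolding sum_increment by (intro square_integrable_sum square_integrable_cmult basis_square_integrable)
  show ?case
    unfolding left_diff_distrib inner_partial_sum[OF j, symmetric]
    by (intro Bochner_Integration.integral_diff integrable_mult elim partial basis_square_integrable)
qed

lemma AE_inner_series: "AE \<xi> in gauss_seq. (\<integral>t. series \<xi> t * e j t \<partial>M) = coefficient j \<xi>"
proof -
  define D where "D \<xi> = (\<integral>t. series \<xi> t * e j t \<partial>M) - coefficient j \<xi>" for \<xi>
  have D: "square_integrable gauss_seq D"
    unfolding D_def[abs_def]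
    by (intro square_integrable_diff square_integrable_coefficient
        pair.square_integrable_inner(1)[OF square_integrable_series basis_square_integrable])
  have D_le: "l2norm gauss_seq D \<le> l2norm (gauss_seq \<Otimes>\<^sub>M M) (\<lambda>(\<xi>, t). series \<xi> t - (\<Sum>r<m. increment r \<xi> t))"
    if m: "j < m" for m
  proof -
    have "square_integrable (gauss_seq \<Otimes>\<^sub>M M) (\<lambda>(\<xi>, t). series \<xi> t - (\<Sum>r<m. increment r \<xi> t))"
      using square_integrable_diff[OF square_integrable_series
          square_integrable_sum[OF square_integrable_increment]]
      by (simp add: split_beta')
    note inner = pair.square_integrable_inner[OF this basis_square_integrable[of j]]
    have "l2norm gauss_seq (\<lambda>\<xi>. \<integral>t. (series \<xi> t - (\<Sum>r<m. increment r \<xi> t)) * e j t \<partial>M) = l2norm gauss_seq D"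
      unfolding D_def[abs_def]
      by (rule l2norm_cong_AE[OF borel_measurable_square_integrable[OF inner(1)]
            borel_measurable_square_integrable[OF D[unfolded D_def[abs_def]]]
            AE_inner_remainder[OF less_le_trans[OF m le_block_start]]])
    then show ?thesis using inner(2) by (simp add: l2norm_basis)
  qed
  have "l2norm gauss_seq D \<le> 0"
    by (rule LIMSEQ_le_const[OF l2norm_series_minus_partial_sum_tendsto])
       (use D_le in \<open>auto simp: Suc_le_eq intro!: exI[of _ "Suc j"]\<close>)
  then have "l2norm gauss_seq D = 0" by (intro antisym l2norm_nonneg)
  from l2norm_eq_0_imp_AE[OF D this] show ?thesis by eventually_elim (simp add: D_def)
qed

lemma kernel_form_cross_moment_series:
  "kernel_form M (cross_moment gauss_seq series series) (e j) (e k) = kernel_form M d (e j) (e k)"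
proof -
  note inner = borel_measurable_square_integrable[OF
      pair.square_integrable_inner(1)[OF square_integrable_series basis_square_integrable]]
  have "kernel_form M (cross_moment gauss_seq series series) (e j) (e k)
      = (\<integral>\<xi>. (\<integral>t. series \<xi> t * e j t \<partial>M) * (\<integral>s. series \<xi> s * e k s \<partial>M) \<partial>gauss_seq)"
    by (rule pair.integral_inner_mult_inner[OF square_integrable_series square_integrable_series
          basis_square_integrable basis_square_integrable, symmetric])
  also have "\<dots> = (\<integral>\<xi>. coefficient j \<xi> * coefficient k \<xi> \<partial>gauss_seq)"
  proof (rule integral_cong_AE)
    show "AE \<xi> in gauss_seq. (\<integral>t. series \<xi> t * e j t \<partial>M) * (\<integral>s. series \<xi> s * e k s \<partial>M)
        = coefficient j \<xi> * coefficient k \<xi>"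
      using AE_inner_series[of j] AE_inner_series[of k] by eventually_elim simp
  qed (intro borel_measurable_times inner measurable_coefficient)+
  finally show ?thesis unfolding integral_coefficient_mult covariance_matrix_def .
qed

lemma AE_covariance_random_field:
  "AE t in M. AE s in M. (\<integral>\<xi>. random_field \<xi> t * random_field \<xi> s \<partial>gauss_seq) = d t s"
proof -
  have "AE t in M. AE s in M. cross_moment gauss_seq series series t s = d t s"
    by (rule AE_kernel_eq_if_coefficients_eq[OF
        pair.square_integrable_cross_moment[OF square_integrable_series
          square_integrable_series] kernel_square_integrable kernel_form_cross_moment_series])
  with AE_regular_points show ?thesis
  proof eventually_elim
    case (elim t)
    from elim(2) AE_regular_points show ?case
      by eventually_elim (use elim(1) in \<open>simp add: random_field_def cross_moment_def\<close>)
  qed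
qed

end

theorem gaussian_process_exists:
  assumes "trace_class_covariance UI haar d B"
  shows "\<exists>G. gaussian_process gauss_seq G d"
proof
  interpret trace_class_covariance UI haar d B by fact
  have measurable: "(\<lambda>(\<xi>, t). random_field \<xi> t) \<in> borel_measurable (gauss_seq \<Otimes>\<^sub>M lborel)"
    using measurable_random_field by (simp cong: measurable_cong_sets sets_pair_measure_cong)
  have covariance: "AE t in lborel. AE s in lborel. t \<in> {0..1} \<longrightarrow> s \<in> {0..1} \<longrightarrow>
      (\<integral>\<xi>. random_field \<xi> t * random_field \<xi> s \<partial>gauss_seq) = d t s"
    using AE_covariance_random_field unfolding AE_UI_iff by eventually_elim auto
  have "centred_gaussian gauss_seq (\<lambda>\<xi>. \<Sum>k<n. a k * random_field \<xi> (T k))" for n T and a :: "nat \<Rightarrow> real"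
    by (intro centred_gaussian_gaussian_space gaussian_space_sum gaussian_space_cmult
        random_field_gaussian_space)
  then show "gaussian_process gauss_seq random_field d"
    unfolding gaussian_process_def centred_gaussian_def square_integrable_def l2norm_square
    using measurable covariance gauss.prob_space_axioms by blast
qed

section \<open>Quadrature at random points\<close>

context prob_space
begin

lemma l2norm_centred_le:
  assumes X: "square_integrable M X"
  shows "l2norm M (\<lambda>x. X x - expectation X) \<le> l2norm M X"
proof (rule power2_le_imp_le)
  have "(l2norm M (\<lambda>x. X x - expectation X))\<^sup>2 = (l2norm M X)\<^sup>2 - (expectation X)\<^sup>2"
    using variance_eq[OF integrable_if_square_integrable[OF X] integrable_square[OF X]]
    by (simp add: l2norm_square)
  then show "(l2norm M (\<lambda>x. X x - expectation X))\<^sup>2 \<le> (l2norm M X)\<^sup>2" by simp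
qed simp

lemma sample_mean:
  fixes X :: "'a \<Rightarrow> real" and n :: nat
  assumes X: "square_integrable M X" and n: "0 < n"
  shows "square_integrable (iid M) (\<lambda>T. (\<Sum>k<n. X (T k)) / n - expectation X)"
    and "l2norm (iid M) (\<lambda>T. (\<Sum>k<n. X (T k)) / n - expectation X) \<le> l2norm M X / sqrt n"
proof -
  define Y where "Y x = X x - expectation X" for x
  have Y: "square_integrable M Y"
    unfolding Y_def[abs_def] by (intro square_integrable_diff X square_integrable_const)
  have Y_mean: "expectation Y = 0"
    unfolding Y_def using integrable_if_square_integrable[OF X] by (simp add: prob_space)
  note [measurable] = borel_measurable_square_integrable[OF Y]
  have component: "square_integrable (iid M) (\<lambda>T. Y (T k))" "l2norm (iid M) (\<lambda>T. Y (T k)) = l2norm M Y"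
    "(\<integral>T. Y (T k) \<partial>iid M) = 0" for k :: nat
    using square_integrable_distr[OF _ distr_iid_component Y, of k]
      integral_distr[of "\<lambda>T. T k" "iid M" M Y] Y_mean by (simp_all add: distr_iid_component)
  have orthogonal: "(\<integral>T. Y (T i) * Y (T j) \<partial>iid M) = 0" if "i \<noteq> j" for i j :: nat
    using integral_mult_disjoint[OF component(1) component(1), of "{i}" i "{j}" j] that component(3)
    by (auto simp: depends_on_def)
  have mean_eq: "(\<Sum>k<n. X (T k)) / n - expectation X = (\<Sum>k<n. Y (T k)) / n" for T
    using n by (simp add: Y_def sum_subtractf field_simps)
  show "square_integrable (iid M) (\<lambda>T. (\<Sum>k<n. X (T k)) / n - expectation X)"
    unfolding mean_eq by (intro square_integrable_divide square_integrable_sum component)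
  have "l2norm (iid M) (\<lambda>T. (\<Sum>k<n. Y (T k)) / n) = l2norm M Y * (sqrt n / n)"
    using l2norm_sum_orthogonal[of "{..<n}" "iid M" "\<lambda>k T. Y (T k)", OF _ component(1) orthogonal
        component(2)]
    by (simp add: l2norm_divide)
  also have "\<dots> = l2norm M Y / sqrt n"
    using sqrt_divide_self_eq[of "real n"] by (simp add: divide_inverse)
  also have "\<dots> \<le> l2norm M X / sqrt n"
    unfolding Y_def[abs_def] by (intro divide_right_mono l2norm_centred_le X) simp
  finally show "l2norm (iid M) (\<lambda>T. (\<Sum>k<n. X (T k)) / n - expectation X) \<le> l2norm M X / sqrt n"
    unfolding mean_eq .
qed

end

context pair_prob_space
begin

lemma sample_mean_sections:
  fixes n :: nat
  assumes X: "square_integrable (M1 \<Otimes>\<^sub>M M2) (\<lambda>(x, y). X x y)" and n: "0 < n"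
  shows "square_integrable (M1 \<Otimes>\<^sub>M iid M2) (\<lambda>(x, T). (\<Sum>k<n. X x (T k)) / n - (\<integral>y. X x y \<partial>M2))"
    and "l2norm (M1 \<Otimes>\<^sub>M iid M2) (\<lambda>(x, T). (\<Sum>k<n. X x (T k)) / n - (\<integral>y. X x y \<partial>M2))
      \<le> l2norm (M1 \<Otimes>\<^sub>M M2) (\<lambda>(x, y). X x y) / sqrt n"
proof -
  let ?E = "\<lambda>x T. (\<Sum>k<n. X x (T k)) / n - (\<integral>y. X x y \<partial>M2)"
  note [measurable] = borel_measurable_square_integrable[OF X]
  interpret iid: prob_space "iid M2 :: (nat \<Rightarrow> 'b) measure" by (rule M2.prob_space_iid)
  have "(\<integral>\<^sup>+p. ennreal ((case p of (x, T) \<Rightarrow> ?E x T)\<^sup>2) \<partial>(M1 \<Otimes>\<^sub>M iid M2))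
      = (\<integral>\<^sup>+x. \<integral>\<^sup>+T. ennreal ((?E x T)\<^sup>2) \<partial>iid M2 \<partial>M1)"
    by (subst iid.nn_integral_fst[symmetric]) auto
  also have "\<dots> \<le> (\<integral>\<^sup>+x. ennreal ((l2norm M2 (X x) / sqrt n)\<^sup>2) \<partial>M1)"
  proof (rule nn_integral_mono_AE)
    show "AE x in M1. (\<integral>\<^sup>+T. ennreal ((?E x T)\<^sup>2) \<partial>iid M2) \<le> ennreal ((l2norm M2 (X x) / sqrt n)\<^sup>2)"
      using square_integrable_section(1)[OF X]
    proof eventually_elim
      case (elim x)
      note mean = M2.sample_mean[OF elim n]
      show ?case
        unfolding nn_integral_square[OF mean(1)] by (intro ennreal_leI power_mono mean(2)) simp
    qed
  qed
  also have "\<dots> = ennreal ((l2norm M1 (\<lambda>x. l2norm M2 (X x) / sqrt n))\<^sup>2)"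
    by (rule nn_integral_square[OF square_integrable_divide[OF square_integrable_section(2)[OF X]]])
  also have "l2norm M1 (\<lambda>x. l2norm M2 (X x) / sqrt n) = l2norm (M1 \<Otimes>\<^sub>M M2) (\<lambda>(x, y). X x y) / sqrt n"
    by (simp add: l2norm_divide square_integrable_section(3)[OF X])
  finally have error_le: "(\<integral>\<^sup>+p. ennreal ((case p of (x, T) \<Rightarrow> ?E x T)\<^sup>2) \<partial>(M1 \<Otimes>\<^sub>M iid M2))
      \<le> ennreal ((l2norm (M1 \<Otimes>\<^sub>M M2) (\<lambda>(x, y). X x y) / sqrt n)\<^sup>2)" .
  from square_integrable_if_nn_integral_le[OF _ error_le]
  show "square_integrable (M1 \<Otimes>\<^sub>M iid M2) (\<lambda>(x, T). ?E x T)"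
    "l2norm (M1 \<Otimes>\<^sub>M iid M2) (\<lambda>(x, T). ?E x T) \<le> l2norm (M1 \<Otimes>\<^sub>M M2) (\<lambda>(x, y). X x y) / sqrt n"
    by simp_all
qed

lemma exists_section_l2norm_less:
  assumes X: "square_integrable (M1 \<Otimes>\<^sub>M M2) (\<lambda>(x, y). X x y)"
    and less: "l2norm (M1 \<Otimes>\<^sub>M M2) (\<lambda>(x, y). X x y) < b" and P: "AE y in M2. P y"
  shows "\<exists>y. P y \<and> l2norm M1 (\<lambda>x. X x y) < b"
proof (rule ccontr)
  assume "\<nexists>y. P y \<and> l2norm M1 (\<lambda>x. X x y) < b"
  then have section_ge: "b \<le> l2norm M1 (\<lambda>x. X x y)" if "P y" for y
    using that by (auto simp: not_less)
  have "AE y in M2. b \<le> l2norm M1 (\<lambda>x. X x y)"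
    using P by eventually_elim (rule section_ge)
  moreover have b: "0 \<le> b" using less l2norm_nonneg[of "M1 \<Otimes>\<^sub>M M2"]
    by (rule order_trans[OF _ less_imp_le, rotated])
  ultimately have "l2norm M2 (\<lambda>y. b) \<le> l2norm M2 (\<lambda>y. l2norm M1 (\<lambda>x. X x y))"
    by (intro square_integrable_bound(2)[OF square_integrable_section_snd(2)[OF X]]) auto
  also have "l2norm M2 (\<lambda>y. b) = b" using b by (simp add: l2norm_def M2.prob_space)
  finally show False using less unfolding square_integrable_section_snd(3)[OF X] by simp
qed

end

section \<open>Integrals of Gaussian processes against test functions\<close>

lemma (in orthonormal_basis) laplace_partial_sums_tendsto:
  assumes N: "prob_space N" and X: "square_integrable (N \<Otimes>\<^sub>M M) (\<lambda>(\<omega>, t). X \<omega> t)" and l: "0 \<le> l"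
  shows "(\<lambda>J. \<integral>\<omega>. exp (- (l * (\<Sum>j<J. (\<integral>t. X \<omega> t * e j t \<partial>M)\<^sup>2))) \<partial>N)
      \<longlonglongrightarrow> (\<integral>\<omega>. exp (- (l * (\<integral>t. (X \<omega> t)\<^sup>2 \<partial>M))) \<partial>N)"
proof (rule integral_dominated_convergence[where w = "\<lambda>_. 1"])
  interpret N: prob_space N by fact
  interpret pair_sigma_finite N M ..
  note [measurable] = borel_measurable_square_integrable[OF X]
  show "AE \<omega> in N. (\<lambda>J. exp (- (l * (\<Sum>j<J. (\<integral>t. X \<omega> t * e j t \<partial>M)\<^sup>2)))) \<longlonglongrightarrow> exp (- (l * (\<integral>t. (X \<omega> t)\<^sup>2 \<partial>M)))"
    using square_integrable_section(1)[OF X]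
  proof eventually_elim
    case (elim \<omega>)
    from Parseval[OF elim] show ?case
      unfolding sums_def l2norm_square by (intro tendsto_intros)
  qed
  show "AE \<omega> in N. norm (exp (- (l * (\<Sum>j<J. (\<integral>t. X \<omega> t * e j t \<partial>M)\<^sup>2)))) \<le> 1" for J
    using l by (intro AE_I2) (simp add: sum_nonneg)
  show "(\<lambda>\<omega>. exp (- (l * (\<Sum>j<J. (\<integral>t. X \<omega> t * e j t \<partial>M)\<^sup>2)))) \<in> borel_measurable N" for J
    by measurable
  show "(\<lambda>\<omega>. exp (- (l * (\<integral>t. (X \<omega> t)\<^sup>2 \<partial>M)))) \<in> borel_measurable N"
    by measurable
  show "integrable N (\<lambda>_. 1 :: real)" by simp
qed

text \<open>The covariance is prescribed only almost everywhere on the square, which says nothing about the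
  variance on the diagonal: that is controlled by the traces of the truncated kernels.\<close>
locale trace_class_gaussian_process =
  fixes \<Omega> :: "'b measure" and G :: "'b \<Rightarrow> real \<Rightarrow> real" and d :: "real \<Rightarrow> real \<Rightarrow> real" and C :: real
  assumes gaussian_process: "gaussian_process \<Omega> G d" and kernel_square_integrable:
      "square_integrable_kernel UI d"
    and trace_bound: "A \<in> sets borel \<Longrightarrow>
      (\<Sum>j<J. kernel_form UI d (\<lambda>t. haar j t * indicator A t) (\<lambda>t. haar j t * indicator A t)) \<le> C"

sublocale trace_class_gaussian_process \<subseteq> prob_space \<Omega>
  using gaussian_process by (simp add: gaussian_process_def)

context trace_class_gaussian_process
begin

interpretation pair: pair_prob_space \<Omega> UI ..

lemma measurable_process[measurable]: "(\<lambda>(\<omega>, t). G \<omega> t) \<in> borel_measurable (\<Omega> \<Otimes>\<^sub>M UI)"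
proof -
  have "(\<lambda>(\<omega>, t). G \<omega> t) \<in> borel_measurable (\<Omega> \<Otimes>\<^sub>M lborel)"
    using gaussian_process by (simp add: gaussian_process_def)
  then show ?thesis by (simp cong: measurable_cong_sets sets_pair_measure_cong)
qed

lemma centred_gaussian_sum:
  fixes T w :: "nat \<Rightarrow> real"
  assumes "\<And>k. k < n \<Longrightarrow> T k \<in> {0..1}"
  shows "centred_gaussian \<Omega> (\<lambda>\<omega>. \<Sum>k<n. w k * G \<omega> (T k))"
proof -
  let ?X = "\<lambda>\<omega>. \<Sum>k<n. w k * G \<omega> (T k)"
  have "\<forall>k<n. T k \<in> {0..1}" using assms by simp
  then have "integrable \<Omega> (\<lambda>\<omega>. (?X \<omega>)\<^sup>2) \<and> expectation ?X = 0 \<and>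
      (\<forall>u. char (distr \<Omega> borel ?X) u = complex_of_real (exp (- (u\<^sup>2 * expectation (\<lambda>\<omega>. (?X \<omega>)\<^sup>2)) / 2)))"
    using gaussian_process unfolding gaussian_process_def by blast
  then show ?thesis
    unfolding centred_gaussian_def square_integrable_def l2norm_square by (simp add: borel_measurable_sum)
qed

lemma square_integrable_process_at: "t \<in> {0..1} \<Longrightarrow> square_integrable \<Omega> (\<lambda>\<omega>. G \<omega> t)"
  using centred_gaussian_sum[of 1 "\<lambda>_. t" "\<lambda>_. 1"] by (simp add: centred_gaussian_def)

lemma AE_cross_moment_process: "AE t in UI. AE s in UI. cross_moment \<Omega> G G t s = d t s"
proof -
  have "AE t in lborel. AE s in lborel. t \<in> {0..1} \<longrightarrow> s \<in> {0..1} \<longrightarrow> (\<integral>\<omega>. G \<omega> t * G \<omega> s \<partial>\<Omega>) = d t s"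
    using gaussian_process unfolding gaussian_process_def by blast
  then show ?thesis unfolding AE_UI_iff cross_moment_def by eventually_elim auto
qed

lemma kernel_form_process:
  "g \<in> borel_measurable UI \<Longrightarrow> h \<in> borel_measurable UI \<Longrightarrow>
    kernel_form UI (cross_moment \<Omega> G G) g h = kernel_form UI d g h"
  by (intro UI.kernel_form_cong_AE pair.measurable_cross_moment measurable_process AE_cross_moment_process
      borel_measurable_square_integrable[OF kernel_square_integrable])

definition bounded_variance_set :: "nat \<Rightarrow> real set" where
  "bounded_variance_set n = {t. t \<in> {0..1} \<longrightarrow> l2norm \<Omega> (\<lambda>\<omega>. G \<omega> t) \<le> real n}"

definition truncated_process :: "nat \<Rightarrow> 'b \<Rightarrow> real \<Rightarrow> real" where
  "truncated_process n \<omega> t = G \<omega> t * indicator (bounded_variance_set n) t"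

lemma measurable_bounded_variance_set[measurable]: "bounded_variance_set n \<in> sets borel"
proof -
  have "bounded_variance_set n = {t \<in> space UI. t \<in> {0..1} \<longrightarrow> l2norm \<Omega> (\<lambda>\<omega>. G \<omega> t) \<le> real n}"
    by (auto simp: bounded_variance_set_def)
  also have "\<dots> \<in> sets UI" unfolding l2norm_def by measurable
  finally show ?thesis by simp
qed

lemma measurable_truncated_process[measurable]:
  "(\<lambda>(\<omega>, t). truncated_process n \<omega> t) \<in> borel_measurable (\<Omega> \<Otimes>\<^sub>M UI)"
  unfolding truncated_process_def by measurable

lemma square_integrable_truncated_process: "square_integrable (\<Omega> \<Otimes>\<^sub>M UI) (\<lambda>(\<omega>, t). truncated_process n \<omega> t)"
proof (rule square_integrable_if_nn_integral_le(1))
  have "(\<integral>\<^sup>+\<omega>. ennreal ((truncated_process n \<omega> t)\<^sup>2) \<partial>\<Omega>) \<le> ennreal ((real n)\<^sup>2)" if "t \<in> {0..1}" for t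
  proof (cases "t \<in> bounded_variance_set n")
    case True
    then have "(\<integral>\<^sup>+\<omega>. ennreal ((truncated_process n \<omega> t)\<^sup>2) \<partial>\<Omega>) = ennreal ((l2norm \<Omega> (\<lambda>\<omega>. G \<omega> t))\<^sup>2)"
      using nn_integral_square[OF square_integrable_process_at[OF that]]
      by (simp add: truncated_process_def bounded_variance_set_def)
    then show ?thesis using True that by (simp add: bounded_variance_set_def ennreal_leI power_mono)
  qed (simp add: truncated_process_def)
  then have "(\<integral>\<^sup>+t. \<integral>\<^sup>+\<omega>. ennreal ((truncated_process n \<omega> t)\<^sup>2) \<partial>\<Omega> \<partial>UI) \<le> (\<integral>\<^sup>+t. ennreal ((real n)\<^sup>2) \<partial>UI)"
    by (intro nn_integral_mono_AE) (simp add: AE_UI_iff)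
  then show "(\<integral>\<^sup>+p. ennreal ((case p of (\<omega>, t) \<Rightarrow> truncated_process n \<omega> t)\<^sup>2) \<partial>(\<Omega> \<Otimes>\<^sub>M UI))
      \<le> ennreal ((real n)\<^sup>2)"
    by (subst pair.nn_integral_snd[symmetric]) (auto simp: UI.emeasure_space_1[unfolded space_UI])
qed simp_all

lemma l2norm_inner_truncated_process_square:
  "(l2norm \<Omega> (\<lambda>\<omega>. \<integral>t. truncated_process n \<omega> t * haar j t \<partial>UI))\<^sup>2 = kernel_form UI d
     (\<lambda>t. haar j t * indicator (bounded_variance_set n) t) (\<lambda>t. haar j t * indicator (bounded_variance_set
         n) t)"
proof -
  let ?X = "truncated_process n" and ?I = "indicator (bounded_variance_set n) :: real \<Rightarrow> real"
  note X = square_integrable_truncated_process[of n]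
  have "(l2norm \<Omega> (\<lambda>\<omega>. \<integral>t. ?X \<omega> t * haar j t \<partial>UI))\<^sup>2 = kernel_form UI (cross_moment \<Omega> ?X ?X) (haar j) (haar j)"
    unfolding l2norm_square unfolding power2_eq_square
    by (rule pair.integral_inner_mult_inner[OF X X square_integrable_haar square_integrable_haar])
  also have "\<dots> = kernel_form UI (cross_moment \<Omega> G G) (\<lambda>t. haar j t * ?I t) (\<lambda>t. haar j t * ?I t)"
  proof -
    have "cross_moment \<Omega> ?X ?X t s = ?I t * ?I s * cross_moment \<Omega> G G t s" for t s
      unfolding cross_moment_def truncated_process_def
      by (subst integral_mult_right_zero[symmetric]) (simp add: mult_ac)
    then show ?thesis unfolding kernel_form_def by (simp add: mult_ac)
  qed
  also have "\<dots> = kernel_form UI d (\<lambda>t. haar j t * ?I t) (\<lambda>t. haar j t * ?I t)"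
    by (rule kernel_form_process)
       (auto intro: borel_measurable_square_integrable square_integrable_times_indicator
           square_integrable_haar)
  finally show ?thesis .
qed

lemma l2norm_truncated_process_square_le: "(l2norm (\<Omega> \<Otimes>\<^sub>M UI) (\<lambda>(\<omega>, t). truncated_process n \<omega> t))\<^sup>2 \<le> C"
proof -
  have Parseval: "(\<lambda>j. (l2norm \<Omega> (\<lambda>\<omega>. \<integral>t. truncated_process n \<omega> t * haar j t \<partial>UI))\<^sup>2) sums
      (l2norm (\<Omega> \<Otimes>\<^sub>M UI) (\<lambda>(\<omega>, t). truncated_process n \<omega> t))\<^sup>2"
    by (rule haar.Parseval_l2norm_sections[OF sigma_finite_measure_axioms
        square_integrable_truncated_process])
  show ?thesis
    unfolding sums_unique[OF Parseval]
    by (rule suminf_le_const[OF sums_summable[OF Parseval]])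
       (unfold l2norm_inner_truncated_process_square, rule trace_bound[OF measurable_bounded_variance_set])
qed

lemma SUP_truncated_process_square:
  "(SUP n. ennreal ((truncated_process n \<omega> t)\<^sup>2)) = ennreal ((G \<omega> t)\<^sup>2)"
proof (rule antisym)
  show "(SUP n. ennreal ((truncated_process n \<omega> t)\<^sup>2)) \<le> ennreal ((G \<omega> t)\<^sup>2)"
    by (rule SUP_least) (auto simp: truncated_process_def split: split_indicator)
  obtain n :: nat where "l2norm \<Omega> (\<lambda>\<omega>. G \<omega> t) \<le> real n" using real_arch_simple by blast
  then have "ennreal ((G \<omega> t)\<^sup>2) = ennreal ((truncated_process n \<omega> t)\<^sup>2)"
    by (simp add: truncated_process_def bounded_variance_set_def)
  also have "\<dots> \<le> (SUP n. ennreal ((truncated_process n \<omega> t)\<^sup>2))" by (rule SUP_upper) simp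
  finally show "ennreal ((G \<omega> t)\<^sup>2) \<le> (SUP n. ennreal ((truncated_process n \<omega> t)\<^sup>2))" .
qed

theorem square_integrable_process: "square_integrable (\<Omega> \<Otimes>\<^sub>M UI) (\<lambda>(\<omega>, t). G \<omega> t)"
proof (rule square_integrable_if_nn_integral_le(1))
  let ?g = "\<lambda>n (\<omega>, t). ennreal ((truncated_process n \<omega> t)\<^sup>2)"
  have C: "0 \<le> C" using order_trans[OF zero_le_power2 l2norm_truncated_process_square_le] .
  then show "0 \<le> sqrt C" by simp
  have incseq: "incseq ?g"
    by (auto simp: incseq_def le_fun_def truncated_process_def bounded_variance_set_def power_mult_distrib
        split: split_indicator)
  have "(\<integral>\<^sup>+p. ennreal ((case p of (\<omega>, t) \<Rightarrow> G \<omega> t)\<^sup>2) \<partial>(\<Omega> \<Otimes>\<^sub>M UI)) = (\<integral>\<^sup>+p. (SUP n. ?g n p) \<partial>(\<Omega> \<Otimes>\<^sub>M UI))"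
    by (simp add: split_beta' SUP_truncated_process_square)
  also have "\<dots> = (SUP n. \<integral>\<^sup>+p. ?g n p \<partial>(\<Omega> \<Otimes>\<^sub>M UI))"
    by (rule nn_integral_monotone_convergence_SUP[OF incseq]) measurable
  also have "\<dots> \<le> ennreal ((sqrt C)\<^sup>2)"
  proof (rule SUP_least)
    fix n
    have "(\<integral>\<^sup>+p. ?g n p \<partial>(\<Omega> \<Otimes>\<^sub>M UI)) = ennreal ((l2norm (\<Omega> \<Otimes>\<^sub>M UI) (\<lambda>(\<omega>, t). truncated_process n \<omega> t))\<^sup>2)"
      using nn_integral_square[OF square_integrable_truncated_process[of n]] by (simp add: split_beta')
    then show "(\<integral>\<^sup>+p. ?g n p \<partial>(\<Omega> \<Otimes>\<^sub>M UI)) \<le> ennreal ((sqrt C)\<^sup>2)"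
      using C l2norm_truncated_process_square_le[of n] by (simp add: ennreal_leI)
  qed
  finally show "(\<integral>\<^sup>+p. ennreal ((case p of (\<omega>, t) \<Rightarrow> G \<omega> t)\<^sup>2) \<partial>(\<Omega> \<Otimes>\<^sub>M UI)) \<le> ennreal ((sqrt C)\<^sup>2)" .
qed simp

text \<open>Averaged over independent uniform points, the quadrature error is of order \<open>1 / sqrt n\<close>, so some
  deterministic choice of points is at least as good.\<close>
lemma quadrature_points:
  fixes h :: "real \<Rightarrow> real" and n :: nat
  assumes h: "h \<in> borel_measurable borel" "\<And>t. \<bar>h t\<bar> \<le> c" and n: "0 < n"
  shows "\<exists>T. (\<forall>k. T k \<in> {0..1}) \<and> l2norm \<Omega> (\<lambda>\<omega>. (\<Sum>k<n. h (T k) / n * G \<omega> (T k)) - (\<integral>t. G \<omega> t * h t \<partial>UI))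
    \<le> (l2norm (\<Omega> \<Otimes>\<^sub>M UI) (\<lambda>(\<omega>, t). G \<omega> t * h t) + 1) / sqrt n"
proof -
  interpret iid: prob_space "iid UI :: (nat \<Rightarrow> real) measure" by (rule UI.prob_space_iid)
  interpret sample: pair_prob_space \<Omega> "iid UI :: (nat \<Rightarrow> real) measure" ..
  let ?Gh = "\<lambda>\<omega> t. G \<omega> t * h t" and ?b = "(l2norm (\<Omega> \<Otimes>\<^sub>M UI) (\<lambda>(\<omega>, t). G \<omega> t * h t) + 1) / sqrt n"
  have Gh: "square_integrable (\<Omega> \<Otimes>\<^sub>M UI) (\<lambda>(\<omega>, t). ?Gh \<omega> t)"
    using square_integrable_times_bounded(1)[OF square_integrable_process, of "\<lambda>(\<omega>, t). h t" c] h
    by (simp add: split_beta')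
  note mean = pair.sample_mean_sections[OF Gh n]
  have less: "l2norm (\<Omega> \<Otimes>\<^sub>M iid UI) (\<lambda>(\<omega>, T). (\<Sum>k<n. ?Gh \<omega> (T k)) / n - (\<integral>t. ?Gh \<omega> t \<partial>UI)) < ?b"
    by (rule le_less_trans[OF mean(2)]) (use n in \<open>simp add: divide_strict_right_mono\<close>)
  have "AE T in iid UI. T k \<in> {0..1}" for k :: nat
  proof -
    have "AE t in distr (iid UI) UI (\<lambda>T. T k). t \<in> {0..1}"
      unfolding UI.distr_iid_component AE_UI_iff by simp
    then show ?thesis by (subst (asm) AE_distr_iff) auto
  qed
  then have unit: "AE T in iid UI. \<forall>k :: nat. T k \<in> {0..1}" by (simp add: AE_all_countable)
  obtain T where "\<forall>k. T k \<in> {0..1}" "l2norm \<Omega> (\<lambda>\<omega>. (\<Sum>k<n. ?Gh \<omega> (T k)) / n - (\<integral>t. ?Gh \<omega> t \<partial>UI)) < ?b"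
    using sample.exists_section_l2norm_less[OF mean(1) less unit] by blast
  then show ?thesis by (intro exI[of _ T]) (simp add: sum_divide_distrib mult_ac)
qed

theorem centred_gaussian_inner:
  fixes h :: "real \<Rightarrow> real"
  assumes h: "h \<in> borel_measurable borel" "\<And>t. \<bar>h t\<bar> \<le> c"
  shows "centred_gaussian \<Omega> (\<lambda>\<omega>. \<integral>t. G \<omega> t * h t \<partial>UI)"
proof -
  let ?X = "\<lambda>\<omega>. \<integral>t. G \<omega> t * h t \<partial>UI" and ?w = "l2norm (\<Omega> \<Otimes>\<^sub>M UI) (\<lambda>(\<omega>, t). G \<omega> t * h t) + 1"
  have h_square_integrable: "square_integrable UI h"
    by (rule UI.square_integrable_if_bounded[OF _ h(2)]) (use h(1) in simp)
  have "\<forall>n. \<exists>T. (\<forall>k. T k \<in> {0..1}) \<and>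
      l2norm \<Omega> (\<lambda>\<omega>. (\<Sum>k<Suc n. h (T k) / Suc n * G \<omega> (T k)) - ?X \<omega>) \<le> ?w / sqrt (Suc n)"
    by (intro allI quadrature_points[OF h]) simp
  from choice[OF this] obtain T where "\<forall>n. (\<forall>k. T n k \<in> {0..1}) \<and>
      l2norm \<Omega> (\<lambda>\<omega>. (\<Sum>k<Suc n. h (T n k) / Suc n * G \<omega> (T n k)) - ?X \<omega>) \<le> ?w / sqrt (Suc n)" ..
  then have T: "T n k \<in> {0..1}"
      "l2norm \<Omega> (\<lambda>\<omega>. (\<Sum>k<Suc n. h (T n k) / Suc n * G \<omega> (T n k)) - ?X \<omega>) \<le> ?w / sqrt (Suc n)" for n k
    by blast+
  show ?thesis
  proof (rule centred_gaussian_limit)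
    show "centred_gaussian \<Omega> (\<lambda>\<omega>. \<Sum>k<Suc n. h (T n k) / Suc n * G \<omega> (T n k))" for n
      by (rule centred_gaussian_sum[OF T(1)])
    show "square_integrable \<Omega> ?X"
      by (rule pair.square_integrable_inner(1)[OF square_integrable_process h_square_integrable])
    show "(\<lambda>n. l2norm \<Omega> (\<lambda>\<omega>. (\<Sum>k<Suc n. h (T n k) / Suc n * G \<omega> (T n k)) - ?X \<omega>)) \<longlonglongrightarrow> 0"
    proof (rule Lim_null_comparison)
      show "(\<lambda>n. ?w / sqrt (Suc n)) \<longlonglongrightarrow> 0"
        by (intro real_tendsto_divide_at_top[OF tendsto_const] filterlim_compose[OF sqrt_at_top]
            filterlim_compose[OF filterlim_real_sequentially filterlim_Suc])
    qed (use T(2) in simp)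
  qed
qed

lemma l2norm_inner_square:
  assumes h: "square_integrable UI h"
  shows "(l2norm \<Omega> (\<lambda>\<omega>. \<integral>t. G \<omega> t * h t \<partial>UI))\<^sup>2 = kernel_form UI d h h"
proof -
  have "(l2norm \<Omega> (\<lambda>\<omega>. \<integral>t. G \<omega> t * h t \<partial>UI))\<^sup>2 = kernel_form UI (cross_moment \<Omega> G G) h h"
    unfolding l2norm_square unfolding power2_eq_square
    by (rule pair.integral_inner_mult_inner[OF square_integrable_process square_integrable_process h h])
  also have "\<dots> = kernel_form UI d h h"
    by (intro kernel_form_process borel_measurable_square_integrable[OF h])
  finally show ?thesis .
qed

end

section \<open>Weakly dependent random fields\<close>

definition coupling_difference :: "((nat \<Rightarrow> 's) \<Rightarrow> 't \<Rightarrow> real) \<Rightarrow> nat \<Rightarrow> (nat \<Rightarrow> 's) \<times> (nat \<Rightarrow> 's) \<Rightarrow> 't \<Rightarrow> real" where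
  "coupling_difference f m p t = f (fst p) t - f (override_on (snd p) (fst p) {..<m}) t"

definition field_coupling_error :: "'t measure \<Rightarrow> 's measure \<Rightarrow> ((nat \<Rightarrow> 's) \<Rightarrow> 't \<Rightarrow> real) \<Rightarrow> nat \<Rightarrow> real" where
  "field_coupling_error U P f m = l2norm ((iid P \<Otimes>\<^sub>M iid P) \<Otimes>\<^sub>M U) (\<lambda>(p, t). coupling_difference f m p t)"

lemma (in prob_space) square_integrable_coupling_difference:
  assumes U: "sigma_finite_measure U" and f: "square_integrable (iid M \<Otimes>\<^sub>M U) (\<lambda>(x, t). f x t)"
  shows "square_integrable ((iid M \<Otimes>\<^sub>M iid M) \<Otimes>\<^sub>M U) (\<lambda>(p, t). coupling_difference f m p t)"
proof -
  interpret past: pair_sigma_finite "iid M :: (nat \<Rightarrow> 'a) measure" U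
    using U by (simp add: pair_sigma_finite_def prob_space_imp_sigma_finite prob_space_iid)
  have "square_integrable ((iid M \<Otimes>\<^sub>M iid M) \<Otimes>\<^sub>M U) (\<lambda>(p, t). f (case p of (x, y) \<Rightarrow> override_on y x J) t)"
      for J
    by (rule past.square_integrable_compose_fst[OF _ distr_iid_override_on f]) measurable
  from square_integrable_diff[OF this[of UNIV] this[of "{..<m}"]] show ?thesis
    by (simp add: coupling_difference_def split_beta' override_on_def[of _ _ UNIV])
qed

locale weakly_dependent_field = orthonormal_basis U e + P: prob_space P
  for U :: "'t measure" and e and P :: "'s measure" +
  fixes f :: "(nat \<Rightarrow> 's) \<Rightarrow> 't \<Rightarrow> real"
  assumes field_square_integrable: "square_integrable (iid P \<Otimes>\<^sub>M U) (\<lambda>(x, t). f x t)"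
    and path_square_integrable: "x \<in> space (iid P) \<Longrightarrow> square_integrable U (f x)"
    and field_mean: "AE t in U. (\<integral>x. f x t \<partial>iid P) = 0"
    and summable_field_coupling_error: "summable (field_coupling_error U P f)"
begin

lemma pair_sigma_finite_iid: "pair_sigma_finite (iid P) U"
  by (simp add: pair_sigma_finite_def prob_space_imp_sigma_finite P.prob_space_iid
      sigma_finite_measure_axioms)

interpretation past: pair_sigma_finite "iid P :: (nat \<Rightarrow> 's) measure" U
  by (rule pair_sigma_finite_iid)

interpretation whole: pair_sigma_finite "iid P :: (int \<Rightarrow> 's) measure" U
  by (rule pair_sigma_finite_iid)

interpretation copies: pair_prob_space "iid P :: (nat \<Rightarrow> 's) measure" "iid P :: (nat \<Rightarrow> 's) measure"
  by (rule P.pair_prob_space_iid)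

interpretation coupled: pair_sigma_finite "(iid P :: (nat \<Rightarrow> 's) measure) \<Otimes>\<^sub>M (iid P :: (nat \<Rightarrow> 's)
    measure)" U ..

lemma square_integrable_coupling_difference:
  "square_integrable ((iid P \<Otimes>\<^sub>M iid P) \<Otimes>\<^sub>M U) (\<lambda>(p, t). coupling_difference f m p t)"
  by (rule P.square_integrable_coupling_difference[OF sigma_finite_measure_axioms field_square_integrable])

definition score :: "('t \<Rightarrow> real) \<Rightarrow> (nat \<Rightarrow> 's) \<Rightarrow> real" where
  "score h x = (\<integral>t. f x t * h t \<partial>U)"

lemma square_integrable_score: "square_integrable U h \<Longrightarrow> square_integrable (iid P) (score h)"
  unfolding score_def[abs_def] by (rule past.square_integrable_inner(1)[OF field_square_integrable])

lemma integral_score: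
  assumes h: "square_integrable U h"
  shows "(\<integral>x. score h x \<partial>iid P) = 0"
proof -
  note [measurable] = borel_measurable_square_integrable[OF h] borel_measurable_square_integrable[OF
      field_square_integrable]
  have "(\<integral>x. 1 * score h x \<partial>iid P) = (\<integral>t. (\<integral>x. 1 * f x t \<partial>iid P) * h t \<partial>U)"
    unfolding score_def
    by (rule past.integral_inner_swap[OF field_square_integrable copies.M1.square_integrable_const h])
  also have "\<dots> = (\<integral>t. 0 \<partial>U)"
  proof (rule integral_cong_AE)
    show "AE t in U. (\<integral>x. 1 * f x t \<partial>iid P) * h t = 0"
      using field_mean by eventually_elim simp
  qed measurable
  finally show ?thesis by simp
qed

lemma inner_coupling_difference:
  assumes h: "square_integrable U h" and p: "p \<in> space (iid P \<Otimes>\<^sub>M iid P)"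
  shows "(\<integral>t. coupling_difference f m p t * h t \<partial>U)
      = score h (fst p) - score h (override_on (snd p) (fst p) {..<m})"
proof -
  have "fst p \<in> space (iid P)" "override_on (snd p) (fst p) {..<m} \<in> space (iid P)"
    using p by (auto simp: space_pair_measure space_PiM PiE_iff override_on_def)
  then show ?thesis
    using integrable_mult[OF path_square_integrable h]
    by (simp add: coupling_difference_def score_def left_diff_distrib)
qed

lemma coupling_error_score:
  assumes h: "square_integrable U h"
  shows "coupling_error P (score h) m
      = l2norm (iid P \<Otimes>\<^sub>M iid P) (\<lambda>p. \<integral>t. coupling_difference f m p t * h t \<partial>U)"
  unfolding coupling_error_def by (intro l2norm_cong) (auto simp: inner_coupling_difference[OF h])

lemma coupling_error_score_le:
  assumes h: "square_integrable U h"
  shows "coupling_error P (score h) m \<le> l2norm U h * field_coupling_error U P f m"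
  unfolding coupling_error_score[OF h] field_coupling_error_def
  by (rule coupled.square_integrable_inner(2)[OF square_integrable_coupling_difference h])

lemma weakly_dependent_score:
  assumes h: "square_integrable U h"
  shows "weakly_dependent P (score h)"
proof
  show "summable (coupling_error P (score h))"
    by (rule summable_comparison_test'[OF summable_mult[OF summable_field_coupling_error, of "l2norm U h"]])
       (use coupling_error_score_le[OF h] in simp)
qed (rule square_integrable_score[OF h] integral_score[OF h])+

lemma coupling_error_score_basis_sums:
  "(\<lambda>j. (coupling_error P (score (e j)) m)\<^sup>2) sums (field_coupling_error U P f m)\<^sup>2"
  unfolding coupling_error_score[OF basis_square_integrable] field_coupling_error_def
  by (rule Parseval_l2norm_sections[OF copies.P.sigma_finite_measure_axioms
      square_integrable_coupling_difference])

definition variance_bound :: "nat \<Rightarrow> real" where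
  "variance_bound j = (coupling_tail P (score (e j)) 0)\<^sup>2"

lemma variance_bound_nonneg: "0 \<le> variance_bound j"
  by (simp add: variance_bound_def)

lemma summable_variance_bound: "summable variance_bound"
proof -
  let ?C = "count_space (UNIV :: nat set)"
  let ?err = "\<lambda>l j. coupling_error P (score (e j)) l" and ?a = "field_coupling_error U P f"
  note sums = coupling_error_score_basis_sums
  have err: "square_integrable ?C (?err l)" for l
    unfolding square_integrable_count_space_nat by (rule sums_summable[OF sums])
  have norm_err: "l2norm ?C (?err l) = ?a l" for l
    unfolding l2norm_count_space_nat[OF sums_summable[OF sums]] sums_unique[OF sums, symmetric]
    by (simp add: field_coupling_error_def)
  have "square_integrable ?C (\<lambda>j. \<Sum>l. ?err l j + ?err (Suc l) j)"
  proof (rule infinite_Minkowski(2))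
    show "square_integrable ?C (\<lambda>j. ?err l j + ?err (Suc l) j)" for l
      by (intro square_integrable_add err)
    show "summable (\<lambda>l. l2norm ?C (\<lambda>j. ?err l j + ?err (Suc l) j))"
    proof (rule summable_comparison_test')
      show "summable (\<lambda>l. ?a l + ?a (Suc l))"
        using summable_field_coupling_error by (intro summable_add) (auto simp: summable_Suc_iff)
      show "norm (l2norm ?C (\<lambda>j. ?err l j + ?err (Suc l) j)) \<le> ?a l + ?a (Suc l)" for l
        using l2norm_add_le[OF err[of l] err[of "Suc l"]] by (simp add: norm_err)
    qed
  qed
  then show ?thesis
    unfolding square_integrable_count_space_nat by (simp add: variance_bound_def[abs_def] coupling_tail_def)
qed

subsection \<open>The long-run covariance kernel\<close>

definition shifted_field :: "int \<Rightarrow> (int \<Rightarrow> 's) \<Rightarrow> 't \<Rightarrow> real" where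
  "shifted_field i x t = f (\<lambda>k. x (i - int k)) t"

lemma shifted_field_eq_shifted: "shifted_field i x t = shifted (\<lambda>y. f y t) i x"
  by (simp add: shifted_field_def shifted_def)

lemma square_integrable_shifted_field: "square_integrable (iid P \<Otimes>\<^sub>M U) (\<lambda>(x, t). shifted_field i x t)"
  unfolding shifted_field_def
  by (rule past.square_integrable_compose_fst[OF P.measurable_past P.distr_past field_square_integrable])

lemma square_integrable_shifted_field_path: "x \<in> space (iid P) \<Longrightarrow> square_integrable U (shifted_field i x)"
  unfolding shifted_field_def[abs_def] by (rule path_square_integrable) (simp add: space_PiM PiE_iff)

lemma inner_shifted_field: "(\<integral>t. shifted_field i x t * h t \<partial>U) = shifted (score h) i x"
  by (simp add: shifted_field_def shifted_def score_def)

definition lag_covariance :: "nat \<Rightarrow> 't \<Rightarrow> 't \<Rightarrow> real" where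
  "lag_covariance k = cross_moment (iid P) (shifted_field 0) (shifted_field (int k))"

definition long_run_covariance :: "'t \<Rightarrow> 't \<Rightarrow> real" where
  "long_run_covariance t s =
    lag_covariance 0 t s + (\<Sum>k. lag_covariance (Suc k) t s) + (\<Sum>k. lag_covariance (Suc k) s t)"

lemma square_integrable_lag_covariance: "square_integrable_kernel U (lag_covariance k)"
  unfolding lag_covariance_def
  by (rule whole.square_integrable_cross_moment[OF square_integrable_shifted_field
      square_integrable_shifted_field])

lemma kernel_form_lag_covariance:
  assumes h: "square_integrable U h"
  shows "kernel_form U (lag_covariance k) h h = autocovariance P (score h) k"
  using whole.integral_inner_mult_inner[OF square_integrable_shifted_field square_integrable_shifted_field
      h h]
  by (simp add: lag_covariance_def autocovariance_def inner_shifted_field)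

lemma l2norm_lag_covariance_le:
  "l2norm (U \<Otimes>\<^sub>M U) (\<lambda>(t, s). lag_covariance k t s)
    \<le> l2norm (iid P \<Otimes>\<^sub>M U) (\<lambda>(x, t). f x t) * field_coupling_error U P f k"
proof -
  note field = past.square_integrable_section_snd[OF field_square_integrable]
  note difference = coupled.square_integrable_section_snd[OF square_integrable_coupling_difference[of k]]
  have "AE t in U. AE s in U. \<bar>lag_covariance k t s\<bar>
      \<le> l2norm (iid P) (\<lambda>x. f x t) * l2norm (iid P \<Otimes>\<^sub>M iid P) (\<lambda>p. coupling_difference f k p s)"
    using field(1)
  proof eventually_elim
    case (elim t)
    show ?case
      using field(1) field_mean
    proof eventually_elim
      case (elim s)
      from P.abs_integral_shifted_mult_le[OF \<open>square_integrable (iid P) (\<lambda>x. f x t)\<close> this, of k]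
      show ?case
        by (simp add: lag_covariance_def cross_moment_def shifted_field_eq_shifted coupling_error_def
            coupling_difference_def split_beta')
    qed
  qed
  from square_integrable_kernel_bound(2)[OF
      borel_measurable_square_integrable[OF square_integrable_lag_covariance]
      field(2) difference(2) this]
  show ?thesis
    unfolding field(3) difference(3) field_coupling_error_def .
qed

lemma summable_l2norm_lag_covariance: "summable (\<lambda>k. l2norm (U \<Otimes>\<^sub>M U) (\<lambda>(t, s). lag_covariance (Suc k) t s))"
proof (rule summable_comparison_test')
  show "summable (\<lambda>k. l2norm (iid P \<Otimes>\<^sub>M U) (\<lambda>(x, t). f x t) * field_coupling_error U P f (Suc k))"
    using summable_field_coupling_error by (intro summable_mult) (simp add: summable_Suc_iff)
qed (use l2norm_lag_covariance_le in simp)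

lemma square_integrable_sum_lag_covariance: "square_integrable_kernel U (\<lambda>t s. \<Sum>k. lag_covariance (Suc k)
    t s)"
  using infinite_Minkowski(2)[OF square_integrable_lag_covariance summable_l2norm_lag_covariance]
  by (simp add: split_beta')

lemma square_integrable_long_run_covariance: "square_integrable_kernel U long_run_covariance"
proof -
  interpret square: pair_sigma_finite U U ..
  show ?thesis
    using square_integrable_add[OF square_integrable_add[OF square_integrable_lag_covariance[of 0]
          square_integrable_sum_lag_covariance]
              square.square_integrable_swap(1)[OF square_integrable_sum_lag_covariance]]
    by (simp add: long_run_covariance_def split_beta')
qed

lemma long_run_covariance_sym: "long_run_covariance t s = long_run_covariance s t"
  by (simp add: long_run_covariance_def lag_covariance_def cross_moment_def mult.commute)

theorem kernel_form_long_run_covariance: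
  assumes h: "square_integrable U h"
  shows "kernel_form U long_run_covariance h h = long_run_variance P (score h)"
proof -
  interpret square: pair_sigma_finite U U ..
  let ?S = "\<lambda>t s. \<Sum>k. lag_covariance (Suc k) t s"
  note S = square_integrable_sum_lag_covariance
  have lag_S: "square_integrable_kernel U (\<lambda>t s. lag_covariance 0 t s + ?S t s)"
    using square_integrable_add[OF square_integrable_lag_covariance S] by (simp add: split_beta')
  have form_S: "kernel_form U ?S h h = (\<Sum>k. autocovariance P (score h) (Suc k))"
    unfolding kernel_form_suminf[OF square_integrable_lag_covariance summable_l2norm_lag_covariance h h]
      kernel_form_lag_covariance[OF h] ..
  have "kernel_form U long_run_covariance h h
      = kernel_form U (lag_covariance 0) h h + kernel_form U ?S h h + kernel_form U (\<lambda>t s. ?S s t) h h"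
    unfolding long_run_covariance_def[abs_def]
      kernel_form_add[OF lag_S square.square_integrable_swap(1)[OF S] h h]
      kernel_form_add[OF square_integrable_lag_covariance S h h] ..
  then show ?thesis
    unfolding kernel_form_swap[OF S h h] form_S kernel_form_lag_covariance[OF h] long_run_variance_def by simp
qed

subsection \<open>The normalized sums of a field\<close>

definition normalized_field :: "nat \<Rightarrow> (int \<Rightarrow> 's) \<Rightarrow> 't \<Rightarrow> real" where
  "normalized_field N x t = (\<Sum>i=1..int N. shifted_field i x t) / sqrt (real N)"

lemma square_integrable_normalized_field: "square_integrable (iid P \<Otimes>\<^sub>M U) (\<lambda>(x, t). normalized_field N x t)"
  using square_integrable_divide[OF square_integrable_sum[OF square_integrable_shifted_field]]
  by (simp add: normalized_field_def split_beta')

lemma square_integrable_normalized_field_path: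
  "x \<in> space (iid P) \<Longrightarrow> square_integrable U (normalized_field N x)"
  unfolding normalized_field_def[abs_def]
  by (intro square_integrable_divide square_integrable_sum square_integrable_shifted_field_path)

lemma inner_normalized_field:
  assumes x: "x \<in> space (iid P)" and h: "square_integrable U h"
  shows "(\<integral>t. normalized_field N x t * h t \<partial>U) = normalized_sum (score h) N x"
proof -
  have "(\<integral>t. normalized_field N x t * h t \<partial>U)
      = (\<integral>t. (\<Sum>i=1..int N. shifted_field i x t * h t) / sqrt (real N) \<partial>U)"
    by (simp add: normalized_field_def sum_distrib_right)
  then show ?thesis
    using integrable_mult[OF square_integrable_shifted_field_path[OF x] h]
    by (simp add: normalized_sum_def inner_shifted_field)
qed

lemma l2norm_normalized_sum_score_square_le:
  "(l2norm (iid P) (normalized_sum (score (e j)) N))\<^sup>2 \<le> variance_bound j"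
  unfolding variance_bound_def
  by (intro power_mono weakly_dependent.l2norm_normalized_sum_le weakly_dependent_score
      basis_square_integrable) simp

lemma l2norm_normalized_field_square_le:
  "(l2norm (iid P \<Otimes>\<^sub>M U) (\<lambda>(x, t). normalized_field N x t))\<^sup>2 \<le> suminf variance_bound"
proof -
  have "l2norm (iid P) (\<lambda>x. \<integral>t. normalized_field N x t * e j t \<partial>U)
      = l2norm (iid P) (normalized_sum (score (e j)) N)" for j
    by (intro l2norm_cong inner_normalized_field basis_square_integrable)
  then have sums: "(\<lambda>j. (l2norm (iid P) (normalized_sum (score (e j)) N))\<^sup>2)
      sums (l2norm (iid P \<Otimes>\<^sub>M U) (\<lambda>(x, t). normalized_field N x t))\<^sup>2"
    using Parseval_l2norm_sections[OF whole.M1.sigma_finite_measure_axioms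
        square_integrable_normalized_field[of N]]
    by simp
  show ?thesis
    unfolding sums_unique[OF sums]
    by (rule suminf_le[OF l2norm_normalized_sum_score_square_le sums_summable[OF sums]
        summable_variance_bound])
qed

lemma sum_l2norm_truncated_score_le:
  assumes A: "A \<in> sets U"
  shows "(\<Sum>j<J. (l2norm (iid P) (normalized_sum (score (\<lambda>t. e j t * indicator A t)) N))\<^sup>2)
      \<le> suminf variance_bound"
proof -
  let ?X = "\<lambda>x t. normalized_field N x t * indicator A t"
  have "square_integrable (iid P \<Otimes>\<^sub>M U) (\<lambda>p. (case p of (x, t) \<Rightarrow> normalized_field N x t) * indicator A
    (snd p))"
      "l2norm (iid P \<Otimes>\<^sub>M U) (\<lambda>p. (case p of (x, t) \<Rightarrow> normalized_field N x t) * indicator A (snd p))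
        \<le> 1 * l2norm (iid P \<Otimes>\<^sub>M U) (\<lambda>(x, t). normalized_field N x t)"
    by (rule square_integrable_times_bounded[OF square_integrable_normalized_field, where c = 1];
        use A in \<open>simp split: split_indicator\<close>)+
  then have X: "square_integrable (iid P \<Otimes>\<^sub>M U) (\<lambda>(x, t). ?X x t)"
      "l2norm (iid P \<Otimes>\<^sub>M U) (\<lambda>(x, t). ?X x t) \<le> l2norm (iid P \<Otimes>\<^sub>M U) (\<lambda>(x, t). normalized_field N x t)"
    by (simp_all add: split_beta')
  have "l2norm (iid P) (\<lambda>x. \<integral>t. ?X x t * e j t \<partial>U)
      = l2norm (iid P) (normalized_sum (score (\<lambda>t. e j t * indicator A t)) N)" for j
    using inner_normalized_field[OF _ square_integrable_times_indicator[OF basis_square_integrable A]]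
    by (intro l2norm_cong) (simp add: mult_ac)
  then have sums: "(\<lambda>j. (l2norm (iid P) (normalized_sum (score (\<lambda>t. e j t * indicator A t)) N))\<^sup>2)
      sums (l2norm (iid P \<Otimes>\<^sub>M U) (\<lambda>(x, t). ?X x t))\<^sup>2"
    using Parseval_l2norm_sections[OF whole.M1.sigma_finite_measure_axioms X(1)] by simp
  have "(\<Sum>j<J. (l2norm (iid P) (normalized_sum (score (\<lambda>t. e j t * indicator A t)) N))\<^sup>2)
      \<le> (l2norm (iid P \<Otimes>\<^sub>M U) (\<lambda>(x, t). ?X x t))\<^sup>2"
    unfolding sums_unique[OF sums] by (rule sum_le_suminf[OF sums_summable[OF sums]]) auto
  also have "\<dots> \<le> (l2norm (iid P \<Otimes>\<^sub>M U) (\<lambda>(x, t). normalized_field N x t))\<^sup>2"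
    by (rule power_mono[OF X(2)]) simp
  also note l2norm_normalized_field_square_le
  finally show ?thesis .
qed

theorem trace_long_run_covariance_le:
  assumes A: "A \<in> sets U"
  shows "(\<Sum>j<J. kernel_form U long_run_covariance (\<lambda>t. e j t * indicator A t) (\<lambda>t. e j t * indicator A t))
    \<le> suminf variance_bound"
proof (rule LIMSEQ_le_const2)
  note h = square_integrable_times_indicator[OF basis_square_integrable A]
  show "(\<lambda>N. \<Sum>j<J. (l2norm (iid P) (normalized_sum (score (\<lambda>t. e j t * indicator A t)) N))\<^sup>2)
      \<longlonglongrightarrow> (\<Sum>j<J. kernel_form U long_run_covariance (\<lambda>t. e j t * indicator A t) (\<lambda>t. e j t * indicator A t))"
    unfolding kernel_form_long_run_covariance[OF h]
    by (intro tendsto_sum weakly_dependent.l2norm_normalized_sum_square_tendsto weakly_dependent_score h)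
qed (use sum_l2norm_truncated_score_le[OF A] in blast)

lemma kernel_form_long_run_covariance_nonneg:
  "square_integrable U h \<Longrightarrow> 0 \<le> kernel_form U long_run_covariance h h"
  by (simp add: kernel_form_long_run_covariance weakly_dependent.long_run_variance_nonneg
      weakly_dependent_score)

theorem scaled_normalized_sum_CLT:
  assumes h: "square_integrable U h" and N: "filterlim N at_top sequentially" and c: "c \<longlonglongrightarrow> c0"
  shows "(\<lambda>k. char (distr (iid P) borel (\<lambda>x. c k * normalized_sum (score h) (N k) x)) u)
    \<longlonglongrightarrow> complex_of_real (exp (- (u\<^sup>2 * (c0\<^sup>2 * kernel_form U long_run_covariance h h)) / 2))"
proof (rule prob_space.char_scaled_tendsto[OF P.prob_space_iid _ _ c])
  interpret weakly_dependent P "score h" by (rule weakly_dependent_score[OF h])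
  show "square_integrable (iid P) (normalized_sum (score h) (N k))" for k
    by (rule square_integrable_normalized_sum)
  show "l2norm (iid P) (normalized_sum (score h) (N k)) \<le> coupling_tail P (score h) 0" for k
    by (rule l2norm_normalized_sum_le)
  show "(\<lambda>k. char (distr (iid P) borel (normalized_sum (score h) (N k))) (u * c0))
      \<longlonglongrightarrow> complex_of_real (exp (- (u\<^sup>2 * (c0\<^sup>2 * kernel_form U long_run_covariance h h)) / 2))"
    using filterlim_compose[OF normalized_sum_CLT[of "u * c0"] N]
    by (simp add: kernel_form_long_run_covariance[OF h] power_mult_distrib mult.assoc)
qed

end

section \<open>Errors given by Bernoulli shifts\<close>

locale bernoulli_errors = prob_space M for M :: "'a measure" +
  fixes S :: "'s measure" and \<delta> :: "int \<Rightarrow> 'a \<Rightarrow> 's" and f :: "(nat \<Rightarrow> 's) \<Rightarrow> real \<Rightarrow> real"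
    and eps :: "int \<Rightarrow> 'a \<Rightarrow> real \<Rightarrow> real"
  assumes error_assumptions: "error_assumptions M S \<delta> f eps"
begin

lemma bernoulli_shift: "bernoulli_shift M S \<delta> f eps"
  using error_assumptions by (simp add: error_assumptions_def)

lemma indep_innovations: "indep_vars (\<lambda>_. S) \<delta> UNIV"
  using bernoulli_shift by (simp add: bernoulli_shift_def)

lemma measurable_innovation[measurable]: "\<delta> i \<in> M \<rightarrow>\<^sub>M S"
  using indep_innovations by (simp add: indep_vars_def)

definition innovation_law :: "'s measure" where
  "innovation_law = distr M S (\<delta> 0)"

lemma distr_innovation: "distr M S (\<delta> i) = innovation_law"
  using bernoulli_shift unfolding bernoulli_shift_def innovation_law_def by blast

lemma sets_innovation_law: "sets innovation_law = sets S"
  by (simp add: innovation_law_def)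

lemma sets_iid_innovation_law: "sets (iid innovation_law) = sets (iid S)"
  by (intro sets_PiM_cong refl sets_innovation_law)

lemma prob_space_innovation_law: "prob_space innovation_law"
  unfolding innovation_law_def by (rule prob_space_distr) simp

end

sublocale bernoulli_errors \<subseteq> law: prob_space innovation_law
  by (rule prob_space_innovation_law)

context bernoulli_errors
begin

interpretation past: prob_space "iid innovation_law :: (nat \<Rightarrow> 's) measure"
  by (rule law.prob_space_iid)

interpretation past_UI: pair_prob_space "iid innovation_law :: (nat \<Rightarrow> 's) measure" UI ..

lemma measurable_f[measurable]: "(\<lambda>(x, t). f x t) \<in> borel_measurable (iid innovation_law \<Otimes>\<^sub>M UI)"
proof -
  have "(\<lambda>(x, t). f x t) \<in> borel_measurable (iid S \<Otimes>\<^sub>M lborel)"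
    using bernoulli_shift by (simp add: bernoulli_shift_def)
  moreover have "sets (iid S \<Otimes>\<^sub>M lborel) = sets (iid innovation_law \<Otimes>\<^sub>M UI)"
    by (intro sets_pair_measure_cong) (simp_all add: sets_iid_innovation_law)
  ultimately show ?thesis using measurable_cong_sets[OF _ refl] by blast
qed

lemma measurable_f_at[measurable]: "(\<lambda>x. f x t) \<in> borel_measurable (iid innovation_law)"
  using measurable_compose[OF measurable_Pair2'[of t UI] measurable_f] by simp

lemma f_path_square_integrable: "x \<in> space (iid innovation_law) \<Longrightarrow> square_integrable UI (f x)"
  using bernoulli_shift
  unfolding bernoulli_shift_def L2_iff_square_integrable_UI
      sets_eq_imp_space_eq[OF sets_iid_innovation_law] by blast

definition innovations :: "'a \<Rightarrow> int \<Rightarrow> 's" where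
  "innovations \<omega> = (\<lambda>i. \<delta> i \<omega>)"

lemma measurable_innovations[measurable]: "innovations \<in> M \<rightarrow>\<^sub>M iid innovation_law"
  by (rule measurable_iidI)
     (simp only: innovations_def measurable_cong_sets[OF refl sets_innovation_law] measurable_innovation)

lemma distr_innovations: "distr M (iid innovation_law) innovations = iid innovation_law"
proof -
  have "distr M (iid S) (\<lambda>\<omega>. \<lambda>i\<in>UNIV. \<delta> i \<omega>) = PiM UNIV (\<lambda>i. distr M S (\<delta> i))"
    using indep_innovations by (subst indep_vars_iff_distr_eq_PiM[symmetric]) auto
  then have "distr M (iid S) innovations = iid innovation_law"
    by (simp add: distr_innovation innovations_def[abs_def] restrict_UNIV)
  moreover have "distr M (iid S) innovations = distr M (iid innovation_law) innovations"
    by (rule distr_cong) (simp_all add: sets_iid_innovation_law)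
  ultimately show ?thesis by simp
qed

lemma distr_comp_innovations:
  assumes [measurable]: "F \<in> borel_measurable (iid innovation_law)"
  shows "distr M borel (\<lambda>\<omega>. F (innovations \<omega>)) = distr (iid innovation_law) borel F"
  using distr_distr[OF assms measurable_innovations] by (simp add: distr_innovations comp_def)

lemma eps_eq: "\<omega> \<in> space M \<Longrightarrow> eps i \<omega> = f (\<lambda>k. innovations \<omega> (i - int k))"
  using bernoulli_shift unfolding bernoulli_shift_def innovations_def by blast

lemma measurable_past_innovations[measurable]: "(\<lambda>\<omega> k. innovations \<omega> (i - int k)) \<in> M \<rightarrow>\<^sub>M iid innovation_law"
  by measurable

lemma distr_past_innovations:
  "distr M (iid innovation_law) (\<lambda>\<omega> k. innovations \<omega> (i - int k)) = iid innovation_law"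
  using distr_distr[OF law.measurable_past measurable_innovations, of i]
  by (simp add: distr_innovations law.distr_past comp_def)

lemma nn_integral_eps_square: "(\<integral>\<^sup>+\<omega>. ennreal ((eps 0 \<omega> t)\<^sup>2) \<partial>M)
    = (\<integral>\<^sup>+x. ennreal ((f x t)\<^sup>2) \<partial>iid innovation_law)"
proof -
  have "(\<integral>\<^sup>+\<omega>. ennreal ((eps 0 \<omega> t)\<^sup>2) \<partial>M) = (\<integral>\<^sup>+\<omega>. ennreal ((f (\<lambda>k. innovations \<omega> (0 - int k)) t)\<^sup>2) \<partial>M)"
    by (intro nn_integral_cong) (simp only: eps_eq)
  also have "\<dots> = (\<integral>\<^sup>+x. ennreal ((f x t)\<^sup>2) \<partial>distr M (iid innovation_law) (\<lambda>\<omega> k. innovations \<omega> (0 - int k)))"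
    by (rule nn_integral_distr[symmetric, OF measurable_past_innovations]) (unfold measurable_distr_eq1,
        measurable)
  finally show ?thesis unfolding distr_past_innovations .
qed

lemma f_square_integrable: "square_integrable (iid innovation_law \<Otimes>\<^sub>M UI) (\<lambda>(x, t). f x t)"
proof -
  have "(\<integral>\<^sup>+p. ennreal ((case p of (x, t) \<Rightarrow> f x t)\<^sup>2) \<partial>(iid innovation_law \<Otimes>\<^sub>M UI))
      = (\<integral>\<^sup>+t. \<integral>\<^sup>+x. ennreal ((f x t)\<^sup>2) \<partial>iid innovation_law \<partial>UI)"
    by (subst past_UI.nn_integral_snd[symmetric]) (auto simp: split_beta')
  also have "\<dots> = (\<integral>\<^sup>+t. indicator {0..1} t * (\<integral>\<^sup>+\<omega>. ennreal ((eps 0 \<omega> t)\<^sup>2) \<partial>M) \<partial>lborel)"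
    unfolding nn_integral_eps_square by (rule nn_integral_UI) (simp cong: measurable_cong_sets)
  also have "\<dots> < \<infinity>" using error_assumptions by (simp add: error_assumptions_def)
  finally show ?thesis
    unfolding square_integrable_def by (auto intro!: integrableI_nonneg)
qed

lemma approx_err_eq: "approx_err innovation_law f m = ennreal ((field_coupling_error UI innovation_law f m)\<^sup>2)"
proof -
  note difference = law.square_integrable_coupling_difference[OF UI.sigma_finite_measure_axioms
      f_square_integrable, of m]
  have "approx_err innovation_law f m = (\<integral>\<^sup>+x. \<integral>\<^sup>+y. \<integral>\<^sup>+t. ennreal ((coupling_difference f m (x, y) t)\<^sup>2) \<partial>UI
      \<partial>iid innovation_law \<partial>iid innovation_law)"
    unfolding approx_err_def
  proof (intro nn_integral_cong)
    fix x y :: "nat \<Rightarrow> 's" assume "x \<in> space (iid innovation_law)" "y \<in> space (iid innovation_law)"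
    then have "coupling_difference f m (x, y) \<in> borel_measurable UI"
      using measurable_Pair2[OF borel_measurable_square_integrable[OF difference], of "(x, y)"]
      by (simp add: space_pair_measure)
    then have [measurable]: "coupling_difference f m (x, y) \<in> borel_measurable borel"
      by (simp only: measurable_cong_sets[OF sets_UI refl])
    have "f x t - f (\<lambda>k. if k < m then x k else y k) t = coupling_difference f m (x, y) t" for t
      by (simp add: coupling_difference_def override_on_def)
    then show "(\<integral>\<^sup>+t. indicator {0..1} t * ennreal ((f x t - f (\<lambda>k. if k < m then x k else y k) t)\<^sup>2) \<partial>lborel)
        = (\<integral>\<^sup>+t. ennreal ((coupling_difference f m (x, y) t)\<^sup>2) \<partial>UI)"
      by (simp only:) (rule nn_integral_UI[symmetric], measurable)
  qed
  also
  note [measurable] = borel_measurable_square_integrable[OF difference]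
  have "\<dots> = (\<integral>\<^sup>+p. \<integral>\<^sup>+t. ennreal ((coupling_difference f m p t)\<^sup>2) \<partial>UI \<partial>(iid innovation_law \<Otimes>\<^sub>M iid
      innovation_law))"
    by (rule past.nn_integral_fst) measurable
  also have "\<dots> = (\<integral>\<^sup>+q. ennreal ((case q of (p, t) \<Rightarrow> coupling_difference f m p t)\<^sup>2)
      \<partial>((iid innovation_law \<Otimes>\<^sub>M iid innovation_law) \<Otimes>\<^sub>M UI))"
    by (subst UI.nn_integral_fst[symmetric]) auto
  finally show ?thesis
    unfolding nn_integral_square[OF difference] field_coupling_error_def .
qed

lemma summable_field_coupling_error: "summable (field_coupling_error UI innovation_law f)"
proof -
  have "summable (\<lambda>m. sqrt (enn2real (approx_err innovation_law f (Suc m))))"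
    using error_assumptions unfolding error_assumptions_def innovation_law_def by blast
  then have "summable (\<lambda>m. field_coupling_error UI innovation_law f (Suc m))"
    by (simp add: approx_err_eq field_coupling_error_def)
  then show ?thesis by (simp add: summable_Suc_iff)
qed

lemma f_mean: "AE t in UI. (\<integral>x. f x t \<partial>iid innovation_law) = 0"
proof -
  have "expectation (\<lambda>\<omega>. eps 0 \<omega> t) = (\<integral>x. f x t \<partial>iid innovation_law)" for t
  proof -
    have "expectation (\<lambda>\<omega>. eps 0 \<omega> t) = expectation (\<lambda>\<omega>. f (\<lambda>k. innovations \<omega> (0 - int k)) t)"
      by (intro Bochner_Integration.integral_cong) (simp_all only: eps_eq)
    also have "\<dots> = (\<integral>x. f x t \<partial>distr M (iid innovation_law) (\<lambda>\<omega> k. innovations \<omega> (0 - int k)))"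
      by (rule integral_distr[symmetric, OF measurable_past_innovations]) measurable
    finally show ?thesis unfolding distr_past_innovations .
  qed
  then show ?thesis
    using error_assumptions unfolding error_assumptions_def AE_UI_iff by simp
qed

end

sublocale bernoulli_errors \<subseteq> field: weakly_dependent_field UI haar innovation_law f
  by unfold_locales (rule f_square_integrable f_path_square_integrable f_mean
      summable_field_coupling_error; assumption?)+

context bernoulli_errors
begin

lemma eps_eq_shifted_field: "\<omega> \<in> space M \<Longrightarrow> eps i \<omega> = field.shifted_field i (innovations \<omega>)"
  by (simp add: eps_eq field.shifted_field_def fun_eq_iff)

lemma eps_square_integrable: "\<omega> \<in> space M \<Longrightarrow> square_integrable UI (eps i \<omega>)"
  unfolding eps_eq by (rule f_path_square_integrable[OF measurable_space[OF measurable_past_innovations]])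

lemma lrcov_eq_long_run_covariance: "lrcov M eps = field.long_run_covariance"
proof (intro ext)
  have lag: "expectation (\<lambda>\<omega>. eps 0 \<omega> t * eps (int k) \<omega> s) = field.lag_covariance k t s" for k t s
  proof -
    have [measurable]: "(\<lambda>x. field.shifted_field i x r) \<in> borel_measurable (iid innovation_law)" for i r
      unfolding field.shifted_field_def by measurable
    have "expectation (\<lambda>\<omega>. eps 0 \<omega> t * eps (int k) \<omega> s)
        = expectation (\<lambda>\<omega>. field.shifted_field 0 (innovations \<omega>) t * field.shifted_field (int k)
          (innovations \<omega>) s)"
      by (intro Bochner_Integration.integral_cong) (simp_all only: eps_eq_shifted_field)
    also have "\<dots> = (\<integral>x. field.shifted_field 0 x t * field.shifted_field (int k) x s
        \<partial>distr M (iid innovation_law) innovations)"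
      by (rule integral_distr[symmetric, OF measurable_innovations]) measurable
    finally show ?thesis unfolding distr_innovations field.lag_covariance_def cross_moment_def .
  qed
  show "lrcov M eps t s = field.long_run_covariance t s" for t s
    using lag[of t 0 s] lag[of t "Suc _" s] lag[of s "Suc _" t]
    by (simp add: lrcov_def field.long_run_covariance_def add.commute)
qed

definition normalized_error :: "nat \<Rightarrow> 'a \<Rightarrow> real \<Rightarrow> real" where
  "normalized_error N \<omega> = field.normalized_field N (innovations \<omega>)"

definition error_coefficient :: "(real \<Rightarrow> real) \<Rightarrow> nat \<Rightarrow> 'a \<Rightarrow> real" where
  "error_coefficient h N \<omega> = normalized_sum (field.score h) N (innovations \<omega>)"

lemma normalized_error_eq: "\<omega> \<in> space M \<Longrightarrow> normalized_error N \<omega> t = (\<Sum>i=1..int N. eps i \<omega> t) / sqrt (real N)"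
  by (simp add: normalized_error_def field.normalized_field_def eps_eq_shifted_field)

lemma square_integrable_normalized_error: "square_integrable (M \<Otimes>\<^sub>M UI) (\<lambda>(\<omega>, t). normalized_error N \<omega> t)"
proof -
  interpret whole: pair_sigma_finite "iid innovation_law :: (int \<Rightarrow> 's) measure" UI
    by (rule field.pair_sigma_finite_iid)
  show ?thesis
    unfolding normalized_error_def
    by (rule whole.square_integrable_compose_fst[OF measurable_innovations distr_innovations
          field.square_integrable_normalized_field])
qed

lemma square_integrable_normalized_error_path: "\<omega> \<in> space M \<Longrightarrow> square_integrable UI (normalized_error N \<omega>)"
  unfolding normalized_error_def
  by (rule field.square_integrable_normalized_field_path[OF measurable_space[OF measurable_innovations]])

lemma inner_normalized_error:
  "\<omega> \<in> space M \<Longrightarrow> square_integrable UI h \<Longrightarrow> (\<integral>t. normalized_error N \<omega> t * h t \<partial>UI) = error_coefficient h N \<omega>"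
  unfolding normalized_error_def error_coefficient_def
  by (rule field.inner_normalized_field[OF measurable_space[OF measurable_innovations]])

lemma square_integrable_error_coefficient:
  assumes h: "square_integrable UI h"
  shows "square_integrable M (error_coefficient h N)"
    and "l2norm M (error_coefficient h N) = l2norm (iid innovation_law) (normalized_sum (field.score h) N)"
  using square_integrable_distr[OF measurable_innovations distr_innovations
      weakly_dependent.square_integrable_normalized_sum[OF field.weakly_dependent_score[OF h]]]
  unfolding error_coefficient_def[abs_def] .

lemma l2norm_error_coefficient_haar_square_le: "(l2norm M (error_coefficient (haar j) N))\<^sup>2
    \<le> field.variance_bound j"
  unfolding square_integrable_error_coefficient(2)[OF square_integrable_haar]
  by (rule field.l2norm_normalized_sum_score_square_le)

lemma error_coefficient_eq:
  assumes \<omega>: "\<omega> \<in> space M" and h: "h \<in> L2"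
  shows "error_coefficient h N \<omega> = (\<Sum>i=1..int N. LINT t:{0..1}|lborel. eps i \<omega> t * h t) / sqrt (real N)"
proof -
  have "(\<lambda>t. eps i \<omega> t * h t) \<in> borel_measurable UI" for i
    using eps_square_integrable[OF \<omega>] h
    by (intro borel_measurable_integrable integrable_mult) (simp_all add: L2_iff_square_integrable_UI)
  then have "(\<integral>t. eps i \<omega> t * h t \<partial>UI) = (LINT t:{0..1}|lborel. eps i \<omega> t * h t)" for i
    by (intro integral_UI) (simp cong: measurable_cong_sets)
  then show ?thesis
    by (simp add: error_coefficient_def normalized_sum_def field.inner_shifted_field[symmetric]
        eps_eq_shifted_field[OF \<omega>])
qed

theorem scaled_error_coefficient_CLT:
  assumes h: "square_integrable UI h" and N: "filterlim N at_top sequentially" and c: "c \<longlonglongrightarrow> c0"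
  shows "(\<lambda>k. char (distr M borel (\<lambda>\<omega>. c k * error_coefficient h (N k) \<omega>)) u)
    \<longlonglongrightarrow> complex_of_real (exp (- (u\<^sup>2 * (c0\<^sup>2 * kernel_form UI (lrcov M eps) h h)) / 2))"
proof -
  note [measurable] = borel_measurable_square_integrable[OF
      weakly_dependent.square_integrable_normalized_sum[OF field.weakly_dependent_score[OF h]]]
  have "distr M borel (\<lambda>\<omega>. c k * error_coefficient h (N k) \<omega>)
      = distr (iid innovation_law) borel (\<lambda>x. c k * normalized_sum (field.score h) (N k) x)" for k
    unfolding error_coefficient_def by (rule distr_comp_innovations) measurable
  then show ?thesis
    using field.scaled_normalized_sum_CLT[OF assms] by (simp add: lrcov_eq_long_run_covariance)
qed

lemma square_integrable_lrcov: "square_integrable_kernel UI (lrcov M eps)"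
  unfolding lrcov_eq_long_run_covariance by (rule field.square_integrable_long_run_covariance)

lemma lrcov_sym: "lrcov M eps t s = lrcov M eps s t"
  unfolding lrcov_eq_long_run_covariance by (rule field.long_run_covariance_sym)

lemma kernel_form_lrcov_nonneg: "square_integrable UI h \<Longrightarrow> 0 \<le> kernel_form UI (lrcov M eps) h h"
  unfolding lrcov_eq_long_run_covariance by (rule field.kernel_form_long_run_covariance_nonneg)

lemma trace_lrcov_le:
  "A \<in> sets borel \<Longrightarrow> (\<Sum>j<J. kernel_form UI (lrcov M eps) (\<lambda>t. haar j t * indicator A t) (\<lambda>t. haar j t *
      indicator A t))
    \<le> suminf field.variance_bound"
  unfolding lrcov_eq_long_run_covariance by (rule field.trace_long_run_covariance_le) simp

end

section \<open>The two-sample statistic\<close>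

lemma sum_haar_bounded: "\<exists>c. \<forall>t. \<bar>\<Sum>j<n. a j * haar j t\<bar> \<le> c"
proof -
  have "\<forall>j. \<exists>c. \<forall>t. \<bar>haar j t\<bar> \<le> c" by (intro allI) (rule haar_bounded, blast)
  from choice[OF this] obtain c where c: "\<forall>j t. \<bar>haar j t\<bar> \<le> c j" ..
  have "\<bar>\<Sum>j<n. a j * haar j t\<bar> \<le> (\<Sum>j<n. \<bar>a j\<bar> * c j)" for t
    by (rule order_trans[OF sum_abs sum_mono]) (use c in \<open>simp add: abs_mult mult_left_mono\<close>)
  then show ?thesis by blast
qed

lemma sum_haar_L2: "(\<lambda>t. \<Sum>j<n. a j * haar j t) \<in> L2"
  unfolding L2_iff_square_integrable_UI
  by (intro square_integrable_sum square_integrable_cmult square_integrable_haar)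

locale two_sample = X: bernoulli_errors M S \<delta> f eps + Y: bernoulli_errors M Ss \<delta>s fs eps_s
  for M :: "'a measure"
    and S :: "'s measure" and \<delta> :: "int \<Rightarrow> 'a \<Rightarrow> 's" and f :: "(nat \<Rightarrow> 's) \<Rightarrow> real \<Rightarrow> real"
    and eps :: "int \<Rightarrow> 'a \<Rightarrow> real \<Rightarrow> real"
    and Ss :: "'t measure" and \<delta>s :: "int \<Rightarrow> 'a \<Rightarrow> 't" and fs :: "(nat \<Rightarrow> 't) \<Rightarrow> real \<Rightarrow> real"
    and eps_s :: "int \<Rightarrow> 'a \<Rightarrow> real \<Rightarrow> real" +
  fixes \<theta> :: real
  assumes indep: "prob_space.indep_var M
           (PiM ({1..} \<times> L2) (\<lambda>_. borel))
           (\<lambda>\<omega>. \<lambda>p\<in>{1..} \<times> L2. LINT t:{0..1}|lborel. eps (fst p) \<omega> t * snd p t)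
           (PiM ({1..} \<times> L2) (\<lambda>_. borel))
           (\<lambda>\<omega>. \<lambda>p\<in>{1..} \<times> L2. LINT t:{0..1}|lborel. eps_s (fst p) \<omega> t * snd p t)"
    and \<theta>: "0 \<le> \<theta>" "\<theta> \<le> 1"
begin

interpretation sample_UI: pair_prob_space M UI ..

subsection \<open>The limiting covariance\<close>

definition limit_covariance :: "real \<Rightarrow> real \<Rightarrow> real" where
  "limit_covariance t s = (1 - \<theta>) * lrcov M eps t s + \<theta> * lrcov M eps_s t s"

lemma square_integrable_scaled_lrcov:
  "square_integrable_kernel UI (\<lambda>t s. c * lrcov M eps t s)"
  "square_integrable_kernel UI (\<lambda>t s. c * lrcov M eps_s t s)"
  using square_integrable_cmult[OF X.square_integrable_lrcov, of c]
      square_integrable_cmult[OF Y.square_integrable_lrcov, of c]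
  by (simp_all add: split_beta')

lemma square_integrable_limit_covariance: "square_integrable_kernel UI limit_covariance"
  using square_integrable_add[OF square_integrable_scaled_lrcov]
  by (simp add: limit_covariance_def split_beta')

lemma limit_covariance_sym: "limit_covariance t s = limit_covariance s t"
  by (simp only: limit_covariance_def X.lrcov_sym[of t s] Y.lrcov_sym[of t s])

lemma kernel_form_limit_covariance:
  assumes h: "square_integrable UI h"
  shows "kernel_form UI limit_covariance h h
    = (1 - \<theta>) * kernel_form UI (lrcov M eps) h h + \<theta> * kernel_form UI (lrcov M eps_s) h h"
  unfolding limit_covariance_def[abs_def] UI.kernel_form_add[OF square_integrable_scaled_lrcov h h]
      kernel_form_cmult ..

lemma kernel_form_limit_covariance_nonneg: "square_integrable UI h \<Longrightarrow> 0 \<le> kernel_form UI limit_covariance h h"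
  using \<theta> by (simp add: kernel_form_limit_covariance X.kernel_form_lrcov_nonneg Y.kernel_form_lrcov_nonneg)

definition total_variance :: real where
  "total_variance = suminf X.field.variance_bound + suminf Y.field.variance_bound"

lemma trace_limit_covariance_le:
  assumes A: "A \<in> sets borel"
  shows "(\<Sum>j<J. kernel_form UI limit_covariance (\<lambda>t. haar j t * indicator A t) (\<lambda>t. haar j t * indicator A t))
    \<le> total_variance"
proof -
  let ?h = "\<lambda>j t. haar j t * indicator A t"
  have h: "square_integrable UI (?h j)" for j
    by (rule square_integrable_times_indicator[OF square_integrable_haar]) (simp add: A)
  have nonneg: "0 \<le> suminf X.field.variance_bound" "0 \<le> suminf Y.field.variance_bound"
    by (intro suminf_nonneg X.field.summable_variance_bound X.field.variance_bound_nonneg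
        Y.field.summable_variance_bound Y.field.variance_bound_nonneg)+
  have "(\<Sum>j<J. kernel_form UI limit_covariance (?h j) (?h j))
      = (1 - \<theta>) * (\<Sum>j<J. kernel_form UI (lrcov M eps) (?h j) (?h j))
        + \<theta> * (\<Sum>j<J. kernel_form UI (lrcov M eps_s) (?h j) (?h j))"
    unfolding kernel_form_limit_covariance[OF h] sum.distrib sum_distrib_left ..
  also have "\<dots> \<le> (1 - \<theta>) * suminf X.field.variance_bound + \<theta> * suminf Y.field.variance_bound"
    using \<theta> by (intro add_mono mult_left_mono X.trace_lrcov_le[OF A] Y.trace_lrcov_le[OF A]) auto
  also have "\<dots> \<le> total_variance"
    unfolding total_variance_def using \<theta> nonneg by (intro add_mono mult_left_le_one_le) auto
  finally show ?thesis .
qed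

lemma limit_process_exists: "\<exists>G. gaussian_process gauss_seq G limit_covariance"
proof (rule gaussian_process_exists, unfold_locales)
  show "(\<Sum>j<J. kernel_form UI limit_covariance (haar j) (haar j)) \<le> total_variance" for J
    using trace_limit_covariance_le[of UNIV J] by simp
qed (rule square_integrable_limit_covariance limit_covariance_sym kernel_form_limit_covariance_nonneg;
    assumption?)+

subsection \<open>The normalized difference of the sample means\<close>

definition normalized_difference :: "nat \<Rightarrow> nat \<Rightarrow> 'a \<Rightarrow> real \<Rightarrow> real" where
  "normalized_difference N K \<omega> t = sqrt (real K / (real N + real K)) * X.normalized_error N \<omega> t
     - sqrt (real N / (real N + real K)) * Y.normalized_error K \<omega> t"

lemma weights_le_1: "sqrt (real K / (real N + real K)) \<le> 1" "sqrt (real N / (real N + real K)) \<le> 1"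
  by (auto simp: divide_le_eq_1)

lemma square_integrable_normalized_difference:
  "square_integrable (M \<Otimes>\<^sub>M UI) (\<lambda>(\<omega>, t). normalized_difference N K \<omega> t)"
  using square_integrable_diff[OF square_integrable_cmult[OF X.square_integrable_normalized_error]
      square_integrable_cmult[OF Y.square_integrable_normalized_error]]
  by (simp add: normalized_difference_def split_beta')

lemma square_integrable_normalized_difference_path:
  "\<omega> \<in> space M \<Longrightarrow> square_integrable UI (normalized_difference N K \<omega>)"
  unfolding normalized_difference_def[abs_def]
  by (intro square_integrable_diff square_integrable_cmult X.square_integrable_normalized_error_path
      Y.square_integrable_normalized_error_path)

lemma inner_normalized_difference:
  assumes \<omega>: "\<omega> \<in> space M" and h: "square_integrable UI h"
  shows "(\<integral>t. normalized_difference N K \<omega> t * h t \<partial>UI)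
    = sqrt (real K / (real N + real K)) * X.error_coefficient h N \<omega>
      - sqrt (real N / (real N + real K)) * Y.error_coefficient h K \<omega>"
proof -
  let ?a = "sqrt (real K / (real N + real K))" and ?b = "sqrt (real N / (real N + real K))"
  have "(\<integral>t. normalized_difference N K \<omega> t * h t \<partial>UI)
      = (\<integral>t. ?a * (X.normalized_error N \<omega> t * h t) - ?b * (Y.normalized_error K \<omega> t * h t) \<partial>UI)"
    by (simp add: normalized_difference_def left_diff_distrib mult.assoc)
  then show ?thesis
    using integrable_mult[OF X.square_integrable_normalized_error_path[OF \<omega>] h]
      integrable_mult[OF Y.square_integrable_normalized_error_path[OF \<omega>] h]
    by (simp add: X.inner_normalized_error[OF \<omega> h] Y.inner_normalized_error[OF \<omega> h])
qed

definition difference_coefficient :: "nat \<Rightarrow> nat \<Rightarrow> nat \<Rightarrow> 'a \<Rightarrow> real" where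
  "difference_coefficient N K j \<omega> = (\<integral>t. normalized_difference N K \<omega> t * haar j t \<partial>UI)"

lemma square_integrable_difference_coefficient: "square_integrable M (difference_coefficient N K j)"
  unfolding difference_coefficient_def[abs_def]
  by (rule sample_UI.square_integrable_inner(1)[OF square_integrable_normalized_difference
      square_integrable_haar])

definition coefficient_bound :: "nat \<Rightarrow> real" where
  "coefficient_bound j = 2 * X.field.variance_bound j + 2 * Y.field.variance_bound j"

lemma summable_coefficient_bound: "summable coefficient_bound"
  unfolding coefficient_bound_def[abs_def]
  by (intro summable_add summable_mult X.field.summable_variance_bound Y.field.summable_variance_bound)

lemma l2norm_difference_coefficient_square_le:
  "(l2norm M (difference_coefficient N K j))\<^sup>2 \<le> coefficient_bound j"
proof -
  let ?X = "X.error_coefficient (haar j) N" and ?Y = "Y.error_coefficient (haar j) K"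
    and ?a = "sqrt (real K / (real N + real K))" and ?b = "sqrt (real N / (real N + real K))"
  have "l2norm M (difference_coefficient N K j) = l2norm M (\<lambda>\<omega>. ?a * ?X \<omega> - ?b * ?Y \<omega>)"
    unfolding difference_coefficient_def
    by (intro l2norm_cong inner_normalized_difference square_integrable_haar)
  also have "\<dots> \<le> l2norm M (\<lambda>\<omega>. ?a * ?X \<omega>) + l2norm M (\<lambda>\<omega>. ?b * ?Y \<omega>)"
    by (intro l2norm_diff_le square_integrable_cmult X.square_integrable_error_coefficient
        Y.square_integrable_error_coefficient square_integrable_haar)
  also have "\<dots> \<le> 1 * l2norm M ?X + 1 * l2norm M ?Y"
    unfolding l2norm_cmult using weights_le_1(1)[of K N] weights_le_1(2)[of N K]
    by (intro add_mono mult_right_mono) auto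
  finally have "(l2norm M (difference_coefficient N K j))\<^sup>2 \<le> (l2norm M ?X + l2norm M ?Y)\<^sup>2"
    by (intro power_mono) auto
  also have "\<dots> \<le> 2 * (l2norm M ?X)\<^sup>2 + 2 * (l2norm M ?Y)\<^sup>2"
    using sum_squares_bound[of "l2norm M ?X" "l2norm M ?Y"] by (simp add: power2_sum)
  also have "\<dots> \<le> coefficient_bound j"
    unfolding coefficient_bound_def
    by (intro add_mono mult_left_mono X.l2norm_error_coefficient_haar_square_le
        Y.l2norm_error_coefficient_haar_square_le) auto
  finally show ?thesis .
qed

lemma integral_normalized_difference_square:
  "integrable M (\<lambda>\<omega>. \<integral>t. (normalized_difference N K \<omega> t)\<^sup>2 \<partial>UI)"
  "X.expectation (\<lambda>\<omega>. \<integral>t. (normalized_difference N K \<omega> t)\<^sup>2 \<partial>UI)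
    = (l2norm (M \<Otimes>\<^sub>M UI) (\<lambda>(\<omega>, t). normalized_difference N K \<omega> t))\<^sup>2"
  using integrable_square[OF
      sample_UI.square_integrable_section(2)[OF square_integrable_normalized_difference]]
    l2norm_square[of M "\<lambda>\<omega>. l2norm UI (normalized_difference N K \<omega>)"]
    sample_UI.square_integrable_section(3)[OF square_integrable_normalized_difference, of N K]
  by (simp_all add: l2norm_square)

lemma sum_difference_coefficient_square_le:
  assumes "\<omega> \<in> space M"
  shows "(\<Sum>j<J. (difference_coefficient N K j \<omega>)\<^sup>2) \<le> (\<integral>t. (normalized_difference N K \<omega> t)\<^sup>2 \<partial>UI)"
proof -
  note Parseval = haar.Parseval[OF square_integrable_normalized_difference_path[OF assms, of N K]]
  show ?thesis
    unfolding difference_coefficient_def l2norm_square[symmetric] sums_unique[OF Parseval]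
    by (rule sum_le_suminf[OF sums_summable[OF Parseval]]) auto
qed

lemma laplace_truncation_error_le:
  assumes l: "0 \<le> l"
  shows "\<bar>X.expectation (\<lambda>\<omega>. exp (- (l * (\<integral>t. (normalized_difference N K \<omega> t)\<^sup>2 \<partial>UI))))
      - X.expectation (\<lambda>\<omega>. exp (- (l * (\<Sum>j<J. (difference_coefficient N K j \<omega>)\<^sup>2))))\<bar>
    \<le> l * (\<Sum>j. coefficient_bound (j + J))"
proof -
  let ?Q = "\<lambda>\<omega>. \<integral>t. (normalized_difference N K \<omega> t)\<^sup>2 \<partial>UI" and ?R
      = "\<lambda>\<omega>. \<Sum>j<J. (difference_coefficient N K j \<omega>)\<^sup>2"
  note coefficient = integrable_square[OF square_integrable_difference_coefficient]
  have R: "integrable M ?R" by (intro Bochner_Integration.integrable_sum coefficient)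
  have "\<bar>X.expectation (\<lambda>\<omega>. exp (- (l * ?Q \<omega>))) - X.expectation (\<lambda>\<omega>. exp (- (l * ?R \<omega>)))\<bar>
      \<le> l * (X.expectation ?Q - X.expectation ?R)"
    by (rule X.laplace_diff_le[OF l])
      (auto intro!: borel_measurable_integrable integral_normalized_difference_square(1) R
        sum_nonneg sum_difference_coefficient_square_le)
  also have "X.expectation ?R = (\<Sum>j<J. (l2norm M (difference_coefficient N K j))\<^sup>2)"
    unfolding l2norm_square by (rule Bochner_Integration.integral_sum[OF coefficient])
  also have "X.expectation ?Q - \<dots> \<le> (\<Sum>j. coefficient_bound (j + J))"
    unfolding integral_normalized_difference_square(2)
  proof (rule sums_minus_partial_sum_le[OF _ summable_coefficient_bound
      l2norm_difference_coefficient_square_le])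
    show "(\<lambda>j. (l2norm M (difference_coefficient N K j))\<^sup>2)
        sums (l2norm (M \<Otimes>\<^sub>M UI) (\<lambda>(\<omega>, t). normalized_difference N K \<omega> t))\<^sup>2"
      using haar.Parseval_l2norm_sections[OF X.sigma_finite_measure_axioms
          square_integrable_normalized_difference]
      by (simp add: difference_coefficient_def[abs_def])
  qed
  finally show ?thesis using l by (simp add: mult_left_mono)
qed

subsection \<open>Convergence of the coefficients\<close>

lemma char_inner_normalized_difference:
  assumes h: "h \<in> L2"
  shows "char (distr M borel (\<lambda>\<omega>. \<integral>t. normalized_difference N K \<omega> t * h t \<partial>UI)) u
    = char (distr M borel (\<lambda>\<omega>. sqrt (real K / (real N + real K)) * X.error_coefficient h N \<omega>)) u
      * char (distr M borel (\<lambda>\<omega>. - sqrt (real N / (real N + real K)) * Y.error_coefficient h K \<omega>)) u"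
proof -
  let ?a = "sqrt (real K / (real N + real K))" and ?b = "- sqrt (real N / (real N + real K))"
  let ?I = "{1::int..} \<times> L2" and ?s = "\<lambda>n z. (\<Sum>i=1..int n. z (i, h)) / sqrt (real n) :: real"
  define V where "V \<omega> = ?a * ?s N (\<lambda>p\<in>?I. LINT t:{0..1}|lborel. eps (fst p) \<omega> t * snd p t)" for \<omega>
  define W where "W \<omega> = ?b * ?s K (\<lambda>p\<in>?I. LINT t:{0..1}|lborel. eps_s (fst p) \<omega> t * snd p t)" for \<omega>
  have V: "V \<omega> = ?a * X.error_coefficient h N \<omega>" and W: "W \<omega> = ?b * Y.error_coefficient h K \<omega>"
    if "\<omega> \<in> space M" for \<omega>
    using that h by (simp_all add: V_def W_def X.error_coefficient_eq Y.error_coefficient_eq)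
  have "(\<lambda>z. c * ?s n z) \<in> borel_measurable (PiM ?I (\<lambda>_. borel))" for c n
    using h by (intro borel_measurable_times borel_measurable_divide borel_measurable_sum) auto
  from X.indep_var_compose[OF indep this[of ?a N] this[of ?b K]]
  have "X.indep_var borel V borel W"
    by (simp add: comp_def V_def[abs_def] W_def[abs_def])
  then have "char (distr M borel (\<lambda>\<omega>. V \<omega> + W \<omega>)) u = char (distr M borel V) u * char (distr M borel W) u"
    by (rule X.char_distr_add)
  moreover have "distr M borel (\<lambda>\<omega>. V \<omega> + W \<omega>)
      = distr M borel (\<lambda>\<omega>. \<integral>t. normalized_difference N K \<omega> t * h t \<partial>UI)"
    using h by (intro distr_cong refl) (simp add: V W inner_normalized_difference L2_iff_square_integrable_UI)
  moreover have "distr M borel V = distr M borel (\<lambda>\<omega>. ?a * X.error_coefficient h N \<omega>)"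
    "distr M borel W = distr M borel (\<lambda>\<omega>. ?b * Y.error_coefficient h K \<omega>)"
    by (intro distr_cong refl V W; assumption)+
  ultimately show ?thesis by simp
qed

context
  fixes Nk Kk :: "nat \<Rightarrow> nat"
  assumes sizes: "filterlim (\<lambda>k. min (Nk k) (Kk k)) at_top sequentially"
    and ratio: "(\<lambda>k. real (Nk k) / (real (Nk k) + real (Kk k))) \<longlonglongrightarrow> \<theta>"
begin

lemma sizes_at_top: "filterlim Nk at_top sequentially" "filterlim Kk at_top sequentially"
  by (rule filterlim_at_top_mono[OF sizes], simp)+

lemma weights_tendsto:
  "(\<lambda>k. sqrt (real (Kk k) / (real (Nk k) + real (Kk k)))) \<longlonglongrightarrow> sqrt (1 - \<theta>)"
  "(\<lambda>k. sqrt (real (Nk k) / (real (Nk k) + real (Kk k)))) \<longlonglongrightarrow> sqrt \<theta>"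
proof -
  have "\<forall>\<^sub>F k in sequentially. 1 \<le> Nk k"
    using sizes_at_top(1) by (simp add: filterlim_at_top)
  then have "\<forall>\<^sub>F k in sequentially.
      1 - real (Nk k) / (real (Nk k) + real (Kk k)) = real (Kk k) / (real (Nk k) + real (Kk k))"
    by eventually_elim (simp add: field_simps)
  moreover have "(\<lambda>k. 1 - real (Nk k) / (real (Nk k) + real (Kk k))) \<longlonglongrightarrow> 1 - \<theta>"
    by (intro tendsto_intros ratio)
  ultimately have "(\<lambda>k. real (Kk k) / (real (Nk k) + real (Kk k))) \<longlonglongrightarrow> 1 - \<theta>"
    by (rule Lim_transform_eventually[rotated])
  then show "(\<lambda>k. sqrt (real (Kk k) / (real (Nk k) + real (Kk k)))) \<longlonglongrightarrow> sqrt (1 - \<theta>)"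
    by (rule tendsto_real_sqrt)
  show "(\<lambda>k. sqrt (real (Nk k) / (real (Nk k) + real (Kk k)))) \<longlonglongrightarrow> sqrt \<theta>"
    by (rule tendsto_real_sqrt[OF ratio])
qed

lemma char_inner_tendsto:
  assumes h: "h \<in> L2"
  shows "(\<lambda>k. char (distr M borel (\<lambda>\<omega>. \<integral>t. normalized_difference (Nk k) (Kk k) \<omega> t * h t \<partial>UI)) u)
    \<longlonglongrightarrow> complex_of_real (exp (- (u\<^sup>2 * kernel_form UI limit_covariance h h) / 2))"
proof -
  let ?X = "kernel_form UI (lrcov M eps) h h" and ?Y = "kernel_form UI (lrcov M eps_s) h h"
  have h_UI: "square_integrable UI h" using h by (simp add: L2_iff_square_integrable_UI)
  have "(\<lambda>k. char (distr M borel (\<lambda>\<omega>. \<integral>t. normalized_difference (Nk k) (Kk k) \<omega> t * h t \<partial>UI)) u)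
      \<longlonglongrightarrow> complex_of_real (exp (- (u\<^sup>2 * ((sqrt (1 - \<theta>))\<^sup>2 * ?X)) / 2))
        * complex_of_real (exp (- (u\<^sup>2 * ((- sqrt \<theta>)\<^sup>2 * ?Y)) / 2))"
    unfolding char_inner_normalized_difference[OF h]
    by (intro tendsto_mult X.scaled_error_coefficient_CLT[OF h_UI sizes_at_top(1) weights_tendsto(1)]
        Y.scaled_error_coefficient_CLT[OF h_UI sizes_at_top(2) tendsto_minus[OF weights_tendsto(2)]])
  also have "complex_of_real (exp (- (u\<^sup>2 * ((sqrt (1 - \<theta>))\<^sup>2 * ?X)) / 2))
        * complex_of_real (exp (- (u\<^sup>2 * ((- sqrt \<theta>)\<^sup>2 * ?Y)) / 2))
      = complex_of_real (exp (- (u\<^sup>2 * ((1 - \<theta>) * ?X)) / 2 + - (u\<^sup>2 * (\<theta> * ?Y)) / 2))"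
    using \<theta> by (simp only: exp_add of_real_mult real_sqrt_pow2 diff_ge_0_iff_ge power2_minus)
  also have "- (u\<^sup>2 * ((1 - \<theta>) * ?X)) / 2 + - (u\<^sup>2 * (\<theta> * ?Y)) / 2
      = - (u\<^sup>2 * kernel_form UI limit_covariance h h) / 2"
    by (simp add: kernel_form_limit_covariance[OF h_UI] field_simps)
  finally show ?thesis .
qed

context
  fixes \<Omega> :: "'b measure" and G
  assumes process: "gaussian_process \<Omega> G limit_covariance"
begin

interpretation limit: trace_class_gaussian_process \<Omega> G limit_covariance total_variance
  by unfold_locales (rule process square_integrable_limit_covariance trace_limit_covariance_le; assumption?)+

interpretation limit_UI: pair_prob_space \<Omega> UI ..

lemma char_coefficients_tendsto:
  "(\<lambda>k. char (distr M borel (\<lambda>\<omega>. \<Sum>j<J. \<xi> j * difference_coefficient (Nk k) (Kk k) j \<omega>)) u)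
    \<longlonglongrightarrow> char (distr \<Omega> borel (\<lambda>\<omega>. \<Sum>j<J. \<xi> j * (\<integral>t. G \<omega> t * haar j t \<partial>UI))) u"
proof -
  let ?h = "\<lambda>t. \<Sum>j<J. \<xi> j * haar j t"
  have h: "square_integrable UI ?h" using sum_haar_L2 by (simp add: L2_iff_square_integrable_UI)
  obtain c where c: "\<forall>t. \<bar>?h t\<bar> \<le> c" using sum_haar_bounded by blast
  have "centred_gaussian \<Omega> (\<lambda>\<omega>. \<integral>t. G \<omega> t * ?h t \<partial>UI)"
    by (rule limit.centred_gaussian_inner[of _ c]) (use c in auto)
  then have gaussian: "square_integrable \<Omega> (\<lambda>\<omega>. \<integral>t. G \<omega> t * ?h t \<partial>UI)"
      "char (distr \<Omega> borel (\<lambda>\<omega>. \<integral>t. G \<omega> t * ?h t \<partial>UI)) u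
        = complex_of_real (exp (- (u\<^sup>2 * kernel_form UI limit_covariance ?h ?h) / 2))"
    by (simp_all add: centred_gaussian_def limit.l2norm_inner_square[OF h])
  note coefficient = limit_UI.square_integrable_inner(1)[OF limit.square_integrable_process
      square_integrable_haar]
  have "distr M borel (\<lambda>\<omega>. \<Sum>j<J. \<xi> j * difference_coefficient (Nk k) (Kk k) j \<omega>)
      = distr M borel (\<lambda>\<omega>. \<integral>t. normalized_difference (Nk k) (Kk k) \<omega> t * ?h t \<partial>UI)" for k
    unfolding difference_coefficient_def
    by (intro distr_cong refl haar.integral_mult_sum_basis[symmetric]
        square_integrable_normalized_difference_path)
  moreover have "distr \<Omega> borel (\<lambda>\<omega>. \<Sum>j<J. \<xi> j * (\<integral>t. G \<omega> t * haar j t \<partial>UI))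
      = distr \<Omega> borel (\<lambda>\<omega>. \<integral>t. G \<omega> t * ?h t \<partial>UI)"
  proof (rule distr_cong_AE)
    show "AE \<omega> in \<Omega>. (\<Sum>j<J. \<xi> j * (\<integral>t. G \<omega> t * haar j t \<partial>UI)) = (\<integral>t. G \<omega> t * ?h t \<partial>UI)"
      using limit_UI.square_integrable_section(1)[OF limit.square_integrable_process]
      by eventually_elim (rule haar.integral_mult_sum_basis[symmetric])
    show "(\<lambda>\<omega>. \<Sum>j<J. \<xi> j * (\<integral>t. G \<omega> t * haar j t \<partial>UI)) \<in> borel_measurable \<Omega>"
      by (intro borel_measurable_square_integrable square_integrable_sum square_integrable_cmult coefficient)
    show "(\<lambda>\<omega>. \<integral>t. G \<omega> t * ?h t \<partial>UI) \<in> borel_measurable \<Omega>"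
      by (rule borel_measurable_square_integrable[OF gaussian(1)])
  qed simp_all
  ultimately show ?thesis
    using char_inner_tendsto[OF sum_haar_L2, of \<xi> J u] by (simp only: gaussian(2))
qed

lemma laplace_tendsto:
  assumes l: "0 \<le> l"
  shows "(\<lambda>k. \<integral>\<omega>. exp (- (l * (\<integral>t. (normalized_difference (Nk k) (Kk k) \<omega> t)\<^sup>2 \<partial>UI))) \<partial>M)
    \<longlonglongrightarrow> (\<integral>\<omega>. exp (- (l * (\<integral>t. (G \<omega> t)\<^sup>2 \<partial>UI))) \<partial>\<Omega>)"
proof (rule tendsto_uniform_approximation[where err = "\<lambda>J k. l * (\<Sum>j. coefficient_bound (j + J))"])
  show "(\<lambda>k. \<integral>\<omega>. exp (- (l * (\<Sum>j<J. (difference_coefficient (Nk k) (Kk k) j \<omega>)\<^sup>2))) \<partial>M)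
      \<longlonglongrightarrow> (\<integral>\<omega>. exp (- (l * (\<Sum>j<J. (\<integral>t. G \<omega> t * haar j t \<partial>UI)\<^sup>2))) \<partial>\<Omega>)" for J
    by (rule laplace_tendsto_if_char_tendsto[OF X.prob_space_axioms limit.prob_space_axioms _ _ l
        char_coefficients_tendsto])
       (intro borel_measurable_square_integrable square_integrable_difference_coefficient
          limit_UI.square_integrable_inner(1)[OF limit.square_integrable_process square_integrable_haar])+
  show "(\<lambda>J. \<integral>\<omega>. exp (- (l * (\<Sum>j<J. (\<integral>t. G \<omega> t * haar j t \<partial>UI)\<^sup>2))) \<partial>\<Omega>)
      \<longlonglongrightarrow> (\<integral>\<omega>. exp (- (l * (\<integral>t. (G \<omega> t)\<^sup>2 \<partial>UI))) \<partial>\<Omega>)"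
    by (rule haar.laplace_partial_sums_tendsto[OF limit.prob_space_axioms limit.square_integrable_process l])
  show "\<forall>\<^sub>F k in sequentially. norm ((\<integral>\<omega>. exp (- (l * (\<integral>t. (normalized_difference (Nk k) (Kk k) \<omega> t)\<^sup>2
      \<partial>UI))) \<partial>M)
      - (\<integral>\<omega>. exp (- (l * (\<Sum>j<J. (difference_coefficient (Nk k) (Kk k) j \<omega>)\<^sup>2))) \<partial>M))
      \<le> l * (\<Sum>j. coefficient_bound (j + J))" for J
    using laplace_truncation_error_le[OF l] by simp
  show "(\<lambda>J. l * (\<Sum>j. coefficient_bound (j + J))) \<longlonglongrightarrow> 0"
    by (rule tendsto_mult_right_zero[OF suminf_exist_split2[OF summable_coefficient_bound]])
qed simp

theorem weak_convergence:
  "weak_conv_m (\<lambda>k. distr M borel (\<lambda>\<omega>. \<integral>t. (normalized_difference (Nk k) (Kk k) \<omega> t)\<^sup>2 \<partial>UI))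
    (distr \<Omega> borel (\<lambda>\<omega>. \<integral>t. (G \<omega> t)\<^sup>2 \<partial>UI))"
proof (rule weak_conv_if_laplace_tendsto[OF X.prob_space_axioms limit.prob_space_axioms])
  note [measurable] = borel_measurable_square_integrable[OF square_integrable_normalized_difference]
    borel_measurable_square_integrable[OF limit.square_integrable_process]
  show "(\<lambda>\<omega>. \<integral>t. (normalized_difference (Nk k) (Kk k) \<omega> t)\<^sup>2 \<partial>UI) \<in> borel_measurable M" for k
    by measurable
  show "(\<lambda>\<omega>. \<integral>t. (G \<omega> t)\<^sup>2 \<partial>UI) \<in> borel_measurable \<Omega>"
    by measurable
qed (simp_all add: laplace_tendsto)

end

end

subsection \<open>The statistic under the null hypothesis\<close>

lemma normalized_difference_eq:
  assumes \<omega>: "\<omega> \<in> space M" and N: "0 < N" and K: "0 < K"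
  shows "normalized_difference N K \<omega> t = sqrt (real N * real K / (real N + real K))
    * ((\<Sum>i=1..int N. eps i \<omega> t) / real N - (\<Sum>j=1..int K. eps_s j \<omega> t) / real K)"
proof -
  have "sqrt (real K / (real N + real K)) * (x / sqrt (real N))
      = sqrt (real N * real K / (real N + real K)) * (x / real N)"
    "sqrt (real N / (real N + real K)) * (x / sqrt (real K))
        = sqrt (real N * real K / (real N + real K)) * (x / real K)"
    for x
    using N K by (simp_all add: real_sqrt_mult real_sqrt_divide field_simps)
  then show ?thesis
    by (simp add: normalized_difference_def X.normalized_error_eq[OF \<omega>] Y.normalized_error_eq[OF \<omega>]
        right_diff_distrib)
qed

lemma U_stat_eq:
  assumes \<omega>: "\<omega> \<in> space M" and \<mu>: "\<mu> \<in> L2" "\<mu>s \<in> L2" and H0: "(LINT t:{0..1}|lborel. (\<mu> t - \<mu>s t)\<^sup>2) = 0"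
  shows "U_stat (\<lambda>i \<omega> t. \<mu> t + eps i \<omega> t) (\<lambda>j \<omega> t. \<mu>s t + eps_s j \<omega> t) N K \<omega>
    = (\<integral>t. (normalized_difference N K \<omega> t)\<^sup>2 \<partial>UI)"
proof (cases "N = 0 \<or> K = 0")
  case True
  then show ?thesis
    by (auto simp: U_stat_def normalized_difference_def X.normalized_error_eq[OF \<omega>]
        Y.normalized_error_eq[OF \<omega>])
next
  case False
  then have N: "0 < N" and K: "0 < K" by auto
  let ?c = "real N * real K / (real N + real K)"
  let ?x = "\<lambda>t. (\<Sum>i=1..int N. eps i \<omega> t) / real N" and ?y = "\<lambda>t. (\<Sum>j=1..int K. eps_s j \<omega> t) / real K"
  have [measurable]: "\<mu> \<in> borel_measurable borel" "\<mu>s \<in> borel_measurable borel"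
    "eps i \<omega> \<in> borel_measurable borel" "eps_s i \<omega> \<in> borel_measurable borel" for i
    using \<mu> X.eps_square_integrable[OF \<omega>] Y.eps_square_integrable[OF \<omega>]
    by (auto simp: L2_iff_square_integrable_UI[symmetric] L2_def)
  have "l2norm UI (\<lambda>t. \<mu> t - \<mu>s t) = 0" using H0 by (simp add: l2norm_def integral_UI)
  then have "AE t in UI. \<mu> t - \<mu>s t = 0"
    using \<mu> by (intro l2norm_eq_0_imp_AE square_integrable_diff) (simp_all add: L2_iff_square_integrable_UI)
  then have AE_eq: "AE t in UI. ((\<mu> t + ?x t) - (\<mu>s t + ?y t))\<^sup>2 = (?x t - ?y t)\<^sup>2"
    by eventually_elim simp
  have "U_stat (\<lambda>i \<omega> t. \<mu> t + eps i \<omega> t) (\<lambda>j \<omega> t. \<mu>s t + eps_s j \<omega> t) N K \<omega>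
      = ?c * (\<integral>t. ((\<mu> t + ?x t) - (\<mu>s t + ?y t))\<^sup>2 \<partial>UI)"
    using N K by (simp add: U_stat_def integral_UI sum.distrib add_divide_distrib)
  also have "(\<integral>t. ((\<mu> t + ?x t) - (\<mu>s t + ?y t))\<^sup>2 \<partial>UI) = (\<integral>t. (?x t - ?y t)\<^sup>2 \<partial>UI)"
    by (rule integral_cong_AE[OF _ _ AE_eq]) measurable
  also have "?c * (\<integral>t. (?x t - ?y t)\<^sup>2 \<partial>UI) = (\<integral>t. (normalized_difference N K \<omega> t)\<^sup>2 \<partial>UI)"
    by (simp add: normalized_difference_eq[OF \<omega> N K] power_mult_distrib)
  finally show ?thesis .
qed

end

lemma distr_integral_square_process:
  assumes "gaussian_process \<Omega> G d"
  shows "distr \<Omega> borel (\<lambda>\<omega>. LINT t:{0..1}|lborel. (G \<omega> t)\<^sup>2) = distr \<Omega> borel (\<lambda>\<omega>. \<integral>t. (G \<omega> t)\<^sup>2 \<partial>UI)"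
proof (intro distr_cong refl)
  fix \<omega> assume "\<omega> \<in> space \<Omega>"
  moreover have "(\<lambda>(\<omega>, t). G \<omega> t) \<in> borel_measurable (\<Omega> \<Otimes>\<^sub>M lborel)"
    using assms by (simp add: gaussian_process_def)
  ultimately have "G \<omega> \<in> borel_measurable borel"
    using measurable_Pair2[of "\<lambda>(\<omega>, t). G \<omega> t" \<Omega> lborel borel \<omega>] by simp
  then show "(LINT t:{0..1}|lborel. (G \<omega> t)\<^sup>2) = (\<integral>t. (G \<omega> t)\<^sup>2 \<partial>UI)"
    by (intro integral_UI[symmetric]) simp
qed

theorem theorem3:
  fixes M :: "'a measure"
    and S :: "'s measure" and \<delta> :: "int \<Rightarrow> 'a \<Rightarrow> 's" and f :: "(nat \<Rightarrow> 's) \<Rightarrow> real \<Rightarrow> real"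
    and Ss :: "'t measure" and \<delta>s :: "int \<Rightarrow> 'a \<Rightarrow> 't" and fs :: "(nat \<Rightarrow> 't) \<Rightarrow> real \<Rightarrow> real"
    and eps eps_s :: "int \<Rightarrow> 'a \<Rightarrow> real \<Rightarrow> real"
    and \<mu> \<mu>s :: "real \<Rightarrow> real"
    and \<theta> :: real
  assumes "prob_space M"
    and "error_assumptions M S \<delta> f eps"
    and "error_assumptions M Ss \<delta>s fs eps_s"
    and "\<mu> \<in> L2" and "\<mu>s \<in> L2"
    and "prob_space.indep_var M
           (PiM ({1..} \<times> L2) (\<lambda>_. borel))
           (\<lambda>\<omega>. \<lambda>p\<in>{1..} \<times> L2. LINT t:{0..1}|lborel. eps (fst p) \<omega> t * snd p t)
           (PiM ({1..} \<times> L2) (\<lambda>_. borel))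
           (\<lambda>\<omega>. \<lambda>p\<in>{1..} \<times> L2. LINT t:{0..1}|lborel. eps_s (fst p) \<omega> t * snd p t)"
    and H0: "(LINT t:{0..1}|lborel. (\<mu> t - \<mu>s t)^2) = 0"
    and "0 \<le> \<theta>" and "\<theta> \<le> 1"
  shows "(\<exists>(\<Omega> :: (nat \<Rightarrow> real) measure) G.
            gaussian_process \<Omega> G (\<lambda>t s. (1 - \<theta>) * lrcov M eps t s + \<theta> * lrcov M eps_s t s)) \<and>
         (\<forall>(\<Omega> :: 'b measure) G.
            gaussian_process \<Omega> G (\<lambda>t s. (1 - \<theta>) * lrcov M eps t s + \<theta> * lrcov M eps_s t s) \<longrightarrow>
            (\<forall>Nk Kk :: nat \<Rightarrow> nat.
               filterlim (\<lambda>k. min (Nk k) (Kk k)) at_top sequentially \<longrightarrow>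
               (\<lambda>k. real (Nk k) / (real (Nk k) + real (Kk k))) \<longlonglongrightarrow> \<theta> \<longrightarrow>
               weak_conv_m
                 (\<lambda>k. distr M borel
                    (U_stat (\<lambda>i \<omega> t. \<mu> t + eps i \<omega> t) (\<lambda>j \<omega> t. \<mu>s t + eps_s j \<omega> t) (Nk k) (Kk k)))
                 (distr \<Omega> borel (\<lambda>\<omega>. LINT t:{0..1}|lborel. (G \<omega> t)^2))))"
proof -
  interpret prob_space M by fact
  interpret two_sample M S \<delta> f eps Ss \<delta>s fs eps_s \<theta>
    by unfold_locales (rule assms)+
  have U_stat: "distr M borel (U_stat (\<lambda>i \<omega> t. \<mu> t + eps i \<omega> t) (\<lambda>j \<omega> t. \<mu>s t + eps_s j \<omega> t) N K)
      = distr M borel (\<lambda>\<omega>. \<integral>t. (normalized_difference N K \<omega> t)\<^sup>2 \<partial>UI)" for N K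
    by (intro distr_cong refl U_stat_eq assms)
  have norm: "distr \<Omega> borel (\<lambda>\<omega>. LINT t:{0..1}|lborel. (G \<omega> t)\<^sup>2) = distr \<Omega> borel (\<lambda>\<omega>. \<integral>t. (G \<omega> t)\<^sup>2 \<partial>UI)"
    if "gaussian_process \<Omega> G limit_covariance" for \<Omega> :: "'b measure" and G
    using that by (rule distr_integral_square_process)
  show ?thesis
    unfolding limit_covariance_def[abs_def, symmetric]
    using limit_process_exists weak_convergence by (auto simp: U_stat norm)
qed

end
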